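(* Let $d\ge 1$, let $n \geq 2$ be an integer and let $G$ be a Sobolev metric of order $n$ with constant coefficients on $\mathcal{I}^n(S^1,\mathbb{R}^d)$, with geodesic distance $\mathrm{dist}$ and metric balls $B(c_0,r)$. Then: \begin{enumerate} \item Given a metric ball $B(c_0,r)$ in $\mathcal{I}^n(S^1,\mathbb{R}^d)$, there exists $C$ such that \[ \| c_1 - c_2 \|_{H^n(d\theta)} \leq C\, \mathrm{dist}(c_1, c_2) \] holds for all $c_1, c_2 \in B(c_0,r)$. \item Given $c_0 \in \mathcal{I}^n(S^1,\mathbb{R}^d)$, there exist $r>0$ and $C$ such that \[ \mathrm{dist}(c_1, c_2) \leq C\, \| c_1 - c_2 \|_{H^n(d\theta)} \] holds for all $c_1, c_2 \in B(c_0,r)$. \end{enumerate}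
   Context: $\mathcal{I}^n(S^1,\mathbb{R}^d)=\{c\in H^n(S^1,\mathbb{R}^d): c'(\theta)\neq 0\text{ for all }\theta\}$ is the space of Sobolev immersions, an open subset of the Hilbert space $H^n(S^1,\mathbb{R}^d)$ (whose elements are $C^1$ for $n\ge 2$), with norm $\|h\|^2_{H^n(d\theta)}=\int_{S^1}|h|^2+|\partial_\theta^n h|^2\,\mathrm{d}\theta$; its tangent space at each $c$ is $H^n(S^1,\mathbb{R}^d)$. For a curve $c$, $D_s=\frac{1}{|c'|}\partial_\theta$ and $\mathrm{d}s=|c'|\,\mathrm{d}\theta$. A Sobolev metric of order $n$ with constant coefficients is \[ G_c(h_1,h_2)=\int_{S^1} \sum_{j=0}^n a_j\langle D_s^j h_1,D_s^j h_2\rangle\,\mathrm{d}s \] with constants $a_j\ge 0$, $a_0>0$, $a_n>0$. The geodesic distance $\mathrm{dist}(c_1,c_2)$ is the infimum of $L(c)=\int_0^1\sqrt{G_{c(t)}(\dot c(t),\dot c(t))}\,\mathrm{d}t$ over piecewise smooth paths $c:[0,1]\to\mathcal{I}^n(S^1,\mathbb{R}^d)$ from $c_1$ to $c_2$ (equal to $+\infty$ if there is no such path), and $B(c_0,r)=\{c:\mathrm{dist}(c_0,c)<r\}$. *)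

theory Defs
  imports "HOL-Analysis.Analysis"
begin

text \<open>
  The circle is \<open>S\<^sup>1 = \<real> / 2\<pi>\<int>\<close>: functions on it are \<open>2\<pi>\<close>-periodic functions on the real line, and
  integrals over it are integrals over \<open>[0, 2\<pi>]\<close>.  All integrands below are Lebesgue integrable
  on that interval, so that the Henstock-Kurzweil integral is the Lebesgue integral.
\<close>

definition periodic :: "(real \<Rightarrow> 'a) \<Rightarrow> bool" where
  "periodic f \<longleftrightarrow> (\<forall>\<theta>. f (\<theta> + 2 * pi) = f \<theta>)"

definition test_function :: "(real \<Rightarrow> real) \<Rightarrow> bool" where
  "test_function \<phi> \<longleftrightarrow> periodic \<phi> \<and> (\<forall>k \<theta>. (deriv ^^ k) \<phi> field_differentiable (at \<theta>))"

definition is_weak_deriv ::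
    "nat \<Rightarrow> (real \<Rightarrow> real ^ 'd) \<Rightarrow> (real \<Rightarrow> real ^ 'd) \<Rightarrow> bool" where
  "is_weak_deriv k f g \<longleftrightarrow>
     periodic f \<and> f absolutely_integrable_on {0..2 * pi} \<and>
     periodic g \<and> g absolutely_integrable_on {0..2 * pi} \<and>
     (\<forall>\<phi>. test_function \<phi> \<longrightarrow>
        integral {0..2 * pi} (\<lambda>\<theta>. (deriv ^^ k) \<phi> \<theta> *\<^sub>R f \<theta>) =
        (- 1) ^ k *\<^sub>R integral {0..2 * pi} (\<lambda>\<theta>. \<phi> \<theta> *\<^sub>R g \<theta>))"

text \<open>
  The \<open>k\<close>-th weak derivative is determined only up to null sets; below, \<open>weak_deriv\<close> is evaluated
  only under integrals over the circle.
\<close>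

definition weak_deriv :: "nat \<Rightarrow> (real \<Rightarrow> real ^ 'd) \<Rightarrow> real \<Rightarrow> real ^ 'd" where
  "weak_deriv k f = (SOME g. is_weak_deriv k f g)"

text \<open>
  An element of \<open>H\<^sup>n(S\<^sup>1, \<real>\<^sup>d)\<close>, \<open>n \<ge> 1\<close>, is an almost-everywhere class that contains exactly one
  continuous function.  It is represented by that function, so that equality in \<open>H\<^sup>n\<close> is equality
  of functions and the vector space operations are pointwise.
\<close>

definition Hn :: "nat \<Rightarrow> (real \<Rightarrow> real ^ 'd) set" where
  "Hn n = {f. continuous_on UNIV f \<and>
      (\<forall>k\<le>n. \<exists>g. is_weak_deriv k f g \<and> (\<lambda>\<theta>. (norm (g \<theta>))\<^sup>2) integrable_on {0..2 * pi})}"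

definition Hn_norm :: "nat \<Rightarrow> (real \<Rightarrow> real ^ 'd) \<Rightarrow> real" where
  "Hn_norm n h =
     sqrt (integral {0..2 * pi} (\<lambda>\<theta>. (norm (h \<theta>))\<^sup>2 + (norm (weak_deriv n h \<theta>))\<^sup>2))"

text \<open>
  For \<open>n \<ge> 2\<close> the elements of \<open>H\<^sup>n\<close> are continuously differentiable, so the velocity \<open>c'\<close> of a curve
  is the classical derivative, defined at every point.
\<close>

definition Imm :: "nat \<Rightarrow> (real \<Rightarrow> real ^ 'd) set" where
  "Imm n = {c \<in> Hn n. \<forall>\<theta>. vector_derivative c (at \<theta>) \<noteq> 0}"

definition speed :: "(real \<Rightarrow> real ^ 'd) \<Rightarrow> real \<Rightarrow> real" where
  "speed c \<theta> = norm (vector_derivative c (at \<theta>))"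

definition Ds :: "(real \<Rightarrow> real ^ 'd) \<Rightarrow> (real \<Rightarrow> real ^ 'd) \<Rightarrow> real \<Rightarrow> real ^ 'd" where
  "Ds c h = (\<lambda>\<theta>. (1 / speed c \<theta>) *\<^sub>R weak_deriv 1 h \<theta>)"

definition sobolev_metric ::
    "(nat \<Rightarrow> real) \<Rightarrow> nat \<Rightarrow> (real \<Rightarrow> real ^ 'd) \<Rightarrow> (real \<Rightarrow> real ^ 'd) \<Rightarrow> (real \<Rightarrow> real ^ 'd) \<Rightarrow> real"
  where
  "sobolev_metric a n c h1 h2 =
     integral {0..2 * pi}
       (\<lambda>\<theta>. (\<Sum>j\<le>n. a j * ((Ds c ^^ j) h1 \<theta> \<bullet> (Ds c ^^ j) h2 \<theta>)) * speed c \<theta>)"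

text \<open>
  Derivatives and smoothness of curves \<open>p\<close> in the Hilbert space \<open>H\<^sup>n\<close>, with difference quotients
  converging in the norm of \<open>H\<^sup>n\<close>; at the end points of an interval derivatives are one-sided.
\<close>

definition Hn_has_derivative ::
    "nat \<Rightarrow> (real \<Rightarrow> real \<Rightarrow> real ^ 'd) \<Rightarrow> (real \<Rightarrow> real ^ 'd) \<Rightarrow> real \<Rightarrow> real set \<Rightarrow> bool" where
  "Hn_has_derivative n p v t S \<longleftrightarrow>
     v \<in> Hn n \<and> (\<forall>s\<in>S. p s \<in> Hn n) \<and>
     ((\<lambda>s. Hn_norm n (\<lambda>\<theta>. (1 / (s - t)) *\<^sub>R (p s \<theta> - p t \<theta>) - v \<theta>)) \<longlongrightarrow> 0) (at t within S)"

definition Hn_smooth_on :: "nat \<Rightarrow> (real \<Rightarrow> real \<Rightarrow> real ^ 'd) \<Rightarrow> real set \<Rightarrow> bool" where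
  "Hn_smooth_on n p S \<longleftrightarrow>
     (\<exists>D. D 0 = p \<and> (\<forall>k. \<forall>t\<in>S. Hn_has_derivative n (D k) (D (Suc k) t) t S))"

text \<open>Smoothness on the closed pieces makes the whole path continuous.\<close>

definition piecewise_smooth_path :: "nat \<Rightarrow> (real \<Rightarrow> real \<Rightarrow> real ^ 'd) \<Rightarrow> bool" where
  "piecewise_smooth_path n p \<longleftrightarrow>
     (\<exists>m \<tau>. \<tau> 0 = 0 \<and> \<tau> m = 1 \<and>
        (\<forall>i<m. \<tau> i < \<tau> (Suc i) \<and> Hn_smooth_on n p {\<tau> i..\<tau> (Suc i)}))"

text \<open>At the finitely many break points of a path the value of \<open>Hn_velocity\<close> is immaterial.\<close>

definition Hn_velocity :: "nat \<Rightarrow> (real \<Rightarrow> real \<Rightarrow> real ^ 'd) \<Rightarrow> real \<Rightarrow> real \<Rightarrow> real ^ 'd" where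
  "Hn_velocity n p t = (SOME v. Hn_has_derivative n p v t {0..1})"

definition path_len :: "(nat \<Rightarrow> real) \<Rightarrow> nat \<Rightarrow> (real \<Rightarrow> real \<Rightarrow> real ^ 'd) \<Rightarrow> real" where
  "path_len a n p =
     integral {0..1} (\<lambda>t. sqrt (sobolev_metric a n (p t) (Hn_velocity n p t) (Hn_velocity n p t)))"

definition geod_dist ::
    "(nat \<Rightarrow> real) \<Rightarrow> nat \<Rightarrow> (real \<Rightarrow> real ^ 'd) \<Rightarrow> (real \<Rightarrow> real ^ 'd) \<Rightarrow> ereal" where
  "geod_dist a n c1 c2 =
     Inf {ereal (path_len a n p) | p.
            piecewise_smooth_path n p \<and> (\<forall>t\<in>{0..1}. p t \<in> Imm n) \<and> p 0 = c1 \<and> p 1 = c2}"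

definition geod_ball ::
    "(nat \<Rightarrow> real) \<Rightarrow> nat \<Rightarrow> (real \<Rightarrow> real ^ 'd) \<Rightarrow> real \<Rightarrow> (real \<Rightarrow> real ^ 'd) set" where
  "geod_ball a n c0 r = {c \<in> Imm n. geod_dist a n c0 c < ereal r}"

end

theory Submission
  imports Defs
begin

text \<open>
  Both estimates compare the norm \<open>sqrt (G\<^sub>c(h, h))\<close> with the fixed norm \<open>\<parallel>h\<parallel>\<close> of \<open>H\<^sup>n\<close>, at foot points \<open>c\<close>
  whose speed \<open>\<bar>c'\<bar>\<close> is bounded below and whose \<open>H\<^sup>n\<close> norm is bounded above.  Under such bounds the
  derivatives \<open>D\<^sub>s\<^sup>j h\<close> are controlled by those of \<open>h\<close> (\<open>metric_upper\<close>).  The content of the theorem is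
  the converse, together with the fact that foot points on a path of bounded length obey such bounds.

  Two facts about \<open>G\<^sub>c\<close> hold with constants that do not depend on \<open>c\<close> at all.  First, integration by
  parts over the closed curve shows that the squares of the \<open>L\<^sup>2(ds)\<close> norms of \<open>D\<^sub>s\<^sup>j h\<close> form a convex
  sequence in \<open>j\<close>; so all of them are bounded by the terms \<open>j = 0\<close> and \<open>j = n\<close>, that is, by
  \<open>G\<^sub>c(h, h)\<close> (\<open>chain_energy_le\<close>).  Secondly, each directional component of \<open>D\<^sub>s\<^sup>j h\<close>, \<open>j \<ge> 1\<close>, is the
  derivative of a periodic function and hence vanishes somewhere if \<open>j < n\<close>, so that \<open>D\<^sub>s\<^sup>j h\<close> is
  bounded uniformly for \<open>1 \<le> j < n\<close> (\<open>chain_sup\<close>).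

  For the velocity \<open>h\<close> of a path of curves \<open>c\<close>, the case \<open>j = 1\<close> says that \<open>ln \<bar>c'(\<theta>)\<bar>\<close> changes at most
  by a constant times the length of the path (\<open>path_log_speed\<close>).  The norms of \<open>c\<close> in \<open>H\<^sup>2, \<dots>, H\<^sup>n\<close>
  are then bounded one after the other.  Once the norm of order \<open>k + 1\<close> is under control, one has
  \<open>\<parallel>h\<parallel>\<^bsub>k+2\<^esub> \<le> C (1 + \<parallel>c\<parallel>\<^bsub>k+2\<^esub>) sqrt (G\<^sub>c(h, h))\<close>, because in the expansion of \<open>\<partial>\<^sup>k\<^sup>+\<^sup>2 h\<close> in terms of
  \<open>D\<^sub>s\<^sup>j h\<close> the highest derivative of \<open>c\<close> enters only linearly (\<open>Hn_norm_velocity_stage\<close>); by Gronwall's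
  argument \<open>ln (1 + \<parallel>c\<parallel>\<^bsub>k+2\<^esub>)\<close> grows at most by \<open>C\<close> times the length (\<open>Hn_norm_path_step\<close>).  At order
  \<open>n\<close> this gives \<open>\<parallel>h\<parallel> \<le> C sqrt (G\<^sub>c(h, h))\<close> along the path, and integration over time bounds the distance
  of the end points in \<open>H\<^sup>n\<close> by the length (\<open>controlled_path_estimate\<close>).

  For the first estimate, a path of length at most 1 between two points of the ball starts at a
  controlled curve, and longer paths are harmless because the ball is bounded in \<open>H\<^sup>n\<close>.  For the second
  one, a small metric ball is small in \<open>H\<^sup>n\<close> by the first one, so straight segments between its points
  consist of immersions, and their length is at most \<open>C \<parallel>c\<^sub>1 - c\<^sub>2\<parallel>\<close>.

  Elements of \<open>H\<^sup>k\<close> are handled as iterated primitives (\<open>is_prim\<close>, \<open>sob\<close>) rather than through weak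
  derivatives; the two views agree by the lemma of du Bois-Reymond (\<open>Hn_iff_sob\<close>), which rests on the
  density of trigonometric polynomials.  Products, reciprocals and absolute values of such functions
  are estimated by induction on \<open>k\<close>.  The length of a path is an integral over time, and its integrand
  is integrable because the metric depends continuously on foot point and velocity
  (\<open>metric_lipschitz\<close>).
\<close>

section \<open>Primitives of integrable functions\<close>

abbreviation circle :: "real set" where
  "circle \<equiv> {0..2 * pi}"

text \<open>
  Thus \<open>f\<close> is absolutely continuous with derivative \<open>g\<close> almost everywhere; working with integrals avoids
  exceptional sets.
\<close>

definition is_prim :: "(real \<Rightarrow> 'a::euclidean_space) \<Rightarrow> (real \<Rightarrow> 'a) \<Rightarrow> bool" where
  "is_prim f g \<longleftrightarrow> (\<forall>a b. g absolutely_integrable_on {a..b}) \<and>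
     (\<forall>a b. a \<le> b \<longrightarrow> (g has_integral (f b - f a)) {a..b})"

lemma is_primD:
  assumes "is_prim f g"
  shows "g absolutely_integrable_on {a..b}" "g integrable_on {a..b}"
    "a \<le> b \<Longrightarrow> (g has_integral (f b - f a)) {a..b}"
    "(\<lambda>x. norm (g x)) integrable_on {a..b}"
  using assms absolutely_integrable_on_def unfolding is_prim_def by blast+

text \<open>
  The error \<open>f b - f a - \<integral> g\<close> is additive over adjacent intervals, so by bisection a local bound by
  \<open>e * \<integral> w\<close> holds on every interval, and \<open>e\<close> is arbitrary.  This replaces differentiation almost
  everywhere in the product and chain rules: only approximations \<open>G\<close> of \<open>g\<close> near each point are needed.
\<close>

lemma is_primI_local:
  fixes f g :: "real \<Rightarrow> 'a::euclidean_space"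
  assumes g: "\<And>a b. g absolutely_integrable_on {a..b}"
    and w: "\<And>a b. w integrable_on {a..b}"
    and loc: "\<And>e x. e > 0 \<Longrightarrow> \<exists>d>0. \<forall>a b. a \<le> x \<and> x \<le> b \<and> b - a < d \<longrightarrow>
        (\<exists>G. (G has_integral (f b - f a)) {a..b} \<and> (\<forall>s\<in>{a..b}. norm (G s - g s) \<le> e * w s))"
  shows "is_prim f g"
proof -
  have gi: "g integrable_on {a..b}" for a b
    using g absolutely_integrable_on_def by blast
  have bound: "norm (f b - f a - integral {a..b} g) \<le> e * integral {a..b} w"
    if ab: "a \<le> b" and e: "e > 0" for a b e
    using ab
  proof (induction a b rule: Bolzano)
    case (trans a b c)
    have "integral {a..c} g = integral {a..b} g + integral {b..c} g"
      "integral {a..c} w = integral {a..b} w + integral {b..c} w"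
      using trans gi w by (auto intro!: Henstock_Kurzweil_Integration.integral_combine[symmetric])
    then have "f c - f a - integral {a..c} g =
        (f b - f a - integral {a..b} g) + (f c - f b - integral {b..c} g)"
      "e * integral {a..c} w = e * integral {a..b} w + e * integral {b..c} w"
      by (auto simp: algebra_simps)
    then show ?case
      using trans.IH norm_triangle_ineq[of "f b - f a - integral {a..b} g" "f c - f b - integral {b..c} g"]
      by (simp only:)
  next
    case (local x)
    obtain d where "d > 0" and d: "\<And>a b. a \<le> x \<Longrightarrow> x \<le> b \<Longrightarrow> b - a < d \<Longrightarrow>
        \<exists>G. (G has_integral (f b - f a)) {a..b} \<and> (\<forall>s\<in>{a..b}. norm (G s - g s) \<le> e * w s)"
      using loc[OF e, of x] by blast
    have "norm (f b - f a - integral {a..b} g) \<le> e * integral {a..b} w"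
      if "a \<le> x" "x \<le> b" "b - a < d" for a b
    proof -
      obtain G where G: "(G has_integral (f b - f a)) {a..b}"
        "\<And>s. s \<in> {a..b} \<Longrightarrow> norm (G s - g s) \<le> e * w s"
        using d[OF \<open>a \<le> x\<close> \<open>x \<le> b\<close> \<open>b - a < d\<close>] by blast
      have "((\<lambda>s. G s - g s) has_integral (f b - f a - integral {a..b} g)) {a..b}"
        using G(1) gi by (intro has_integral_diff) auto
      moreover have "((\<lambda>s. e * w s) has_integral (e * integral {a..b} w)) {a..b}"
        using w by (intro has_integral_mult_right) auto
      ultimately show ?thesis
        using G(2) integral_norm_bound_integral[of "\<lambda>s. G s - g s" "{a..b}" "\<lambda>s. e * w s"]
        by (simp add: has_integral_iff)
    qed
    then show ?case using \<open>d > 0\<close> by blast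
  qed
  have "integral {a..b} g = f b - f a" if "a \<le> b" for a b
  proof -
    have "norm (f b - f a - integral {a..b} g) \<le> 0"
    proof (rule field_le_epsilon)
      fix e :: real assume "e > 0"
      define W where "W = integral {a..b} w"
      have "norm (f b - f a - integral {a..b} g) \<le> (e / (\<bar>W\<bar> + 1)) * W"
        unfolding W_def by (rule bound) (use that \<open>e > 0\<close> in auto)
      also have "\<dots> \<le> (e / (\<bar>W\<bar> + 1)) * (\<bar>W\<bar> + 1)"
        using \<open>e > 0\<close> by (intro mult_left_mono) auto
      finally show "norm (f b - f a - integral {a..b} g) \<le> 0 + e" by simp
    qed
    then show ?thesis by simp
  qed
  then show ?thesis unfolding is_prim_def using g gi by (metis integrable_integral)
qed

lemma is_prim_continuous:
  assumes "is_prim f g" shows "continuous_on UNIV f"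
proof -
  have "isCont f x" for x
  proof -
    have "continuous_on {x-1..x+1} (\<lambda>y. f (x-1) + integral {x-1..y} g)"
      by (intro continuous_intros indefinite_integral_continuous_1 is_primD[OF assms])
    then have "continuous_on {x-1..x+1} f"
      by (rule continuous_on_eq) (use is_primD(3)[OF assms, of "x-1"] in \<open>auto simp: has_integral_iff\<close>)
    then show ?thesis
      by (rule continuous_on_interior) simp
  qed
  then show ?thesis by (simp add: continuous_on_eq_continuous_at)
qed

lemma is_prim_isCont: "is_prim f g \<Longrightarrow> isCont f x"
  using is_prim_continuous[of f g] by (simp add: continuous_on_eq_continuous_at)

lemma is_prim_isCont_pair:
  assumes "is_prim f g"
  shows "isCont (\<lambda>p. f (fst p)) p" "isCont (\<lambda>p. f (snd p)) p"
  using is_prim_isCont[OF assms]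
  by (auto intro!: continuous_at_compose[of p fst f, unfolded o_def]
      continuous_at_compose[of p snd f, unfolded o_def] continuous_fst continuous_snd)

lemma is_prim_has_vector_derivative:
  assumes "is_prim f g" "isCont g x"
  shows "(f has_vector_derivative g x) (at x)"
proof -
  have "((\<lambda>y. integral {x-1..y} g) has_vector_derivative g x) (at x within {x-1..x+1})"
    using integral_has_vector_derivative_continuous_at[OF is_primD(2)[OF assms(1), of "x-1" "x+1"], of x "{}"]
      assms(2) by (auto intro: continuous_at_imp_continuous_at_within has_vector_derivative_at_within)
  then have "((\<lambda>y. f (x-1) + integral {x-1..y} g) has_vector_derivative (0 + g x)) (at x within {x-1..x+1})"
    by (intro derivative_intros)
  then have "(f has_vector_derivative (0 + g x)) (at x within {x-1..x+1})"
    using is_primD(3)[OF assms(1), of "x-1"]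
    by (subst has_vector_derivative_cong_ev[where g = "\<lambda>y. f (x-1) + integral {x-1..y} g"])
      (auto intro!: always_eventually simp: has_integral_iff)
  then show ?thesis
    by (simp add: at_within_Icc_at)
qed

lemma is_prim_const: "is_prim (\<lambda>x. c) (\<lambda>x. 0)"
  by (simp add: is_prim_def)

lemma is_prim_add:
  assumes "is_prim f f'" "is_prim g g'"
  shows "is_prim (\<lambda>x. f x + g x) (\<lambda>x. f' x + g' x)"
  unfolding is_prim_def
proof (intro conjI allI impI)
  fix a b :: real
  show "(\<lambda>x. f' x + g' x) absolutely_integrable_on {a..b}"
    using assms is_primD(1) by (intro set_integral_add) auto
  assume "a \<le> b"
  then have "((\<lambda>x. f' x + g' x) has_integral ((f b - f a) + (g b - g a))) {a..b}"
    using assms is_primD(3) by (intro has_integral_add) auto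
  then show "((\<lambda>x. f' x + g' x) has_integral f b + g b - (f a + g a)) {a..b}"
    by (simp add: algebra_simps)
qed

lemma is_prim_linear:
  assumes "is_prim f g" "bounded_linear h"
  shows "is_prim (\<lambda>x. h (f x)) (\<lambda>x. h (g x))"
proof -
  interpret h: bounded_linear h by fact
  show ?thesis
    unfolding is_prim_def h.diff[symmetric]
    using absolutely_integrable_linear[OF is_primD(1)[OF assms(1)] assms(2)]
      has_integral_linear[OF is_primD(3)[OF assms(1)] assms(2)]
    by (auto simp: o_def)
qed

lemma is_prim_spike:
  assumes "is_prim f g" "negligible N" "\<And>x. x \<notin> N \<Longrightarrow> g' x = g x"
  shows "is_prim f g'"
  unfolding is_prim_def
proof (intro conjI allI impI)
  show "g' absolutely_integrable_on {a..b}" for a b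
    using absolutely_integrable_spike[OF is_primD(1)[OF assms(1)] assms(2)] assms(3) by auto
  show "(g' has_integral f b - f a) {a..b}" if "a \<le> b" for a b
    using has_integral_spike[OF assms(2) _ is_primD(3)[OF assms(1) that]] assms(3) by auto
qed

lemma isCont_pair_small:
  fixes L :: "real \<times> real \<Rightarrow> 'b::real_normed_vector"
  assumes "isCont L (x, x)" "e > 0"
  shows "\<exists>d>0. \<forall>a b. a \<le> x \<and> x \<le> b \<and> b - a < d \<longrightarrow> (\<forall>s\<in>{a..b}. norm (L (a, b) - L (s, s)) \<le> e)"
proof -
  obtain d where "d > 0" and d: "\<And>p. dist p (x, x) < d \<Longrightarrow> dist (L p) (L (x, x)) < e / 2"
    using assms unfolding continuous_at_eps_delta by (meson half_gt_zero)
  have "norm (L (a, b) - L (s, s)) \<le> e"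
    if "a \<le> x" "x \<le> b" "b - a < d / 2" "s \<in> {a..b}" for a b s
  proof -
    have near: "dist (u, v) (x, x) < d" if "\<bar>u - x\<bar> < d / 2" "\<bar>v - x\<bar> < d / 2" for u v :: real
    proof -
      have "dist (u, v) (x, x) \<le> \<bar>u - x\<bar> + \<bar>v - x\<bar>"
        unfolding dist_Pair_Pair dist_real_def by (rule sqrt_sum_squares_le_sum_abs[THEN order_trans]) simp
      then show ?thesis using that by simp
    qed
    have "dist (L (a, b)) (L (x, x)) < e / 2" "dist (L (s, s)) (L (x, x)) < e / 2"
      using that by (intro d near; auto simp: abs_if)+
    then show ?thesis
      unfolding dist_norm using norm_triangle_half_l[of "L (a, b)" "L (x, x)" e "L (s, s)"] by simp
  qed
  then show ?thesis using \<open>d > 0\<close> by (intro exI[of _ "d/2"]) auto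
qed

lemma bounded_bilinear_abs_int:
  fixes prod :: "'a::euclidean_space \<Rightarrow> 'b::euclidean_space \<Rightarrow> 'c::euclidean_space"
  assumes "bounded_bilinear prod" "continuous_on {a..b::real} f" "g absolutely_integrable_on {a..b}"
  shows "(\<lambda>x. prod (f x) (g x)) absolutely_integrable_on {a..b}"
proof (rule absolutely_integrable_bounded_measurable_product[where h = prod])
  show "f \<in> borel_measurable (lebesgue_on {a..b})"
    using assms(2) by (intro continuous_imp_measurable_on_sets_lebesgue) auto
  show "bounded (f ` {a..b})"
    using assms(2) compact_continuous_image compact_imp_bounded by blast
  show "bilinear prod" using assms(1) bilinear_conv_bounded_bilinear by blast
qed (use assms in auto)

text \<open>
  On a short interval, \<open>prod (f b) (g b) - prod (f a) (g a)\<close> is the integral of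
  \<open>prod (f' s) (g b) + prod (f a) (g' s)\<close>, and continuity of \<open>f\<close> and \<open>g\<close> makes this integrand close to the
  one of the product rule.
\<close>

lemma is_prim_bilinear:
  fixes prod :: "'a::euclidean_space \<Rightarrow> 'b::euclidean_space \<Rightarrow> 'c::euclidean_space"
  assumes bil: "bounded_bilinear prod" and f: "is_prim f f'" and g: "is_prim g g'"
  shows "is_prim (\<lambda>x. prod (f x) (g x)) (\<lambda>x. prod (f' x) (g x) + prod (f x) (g' x))"
proof -
  interpret bounded_bilinear prod by fact
  obtain K where K: "K > 0" "\<And>x y. norm (prod x y) \<le> norm x * norm y * K"
    using pos_bounded by blast
  have cont: "continuous_on A f" "continuous_on A g" for A
    using is_prim_continuous f g continuous_on_subset by blast+
  show ?thesis
  proof (rule is_primI_local[where w = "\<lambda>x. norm (f' x) + norm (g' x)"])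
    show "(\<lambda>x. prod (f' x) (g x) + prod (f x) (g' x)) absolutely_integrable_on {a..b}" for a b
      using bounded_bilinear_abs_int[OF flip cont(2) is_primD(1)[OF f]]
        bounded_bilinear_abs_int[OF bil cont(1) is_primD(1)[OF g]]
      by (intro set_integral_add) auto
    show "(\<lambda>x. norm (f' x) + norm (g' x)) integrable_on {a..b}" for a b
      using is_primD(4)[OF f] is_primD(4)[OF g] by (intro integrable_add)
    fix e x :: real assume "e > 0"
    have "isCont (\<lambda>p. f (fst p)) (x, x)" "isCont (\<lambda>p. g (snd p)) (x, x)"
      using is_prim_isCont_pair[OF f] is_prim_isCont_pair[OF g] by auto
    then obtain d1 d2 where d: "d1 > 0" "d2 > 0"
      and d1: "\<And>a b s. a \<le> x \<Longrightarrow> x \<le> b \<Longrightarrow> b - a < d1 \<Longrightarrow> s \<in> {a..b} \<Longrightarrow> norm (f a - f s) \<le> e / K"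
      and d2: "\<And>a b s. a \<le> x \<Longrightarrow> x \<le> b \<Longrightarrow> b - a < d2 \<Longrightarrow> s \<in> {a..b} \<Longrightarrow> norm (g b - g s) \<le> e / K"
      using isCont_pair_small[where L = "\<lambda>p. f (fst p)" and x = x and e = "e / K"]
        isCont_pair_small[where L = "\<lambda>p. g (snd p)" and x = x and e = "e / K"]
        \<open>e > 0\<close> \<open>K > 0\<close> by (metis divide_pos_pos fst_conv snd_conv)
    have "\<exists>G. (G has_integral (prod (f b) (g b) - prod (f a) (g a))) {a..b} \<and>
        (\<forall>s\<in>{a..b}. norm (G s - (prod (f' s) (g s) + prod (f s) (g' s))) \<le> e * (norm (f' s) + norm (g' s)))"
      if ab: "a \<le> x" "x \<le> b" "b - a < min d1 d2" for a b
    proof (intro exI[of _ "\<lambda>s. prod (f' s) (g b) + prod (f a) (g' s)"] conjI ballI)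
      have "((\<lambda>s. prod (f' s) (g b) + prod (f a) (g' s)) has_integral
          (prod (f b - f a) (g b) + prod (f a) (g b - g a))) {a..b}"
        using ab has_integral_linear[OF is_primD(3)[OF f] bounded_linear_left, of a b]
           has_integral_linear[OF is_primD(3)[OF g] bounded_linear_right, of a b]
        by (intro has_integral_add) (auto simp: o_def)
      then show "((\<lambda>s. prod (f' s) (g b) + prod (f a) (g' s)) has_integral
          (prod (f b) (g b) - prod (f a) (g a))) {a..b}"
        by (simp add: diff_left diff_right)
      fix s assume s: "s \<in> {a..b}"
      have "prod (f' s) (g b) + prod (f a) (g' s) - (prod (f' s) (g s) + prod (f s) (g' s)) =
          prod (f' s) (g b - g s) + prod (f a - f s) (g' s)"
        by (simp add: diff_left diff_right)
      moreover have "norm (prod (f' s) (g b - g s)) \<le> norm (f' s) * (e / K) * K"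
        using d2[OF ab(1,2) _ s] ab(3) K(1)
        by (intro order_trans[OF K(2)] mult_right_mono mult_left_mono) auto
      moreover have "norm (prod (f a - f s) (g' s)) \<le> (e / K) * norm (g' s) * K"
        using d1[OF ab(1,2) _ s] ab(3) K(1)
        by (intro order_trans[OF K(2)] mult_right_mono) auto
      ultimately show "norm (prod (f' s) (g b) + prod (f a) (g' s) - (prod (f' s) (g s) + prod (f s) (g' s)))
          \<le> e * (norm (f' s) + norm (g' s))"
        using K(1) norm_triangle_ineq[of "prod (f' s) (g b - g s)" "prod (f a - f s) (g' s)"]
        by (simp add: algebra_simps)
    qed
    then show "\<exists>d>0. \<forall>a b. a \<le> x \<and> x \<le> b \<and> b - a < d \<longrightarrow>
        (\<exists>G. (G has_integral (prod (f b) (g b) - prod (f a) (g a))) {a..b} \<and>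
        (\<forall>s\<in>{a..b}. norm (G s - (prod (f' s) (g s) + prod (f s) (g' s))) \<le> e * (norm (f' s) + norm (g' s))))"
      using d by (intro exI[of _ "min d1 d2"]) auto
  qed
qed

text \<open>
  A chain rule for maps whose secant slopes \<open>L\<close> are explicit, as for the reciprocal and the norm.  The
  increment of \<open>F\<close> over a short interval is the integral of \<open>prod (L (a, b)) (f' s)\<close> with a constant first
  factor close to \<open>L (s, s)\<close>.
\<close>

lemma is_prim_secant:
  fixes prod :: "'a::euclidean_space \<Rightarrow> 'b::euclidean_space \<Rightarrow> 'c::euclidean_space"
  assumes bil: "bounded_bilinear prod" and f: "is_prim f f'"
    and L: "\<And>x. isCont L (x, x)" "continuous_on UNIV (\<lambda>x. L (x, x))"
    and secant: "\<And>a b. F b - F a = prod (L (a, b)) (f b - f a)"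
  shows "is_prim F (\<lambda>x. prod (L (x, x)) (f' x))"
proof -
  interpret bounded_bilinear prod by fact
  obtain K where K: "K > 0" "\<And>x y. norm (prod x y) \<le> norm x * norm y * K"
    using pos_bounded by blast
  show ?thesis
  proof (rule is_primI_local[where w = "\<lambda>x. norm (f' x)"])
    show "(\<lambda>x. prod (L (x, x)) (f' x)) absolutely_integrable_on {a..b}" for a b
      using bounded_bilinear_abs_int[OF bil _ is_primD(1)[OF f]] L(2) continuous_on_subset by blast
    show "(\<lambda>x. norm (f' x)) integrable_on {a..b}" for a b
      using is_primD(4)[OF f] .
    fix e x :: real assume "e > 0"
    then obtain d where d: "d > 0" "\<And>a b s. a \<le> x \<Longrightarrow> x \<le> b \<Longrightarrow> b - a < d \<Longrightarrow>
        s \<in> {a..b} \<Longrightarrow> norm (L (a, b) - L (s, s)) \<le> e / K"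
      using isCont_pair_small[OF L(1), of "e / K" x] K(1) by (metis divide_pos_pos)
    have "\<exists>G. (G has_integral (F b - F a)) {a..b} \<and>
        (\<forall>s\<in>{a..b}. norm (G s - prod (L (s, s)) (f' s)) \<le> e * norm (f' s))"
      if ab: "a \<le> x" "x \<le> b" "b - a < d" for a b
    proof (intro exI[of _ "\<lambda>s. prod (L (a, b)) (f' s)"] conjI ballI)
      show "((\<lambda>s. prod (L (a, b)) (f' s)) has_integral (F b - F a)) {a..b}"
        using ab has_integral_linear[OF is_primD(3)[OF f] bounded_linear_right, of a b]
        by (auto simp: o_def secant)
      fix s assume s: "s \<in> {a..b}"
      have "norm (prod (L (a, b) - L (s, s)) (f' s)) \<le> (e / K) * norm (f' s) * K"
        using d(2)[OF ab s] K(1) by (intro order_trans[OF K(2)] mult_right_mono) auto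
      then show "norm (prod (L (a, b)) (f' s) - prod (L (s, s)) (f' s)) \<le> e * norm (f' s)"
        using K(1) by (simp add: diff_left)
    qed
    then show "\<exists>d>0. \<forall>a b. a \<le> x \<and> x \<le> b \<and> b - a < d \<longrightarrow> (\<exists>G. (G has_integral (F b - F a)) {a..b} \<and>
        (\<forall>s\<in>{a..b}. norm (G s - prod (L (s, s)) (f' s)) \<le> e * norm (f' s)))"
      using d(1) by blast
  qed
qed

lemma is_prim_inverse:
  fixes f :: "real \<Rightarrow> real"
  assumes f: "is_prim f f'" and nz: "\<And>x. f x \<noteq> 0"
  shows "is_prim (\<lambda>x. 1 / f x) (\<lambda>x. - (f' x * ((1 / f x) * (1 / f x))))"
proof -
  have "is_prim (\<lambda>x. 1 / f x) (\<lambda>x. (- (1 / (f (fst (x, x)) * f (snd (x, x))))) * f' x)"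
  proof (rule is_prim_secant[OF bounded_bilinear_mult f])
    show "isCont (\<lambda>p. - (1 / (f (fst p) * f (snd p)))) (x, x)" for x
      using is_prim_isCont_pair[OF f] nz by (intro continuous_intros) auto
    show "continuous_on UNIV (\<lambda>x. - (1 / (f (fst (x, x)) * f (snd (x, x)))))"
      using is_prim_continuous[OF f] nz by (auto intro!: continuous_intros)
    show "1 / f b - 1 / f a = - (1 / (f (fst (a, b)) * f (snd (a, b)))) * (f b - f a)" for a b
      using nz by (simp add: field_simps)
  qed
  then show ?thesis by (simp add: mult.commute)
qed

lemma is_prim_norm:
  fixes f :: "real \<Rightarrow> 'a::euclidean_space"
  assumes f: "is_prim f f'" and nz: "\<And>x. f x \<noteq> 0"
  shows "is_prim (\<lambda>x. norm (f x)) (\<lambda>x. (1 / norm (f x)) * (f x \<bullet> f' x))"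
proof -
  define L where "L = (\<lambda>p. (1 / (norm (f (fst p)) + norm (f (snd p)))) *\<^sub>R (f (fst p) + f (snd p)))"
  have pos: "norm (f a) + norm (f b) > 0" for a b
    using nz by (simp add: add_pos_nonneg)
  have "is_prim (\<lambda>x. norm (f x)) (\<lambda>x. L (x, x) \<bullet> f' x)"
  proof (rule is_prim_secant[OF bounded_bilinear_inner f])
    show "isCont L (x, x)" for x
      using is_prim_isCont_pair[OF f] pos[of x x] unfolding L_def
      by (intro continuous_intros) auto
    show "continuous_on UNIV (\<lambda>x. L (x, x))"
      using is_prim_continuous[OF f] pos unfolding L_def
      by (intro continuous_intros) (auto simp: nz)
    show "norm (f b) - norm (f a) = L (a, b) \<bullet> (f b - f a)" for a b
    proof -
      have "(norm (f b) - norm (f a)) * (norm (f a) + norm (f b)) = (f a + f b) \<bullet> (f b - f a)"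
        by (simp add: algebra_simps inner_commute flip: power2_norm_eq_inner power2_eq_square)
      then have "norm (f b) - norm (f a) = ((f a + f b) \<bullet> (f b - f a)) / (norm (f a) + norm (f b))"
        using pos[of a b] by (simp add: eq_divide_eq)
      then show ?thesis unfolding L_def by simp
    qed
  qed
  moreover have "L (x, x) \<bullet> f' x = (1 / norm (f x)) * (f x \<bullet> f' x)" for x
    unfolding L_def using nz by (simp add: inner_add_left field_simps)
  ultimately show ?thesis by simp
qed

section \<open>Periodic functions\<close>

lemma periodic_add_int:
  assumes "periodic f" shows "f (x + 2 * pi * of_int k) = f x"
proof -
  have nat: "f (x + 2 * pi * of_nat m) = f x" for x m
  proof (induction m)
    case (Suc m)
    have "f (x + 2 * pi * of_nat (Suc m)) = f ((x + 2 * pi * of_nat m) + 2 * pi)"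
      by (simp add: algebra_simps)
    then show ?case using Suc assms by (simp add: periodic_def)
  qed simp
  show ?thesis
  proof (cases "k \<ge> 0")
    case True
    then show ?thesis using nat[of x "nat k"] by simp
  next
    case False
    then show ?thesis using nat[of "x + 2 * pi * of_int k" "nat (- k)"] by simp
  qed
qed

lemma periodic_reduce:
  obtains k :: int where "x - 2 * pi * of_int k \<in> {0..<2 * pi}"
proof
  show "x - 2 * pi * of_int \<lfloor>x / (2 * pi)\<rfloor> \<in> {0..<2 * pi}"
    using floor_divide_lower[of "2 * pi" x] floor_divide_upper[of "2 * pi" x] by (simp add: algebra_simps)
qed

lemma periodic_eqI:
  assumes "periodic f" "periodic g" "\<And>x. x \<in> circle \<Longrightarrow> f x = g x"
  shows "f = g"
proof
  fix x :: real
  obtain k :: int where k: "x - 2 * pi * of_int k \<in> {0..<2 * pi}" by (rule periodic_reduce)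
  show "f x = g x"
    using periodic_add_int[OF assms(1), of "x - 2 * pi * of_int k" k]
      periodic_add_int[OF assms(2), of "x - 2 * pi * of_int k" k] assms(3)[of "x - 2 * pi * of_int k"] k
    by simp
qed

lemma periodic_0_2pi: "periodic f \<Longrightarrow> f (2 * pi) = f 0"
  unfolding periodic_def by (metis add_0)

lemma periodic_negligible:
  assumes P: "periodic P" and neg: "negligible {x \<in> circle. P x}"
  shows "negligible {x. P x}"
proof -
  have "{x. P x} \<subseteq> (\<Union>k\<in>(UNIV::int set). (+) (2 * pi * of_int k) ` {x \<in> circle. P x})"
  proof
    fix x assume x: "x \<in> {x. P x}"
    obtain k :: int where k: "x - 2 * pi * of_int k \<in> {0..<2 * pi}" by (rule periodic_reduce)
    then have "x - 2 * pi * of_int k \<in> {x \<in> circle. P x}"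
      using x periodic_add_int[OF P, of "x - 2 * pi * of_int k" k] by auto
    then have "2 * pi * of_int k + (x - 2 * pi * of_int k) \<in> (+) (2 * pi * of_int k) ` {x \<in> circle. P x}"
      by blast
    then show "x \<in> (\<Union>k\<in>(UNIV::int set). (+) (2 * pi * of_int k) ` {x \<in> circle. P x})"
      by auto
  qed
  moreover have "negligible (\<Union>k\<in>(UNIV::int set). (+) (2 * pi * of_int k) ` {x \<in> circle. P x})"
    using neg by (intro negligible_countable_Union) (auto intro!: negligible_translation)
  ultimately show ?thesis using negligible_subset by blast
qed

lemma nonneg_integral_zero_negligible:
  fixes f :: "real \<Rightarrow> real"
  assumes "f integrable_on {a..b}" "\<And>x. x \<in> {a..b} \<Longrightarrow> f x \<ge> 0" "integral {a..b} f = 0"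
  shows "negligible {x \<in> {a..b}. f x \<noteq> 0}"
proof -
  have ai: "f absolutely_integrable_on {a..b}"
    using assms by (intro nonnegative_absolutely_integrable_1) auto
  then have int: "integrable (lebesgue_on {a..b}) f"
    by (simp add: integrable_restrict_space set_integrable_def)
  have "integral\<^sup>L (lebesgue_on {a..b}) f = 0"
    using lebesgue_integral_eq_integral[OF int] assms(3) by simp
  then have "AE x in lebesgue_on {a..b}. f x = 0"
    using integral_nonneg_eq_0_iff_AE[OF int] assms(2) by (auto simp: AE_restrict_space_iff)
  then have "AE x in lebesgue. x \<in> {a..b} \<longrightarrow> f x = 0"
    by (simp add: AE_restrict_space_iff)
  then obtain N where "negligible N" "{x. \<not> (x \<in> {a..b} \<longrightarrow> f x = 0)} \<subseteq> N"
    unfolding eventually_ae_filter_negligible by blast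
  then show ?thesis by (auto intro: negligible_subset)
qed

text \<open>
  By Henstock's lemma, fine Riemann sums of \<open>g\<close> are close to the integrals termwise in norm; as the
  integrals vanish, the Riemann sums of \<open>norm (g x)\<close> themselves are small.
\<close>

lemma zero_integrals_imp_negligible:
  fixes g :: "real \<Rightarrow> 'a::euclidean_space"
  assumes g: "g absolutely_integrable_on {a..b}"
    and zero: "\<And>u v. a \<le> u \<Longrightarrow> u \<le> v \<Longrightarrow> v \<le> b \<Longrightarrow> integral {u..v} g = 0"
  shows "negligible {x \<in> {a..b}. g x \<noteq> 0}"
proof -
  have gi: "g integrable_on cbox a b"
    using g absolutely_integrable_on_def by auto
  have "((\<lambda>x. norm (g x)) has_integral 0) (cbox a b)"
    unfolding has_integral
  proof (intro allI impI)
    fix e :: real assume "e > 0"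
    then obtain \<gamma> where "gauge \<gamma>" and \<gamma>: "\<And>p. \<lbrakk>p tagged_partial_division_of (cbox a b); \<gamma> fine p\<rbrakk> \<Longrightarrow>
             sum (\<lambda>(x,k). norm(measure lborel k *\<^sub>R g x - integral k g)) p < e"
      using Henstock_lemma[OF gi] by blast
    have "norm ((\<Sum>(x, k)\<in>p. measure lborel k *\<^sub>R norm (g x)) - 0) < e"
      if p: "p tagged_division_of cbox a b" "\<gamma> fine p" for p
    proof -
      have "integral k g = 0" if "(x, k) \<in> p" for x k
        using zero tagged_division_ofD(3,4)[OF p(1) that] by (metis atLeastatMost_subset_iff box_real(2) 
              atLeastatMost_empty_iff2 integral_empty)
      then have "(\<Sum>(x, k)\<in>p. measure lborel k *\<^sub>R norm (g x)) =
          (\<Sum>(x, k)\<in>p. norm (measure lborel k *\<^sub>R g x - integral k g))"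
        by (intro sum.cong) auto
      then show ?thesis
        using \<gamma>[OF _ p(2)] p(1)
        by (auto simp: tagged_division_of_def sum_nonneg case_prod_unfold)
    qed
    then show "\<exists>\<gamma>. gauge \<gamma> \<and> (\<forall>p. p tagged_division_of cbox a b \<and> \<gamma> fine p \<longrightarrow>
        norm ((\<Sum>(x, k)\<in>p. measure lborel k *\<^sub>R norm (g x)) - 0) < e)"
      using \<open>gauge \<gamma>\<close> by blast
  qed
  then have "negligible {x \<in> {a..b}. norm (g x) \<noteq> 0}"
    by (intro nonneg_integral_zero_negligible) (auto simp: has_integral_iff)
  then show ?thesis by simp
qed

text \<open>
  Vanishing of the integral over a period lets the primitives on the cells \<open>[2\<pi>k, 2\<pi>(k+1)]\<close>, all starting
  from 0, fit together; bisection passes from subintervals of cells to arbitrary intervals.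
\<close>

lemma periodic_primitive:
  fixes g :: "real \<Rightarrow> 'a::euclidean_space"
  assumes per: "periodic g" and g: "g absolutely_integrable_on circle" and zero: "integral circle g = 0"
  obtains F where "periodic F" "is_prim F g" "F 0 = 0"
proof -
  define F where "F x = integral {0..x - 2 * pi * of_int \<lfloor>x / (2 * pi)\<rfloor>} g" for x
  have gi: "g integrable_on circle" using g absolutely_integrable_on_def by blast
  have F: "F x = integral {0..x - 2 * pi * of_int k} g"
    if "2 * pi * of_int k \<le> x" "x \<le> 2 * pi * of_int (k + 1)" for x k
  proof (cases "x = 2 * pi * of_int (k + 1)")
    case True
    then have "\<lfloor>x / (2 * pi)\<rfloor> = k + 1" by simp
    then show ?thesis using True zero by (simp add: F_def algebra_simps)
  next
    case False
    then have "\<lfloor>x / (2 * pi)\<rfloor> = k" using that by (intro floor_unique) (auto simp: field_simps)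
    then show ?thesis by (simp add: F_def)
  qed
  define P where "P a b \<longleftrightarrow> g absolutely_integrable_on {a..b} \<and> (g has_integral (F b - F a)) {a..b}" for a b
  have cell: "P a b" if ab: "2 * pi * of_int k \<le> a" "a \<le> b" "b \<le> 2 * pi * of_int (k + 1)" for a b k
  proof -
    define s where "s = 2 * pi * of_int k"
    have sub: "{a - s..b - s} \<subseteq> circle" using ab by (auto simp: s_def algebra_simps)
    have shift: "g (x - s) = g x" for x
      using periodic_add_int[OF per, of x "- k"] by (simp add: s_def)
    have "integral {0..a - s} g + integral {a - s..b - s} g = integral {0..b - s} g"
      using ab gi by (intro Henstock_Kurzweil_Integration.integral_combine integrable_on_subinterval[OF gi])
        (auto simp: s_def algebra_simps)
    then have "integral {a - s..b - s} g = F b - F a"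
      using F[of k a] F[of k b] ab by (simp add: s_def algebra_simps)
    then have "(g has_integral (F b - F a)) {a - s..b - s}"
      using integrable_on_subinterval[OF gi sub] by (simp add: has_integral_iff)
    then have 1: "(g has_integral (F b - F a)) {a..b}"
      using has_integral_shift_real_ivl[of g _ "a - s" "b - s" "- s"] by (simp add: shift)
    have "(\<lambda>x. norm (g x)) integrable_on circle" using g absolutely_integrable_on_def by blast
    then have "(\<lambda>x. norm (g x)) integrable_on {a - s..b - s}" using sub integrable_on_subinterval by blast
    then have "(\<lambda>x. norm (g x)) integrable_on {a..b}"
      using integrable_shift_real_ivl[of "\<lambda>x. norm (g x)" "a - s" "b - s" "- s"] by (simp add: shift)
    with 1 show ?thesis unfolding P_def absolutely_integrable_on_def by blast
  qed
  have combine: "P a c" if "P a b" "P b c" "a \<le> b" "b \<le> c" for a b c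
    using has_integral_combine[OF that(3,4), where f = g and i = "F b - F a" and j = "F c - F b"]
      absolutely_integrable_on_combine[OF _ _ that(3,4), where f = g] that unfolding P_def by simp
  have P: "P a b" if "a \<le> b" for a b
    using that
  proof (induction a b rule: Bolzano)
    case (trans a b c)
    then show ?case using combine by blast
  next
    case (local x)
    define k where "k = \<lfloor>x / (2 * pi)\<rfloor>"
    define s where "s = 2 * pi * of_int k"
    have s: "s \<le> x" "x < s + 2 * pi"
      using floor_divide_lower[of "2 * pi" x] floor_divide_upper[of "2 * pi" x]
      by (auto simp: s_def k_def algebra_simps)
    have cell1: "P a b" if "s \<le> a" "a \<le> b" "b \<le> s + 2 * pi" for a b
      using cell[of k a b] that by (simp add: s_def algebra_simps)
    have cell0: "P a b" if "s - 2 * pi \<le> a" "a \<le> b" "b \<le> s" for a b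
      using cell[of "k - 1" a b] that by (simp add: s_def algebra_simps)
    define d where "d = min (2 * pi) (s + 2 * pi - x)"
    have "P a b" if "a \<le> x" "x \<le> b" "b - a < d" for a b
    proof (cases "a \<ge> s")
      case True
      then show ?thesis using that s by (intro cell1) (auto simp: d_def)
    next
      case False
      have "P a s" using False that s by (intro cell0) (auto simp: d_def)
      moreover have "P s b" using False that s by (intro cell1) (auto simp: d_def)
      ultimately show ?thesis using combine False that s by (meson linear order_trans)
    qed
    moreover have "d > 0" using s by (simp add: d_def)
    ultimately show ?case by blast
  qed
  show thesis
  proof (rule that)
    show "periodic F"
      unfolding periodic_def
    proof
      fix x
      have "\<lfloor>(x + 2 * pi) / (2 * pi)\<rfloor> = \<lfloor>x / (2 * pi)\<rfloor> + 1"
        by (simp add: add_divide_distrib)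
      then show "F (x + 2 * pi) = F x" by (simp add: F_def algebra_simps)
    qed
    have "g absolutely_integrable_on {a..b}" for a b
      using P[of a b] by (cases "a \<le> b") (auto simp: P_def)
    then show "is_prim F g" using P by (auto simp: is_prim_def P_def)
    show "F 0 = 0" by (simp add: F_def)
  qed
qed

lemma is_prim_integral_period:
  assumes "is_prim f g" "periodic f"
  shows "(g has_integral 0) circle" "integral circle g = 0"
  using is_primD(3)[OF assms(1), of 0 "2 * pi"] periodic_0_2pi[OF assms(2)]
  by (auto simp: has_integral_iff)



section \<open>Test functions and the fundamental lemma\<close>

text \<open>
  Closed under differentiation, so all members are smooth, and under multiplication, as the theorem of
  Stone and Weierstrass requires.
\<close>

inductive trig_poly :: "(real \<Rightarrow> real) \<Rightarrow> bool" where
  const: "trig_poly (\<lambda>x. c)"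
| cos: "trig_poly cos"
| sin: "trig_poly sin"
| add: "trig_poly f \<Longrightarrow> trig_poly g \<Longrightarrow> trig_poly (\<lambda>x. f x + g x)"
| mult: "trig_poly f \<Longrightarrow> trig_poly g \<Longrightarrow> trig_poly (\<lambda>x. f x * g x)"

lemma trig_poly_deriv:
  assumes "trig_poly f" shows "\<exists>f'. trig_poly f' \<and> (\<forall>x. (f has_field_derivative f' x) (at x))"
  using assms
proof induction
  case (const c)
  then show ?case by (intro exI[of _ "\<lambda>x. 0"]) (auto intro: trig_poly.const)
next
  case cos
  have "trig_poly (\<lambda>x. (- 1) * sin x)" by (intro trig_poly.intros)
  then show ?case
    by (intro exI[of _ "\<lambda>x. (- 1) * sin x"] conjI) (auto intro!: derivative_eq_intros)
next
  case sin
  show ?case by (intro exI[of _ cos]) (auto intro!: trig_poly.intros derivative_eq_intros)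
next
  case (add f g)
  then obtain f' g' where "trig_poly f'" "trig_poly g'" "\<forall>x. (f has_field_derivative f' x) (at x)"
    "\<forall>x. (g has_field_derivative g' x) (at x)" by blast
  then show ?case
    by (intro exI[of _ "\<lambda>x. f' x + g' x"]) (auto intro!: trig_poly.add DERIV_add)
next
  case (mult f g)
  then obtain f' g' where "trig_poly f'" "trig_poly g'" "\<forall>x. (f has_field_derivative f' x) (at x)"
    "\<forall>x. (g has_field_derivative g' x) (at x)" by blast
  with mult show ?case
    by (intro exI[of _ "\<lambda>x. f' x * g x + g' x * f x"]) (auto intro!: trig_poly.intros DERIV_mult)
qed

lemma trig_poly_periodic: "trig_poly f \<Longrightarrow> periodic f"
  by (induction rule: trig_poly.induct) (auto simp: periodic_def)

lemma trig_poly_test_function: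
  assumes "trig_poly f" shows "test_function f"
proof -
  have "trig_poly ((deriv ^^ k) f)" for k
  proof (induction k)
    case (Suc k)
    then obtain f' where f': "trig_poly f'" "\<forall>x. ((deriv ^^ k) f has_field_derivative f' x) (at x)"
      using trig_poly_deriv by blast
    then have "deriv ((deriv ^^ k) f) = f'" using DERIV_imp_deriv by blast
    then show ?case using f' by simp
  qed (use assms in simp)
  then show ?thesis
    using trig_poly_deriv trig_poly_periodic[OF assms]
    unfolding test_function_def field_differentiable_def by blast
qed

lemma test_function_has_deriv:
  "test_function \<phi> \<Longrightarrow> ((deriv ^^ k) \<phi> has_field_derivative (deriv ^^ Suc k) \<phi> x) (at x)"
  unfolding test_function_def by (simp add: field_differentiable_derivI)

lemma test_function_periodic: "test_function \<phi> \<Longrightarrow> periodic \<phi>"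
  by (simp add: test_function_def)

lemma test_function_deriv:
  assumes "test_function \<phi>" shows "test_function (deriv \<phi>)"
proof -
  have "deriv \<phi> (x + 2 * pi) = deriv \<phi> x" for x
  proof -
    have "(\<phi> has_field_derivative deriv \<phi> (x + 2 * pi)) (at (x + 2 * pi))"
      using test_function_has_deriv[OF assms, of 0] by simp
    then have "((\<lambda>y. \<phi> (y + 2 * pi)) has_field_derivative deriv \<phi> (x + 2 * pi)) (at x)"
      using DERIV_shift by blast
    moreover have "(\<lambda>y. \<phi> (y + 2 * pi)) = \<phi>"
      using test_function_periodic[OF assms] by (auto simp: periodic_def)
    ultimately show ?thesis by (simp add: DERIV_imp_deriv)
  qed
  moreover have "(deriv ^^ k) (deriv \<phi>) field_differentiable at x" for k x
    using assms unfolding test_function_def by (metis comp_apply funpow_Suc_right)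
  ultimately show ?thesis by (auto simp: test_function_def periodic_def)
qed

lemma test_function_funpow_deriv: "test_function \<phi> \<Longrightarrow> test_function ((deriv ^^ k) \<phi>)"
  by (induction k) (auto intro: test_function_deriv)

lemma test_function_continuous: "test_function \<phi> \<Longrightarrow> continuous_on A \<phi>"
  using test_function_has_deriv[of \<phi> 0] DERIV_continuous_on[of A \<phi> "deriv \<phi>"]
  by (auto intro: has_field_derivative_at_within)

lemma is_prim_C1:
  fixes f :: "real \<Rightarrow> 'a::euclidean_space"
  assumes "\<And>x. (f has_vector_derivative g x) (at x)" "continuous_on UNIV g"
  shows "is_prim f g"
  unfolding is_prim_def
proof (intro conjI allI impI)
  show "g absolutely_integrable_on {a..b}" for a b
    using assms(2) by (intro absolutely_integrable_continuous_real) (rule continuous_on_subset, auto)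
  show "(g has_integral f b - f a) {a..b}" if "a \<le> b" for a b
    using assms(1) that by (intro fundamental_theorem_of_calculus) (auto intro: has_vector_derivative_at_within)
qed

lemma is_prim_test_function: "test_function \<phi> \<Longrightarrow> is_prim \<phi> (deriv \<phi>)"
  using test_function_has_deriv[of \<phi> 0]
  by (intro is_prim_C1 test_function_continuous test_function_deriv)
    (auto simp: has_real_derivative_iff_has_vector_derivative)

lemma test_function_abs_int:
  fixes f :: "real \<Rightarrow> 'a::euclidean_space"
  assumes "test_function \<phi>" "f absolutely_integrable_on {a..b}"
  shows "(\<lambda>x. \<phi> x *\<^sub>R f x) absolutely_integrable_on {a..b}"
  using bounded_bilinear_abs_int[OF bounded_bilinear_scaleR test_function_continuous[OF assms(1)] assms(2)] .

lemma test_function_integrable: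
  fixes f :: "real \<Rightarrow> 'a::euclidean_space"
  assumes "test_function \<phi>" "f absolutely_integrable_on {a..b}"
  shows "(\<lambda>x. \<phi> x *\<^sub>R f x) integrable_on {a..b}"
  using test_function_abs_int[OF assms] absolutely_integrable_on_def by blast

lemma integration_by_parts_period:
  assumes f: "is_prim f g" "periodic f" and \<phi>: "test_function \<phi>"
  shows "integral circle (\<lambda>x. deriv \<phi> x *\<^sub>R f x) = - integral circle (\<lambda>x. \<phi> x *\<^sub>R g x)"
proof -
  have "is_prim (\<lambda>x. \<phi> x *\<^sub>R f x) (\<lambda>x. deriv \<phi> x *\<^sub>R f x + \<phi> x *\<^sub>R g x)"
    by (intro is_prim_bilinear[OF bounded_bilinear_scaleR] is_prim_test_function f \<phi>)
  moreover have "periodic (\<lambda>x. \<phi> x *\<^sub>R f x)"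
    using f(2) test_function_periodic[OF \<phi>] by (auto simp: periodic_def)
  ultimately have "integral circle (\<lambda>x. deriv \<phi> x *\<^sub>R f x + \<phi> x *\<^sub>R g x) = 0"
    by (rule is_prim_integral_period(2))
  moreover have "f absolutely_integrable_on circle"
    using is_prim_continuous[OF f(1)] continuous_on_subset by (intro absolutely_integrable_continuous_real) blast
  ultimately show ?thesis
    using Henstock_Kurzweil_Integration.integral_add[OF test_function_integrable[OF test_function_deriv[OF \<phi>]]
        test_function_integrable[OF \<phi> is_primD(1)[OF f(1)]], of 0 "2 * pi" f]
    by (simp add: eq_neg_iff_add_eq_0)
qed

lemma test_function_primitive:
  assumes \<psi>: "test_function \<psi>" and zero: "integral circle \<psi> = 0"
  obtains \<phi> where "test_function \<phi>" "deriv \<phi> = \<psi>"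
proof -
  have cont: "continuous_on A \<psi>" for A using test_function_continuous[OF \<psi>] .
  obtain \<phi> where \<phi>: "periodic \<phi>" "is_prim \<phi> \<psi>"
    using periodic_primitive[OF test_function_periodic[OF \<psi>] absolutely_integrable_continuous_real[OF cont] zero] .
  have der: "(\<phi> has_field_derivative \<psi> x) (at x)" for x
    using is_prim_has_vector_derivative[OF \<phi>(2)] cont[of UNIV]
    by (simp add: has_real_derivative_iff_has_vector_derivative continuous_on_eq_continuous_at)
  then have d: "deriv \<phi> = \<psi>" using DERIV_imp_deriv by blast
  have "(deriv ^^ k) \<phi> field_differentiable at x" for k x
  proof (cases k)
    case 0
    then show ?thesis using der by (auto simp: field_differentiable_def)
  next
    case (Suc m)
    have "(deriv ^^ k) \<phi> = (deriv ^^ m) \<psi>"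
      unfolding Suc using d by (metis comp_apply funpow_Suc_right)
    then show ?thesis using \<psi> by (simp add: test_function_def)
  qed
  then have "test_function \<phi>" using \<phi>(1) by (simp add: test_function_def)
  with d show thesis using that by blast
qed

lemma test_function_diff_const:
  assumes "test_function \<psi>" shows "test_function (\<lambda>x. \<psi> x - c)"
proof -
  have d: "deriv (\<lambda>x. \<psi> x - c) = deriv \<psi>"
    using test_function_has_deriv[OF assms, of 0]
    by (intro ext DERIV_imp_deriv) (auto intro!: derivative_eq_intros)
  have "(deriv ^^ k) (\<lambda>x. \<psi> x - c) field_differentiable at x" for k x
  proof (cases k)
    case 0
    have "\<psi> field_differentiable at x"
      using assms unfolding test_function_def by (metis funpow_0)
    then show ?thesis using 0 by (simp add: field_differentiable_diff)
  next
    case (Suc m)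
    then have "(deriv ^^ k) (\<lambda>x. \<psi> x - c) = (deriv ^^ k) \<psi>"
      using d by (metis comp_apply funpow_Suc_right)
    then show ?thesis using assms by (simp add: test_function_def)
  qed
  then show ?thesis using assms by (auto simp: test_function_def periodic_def)
qed

text \<open>
  A test function of mean zero is the derivative of a test function.  Being orthogonal to all derivatives
  therefore means being orthogonal to all test functions after subtraction of the mean.
\<close>

lemma orthogonal_to_derivs:
  fixes w :: "real \<Rightarrow> 'a::euclidean_space"
  assumes w: "w absolutely_integrable_on circle"
    and orth: "\<And>\<phi>. test_function \<phi> \<Longrightarrow> integral circle (\<lambda>x. deriv \<phi> x *\<^sub>R w x) = 0"
    and \<psi>: "test_function \<psi>"
  shows "integral circle (\<lambda>x. \<psi> x *\<^sub>R (w x - (1 / (2 * pi)) *\<^sub>R integral circle w)) = 0"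
proof -
  define m where "m = (1 / (2 * pi)) *\<^sub>R integral circle w"
  define c where "c = integral circle \<psi> / (2 * pi)"
  have \<psi>i: "\<psi> integrable_on circle"
    using test_function_continuous[OF \<psi>] integrable_continuous_interval by blast
  have wi: "w integrable_on circle" using w absolutely_integrable_on_def by blast
  have "integral circle (\<lambda>x. \<psi> x - c) = 0"
    using has_integral_diff[OF integrable_integral[OF \<psi>i] has_integral_const_real[of c 0 "2 * pi"]]
    by (simp add: has_integral_iff c_def)
  then obtain \<phi> where "test_function \<phi>" "deriv \<phi> = (\<lambda>x. \<psi> x - c)"
    using test_function_primitive[OF test_function_diff_const[OF \<psi>]] by blast
  then have "integral circle (\<lambda>x. (\<psi> x - c) *\<^sub>R w x) = 0"
    using orth by metis
  then have "integral circle (\<lambda>x. \<psi> x *\<^sub>R w x) = c *\<^sub>R integral circle w"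
    using test_function_integrable[OF \<psi> w] wi
    by (simp add: scaleR_diff_left Henstock_Kurzweil_Integration.integral_diff integrable_cmul)
  moreover have "((\<lambda>x. \<psi> x *\<^sub>R m) has_integral (integral circle \<psi> *\<^sub>R m)) circle"
    using \<psi>i by (intro has_integral_scaleR_left) auto
  moreover have "integral circle \<psi> *\<^sub>R m = c *\<^sub>R integral circle w"
    by (simp add: m_def c_def)
  ultimately show ?thesis
    unfolding m_def[symmetric] using test_function_integrable[OF \<psi> w]
    by (simp add: scaleR_diff_right Henstock_Kurzweil_Integration.integral_diff has_integral_iff)
qed

text \<open>
  A continuous periodic function is a continuous function on the unit circle in the plane.  At the branch
  cut of \<open>Arg\<close>, the angle may be replaced by \<open>Arg2pi\<close>, which differs by a period.
\<close>

lemma periodic_Arg_continuous: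
  fixes F :: "real \<Rightarrow> real"
  assumes per: "periodic F" and cont: "continuous_on UNIV F"
  shows "continuous_on (sphere 0 1) (\<lambda>z. F (Arg z))" "F (Arg (cis x)) = F x"
proof -
  have eq: "F a = F b" if "cis a = cis b" for a b
  proof -
    have "sin a = sin b \<and> cos a = cos b" using that by (auto simp: complex_eq_iff)
    then obtain k :: int where "a = b + 2 * pi * of_int k" using sin_cos_eq_iff by blast
    then show ?thesis using periodic_add_int[OF per] by simp
  qed
  have F: "isCont F x" for x using cont by (simp add: continuous_on_eq_continuous_at)
  show "F (Arg (cis x)) = F x" by (rule eq) (simp add: cis_Arg)
  have Arg2pi: "F (Arg2pi z) = F (Arg z)" if "z \<noteq> 0" for z
  proof (rule eq)
    have "z = of_real (norm z) * exp (\<i> * of_real (Arg2pi z))"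
      using Arg2pi[of z] by (simp add: is_Arg_def)
    then have "cis (Arg2pi z) = sgn z"
      using that by (metis cis_conv_exp nonzero_mult_div_cancel_left norm_eq_zero of_real_eq_0_iff sgn_eq)
    then show "cis (Arg2pi z) = cis (Arg z)" using cis_Arg that by simp
  qed
  have "isCont (\<lambda>z. F (Arg z)) z" if "z \<noteq> 0" for z
  proof (cases "z \<in> \<real>\<^sub>\<le>\<^sub>0")
    case False
    then show ?thesis using isCont_o2[OF continuous_at_Arg F] by blast
  next
    case True
    then have "z \<notin> \<real>\<^sub>\<ge>\<^sub>0" using that
      by (auto simp: complex_nonneg_Reals_iff complex_nonpos_Reals_iff complex_eq_iff)
    then have "isCont (\<lambda>z. F (Arg2pi z)) z" using isCont_o2[OF continuous_at_Arg2pi F] by blast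
    moreover have "\<forall>\<^sub>F y in nhds z. F (Arg2pi y) = F (Arg y)"
      using that Arg2pi t1_space_nhds by (metis (mono_tags, lifting) eventually_mono)
    ultimately show ?thesis by (subst isCont_cong[symmetric]) 
  qed
  then show "continuous_on (sphere 0 1) (\<lambda>z. F (Arg z))"
    by (intro continuous_at_imp_continuous_on) (metis mem_sphere_0 norm_zero zero_neq_one)
qed

lemma real_polynomial_cis_trig_poly:
  assumes "real_polynomial_function p" shows "trig_poly (\<lambda>x. p (cis x))"
  using assms
proof induction
  case (linear f)
  then interpret bounded_linear f .
  have "f (cis x) = cos x * f 1 + sin x * f \<i>" for x
  proof -
    have "cis x = cos x *\<^sub>R 1 + sin x *\<^sub>R \<i>" by (simp add: complex_eq_iff)
    then show ?thesis by (simp only: add scaleR real_scaleR_def)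
  qed
  then show ?case by (auto intro!: trig_poly.intros)
qed (auto intro: trig_poly.intros)

text \<open>
  Trigonometric polynomials are uniformly dense, by Stone and Weierstrass on the unit circle, so \<open>F\<close> is
  orthogonal to itself.
\<close>

lemma continuous_orthogonal_to_test_functions:
  fixes F :: "real \<Rightarrow> real"
  assumes per: "periodic F" and cont: "continuous_on UNIV F"
    and orth: "\<And>\<psi>. test_function \<psi> \<Longrightarrow> integral circle (\<lambda>x. \<psi> x *\<^sub>R F x) = 0"
  shows "F x = 0"
proof -
  have c: "continuous_on circle F" using cont continuous_on_subset by blast
  have approx: "integral circle (\<lambda>x. F x * F x) \<le> e * integral circle (\<lambda>x. \<bar>F x\<bar>)" if e: "e > 0" for e
  proof -
    obtain p where p: "real_polynomial_function p" "\<And>z. z \<in> sphere 0 1 \<Longrightarrow> \<bar>F (Arg z) - p z\<bar> < e"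
      using Stone_Weierstrass_real_polynomial_function[OF compact_sphere periodic_Arg_continuous(1)[OF per cont] e]
      by metis
    define \<psi> where "\<psi> = (\<lambda>x. p (cis x))"
    have \<psi>: "test_function \<psi>"
      unfolding \<psi>_def by (intro trig_poly_test_function real_polynomial_cis_trig_poly p)
    have near: "\<bar>F x - \<psi> x\<bar> \<le> e" for x
      using p(2)[of "cis x"] periodic_Arg_continuous(2)[OF per cont, of x] by (simp add: \<psi>_def)
    have "integral circle (\<lambda>x. F x * F x) = integral circle (\<lambda>x. F x * F x - \<psi> x *\<^sub>R F x)"
      using orth[OF \<psi>] c test_function_continuous[OF \<psi>]
      by (subst Henstock_Kurzweil_Integration.integral_diff)
        (auto intro!: integrable_continuous_interval continuous_intros)
    also have "\<dots> \<le> integral circle (\<lambda>x. e * \<bar>F x\<bar>)"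
    proof (rule integral_le)
      fix x
      have "F x * F x - \<psi> x *\<^sub>R F x = (F x - \<psi> x) * F x" by (simp add: algebra_simps)
      also have "\<dots> \<le> \<bar>F x - \<psi> x\<bar> * \<bar>F x\<bar>" by (metis abs_ge_self abs_mult)
      also have "\<dots> \<le> e * \<bar>F x\<bar>" using near by (intro mult_right_mono) auto
      finally show "F x * F x - \<psi> x *\<^sub>R F x \<le> e * \<bar>F x\<bar>" .
    qed (use c test_function_continuous[OF \<psi>] in \<open>auto intro!: integrable_continuous_interval continuous_intros\<close>)
    finally show ?thesis by simp
  qed
  have "integral circle (\<lambda>x. F x * F x) \<le> 0 + e" if "e > 0" for e
  proof -
    define J where "J = integral circle (\<lambda>x. \<bar>F x\<bar>)"
    have "J \<ge> 0" unfolding J_def by (intro Henstock_Kurzweil_Integration.integral_nonneg)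
        (use c in \<open>auto intro!: integrable_continuous_interval continuous_intros\<close>)
    then have "e / (J + 1) * J \<le> e" using that by (simp add: field_simps)
    moreover have "e / (J + 1) > 0" using \<open>J \<ge> 0\<close> that by simp
    ultimately show ?thesis
      using approx[of "e / (J + 1)"] unfolding J_def[symmetric] by simp
  qed
  then have "integral circle (\<lambda>x. F x * F x) \<le> 0" by (rule field_le_epsilon)
  moreover have "integral circle (\<lambda>x. F x * F x) \<ge> 0"
    by (intro Henstock_Kurzweil_Integration.integral_nonneg)
        (use c in \<open>auto intro!: integrable_continuous_interval continuous_intros\<close>)
  ultimately have "integral circle (\<lambda>x. F x * F x) = 0" by simp
  then have "\<forall>x\<in>circle. F x * F x = 0"
    using c by (subst (asm) integral_eq_0_iff) (auto intro!: continuous_intros)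
  then have "F = (\<lambda>x. 0)"
    using per by (intro periodic_eqI) (auto simp: periodic_def)
  then show ?thesis by simp
qed

text \<open>
  The periodic primitive \<open>F\<close> of \<open>g\<close> is continuous and, by integration by parts, orthogonal to all
  derivatives of test functions; so \<open>F\<close> is constant and all integrals of \<open>g\<close> vanish.
\<close>

lemma orthogonal_to_test_functions:
  fixes g :: "real \<Rightarrow> 'a::euclidean_space"
  assumes per: "periodic g" and g: "g absolutely_integrable_on circle"
    and orth: "\<And>\<psi>. test_function \<psi> \<Longrightarrow> integral circle (\<lambda>x. \<psi> x *\<^sub>R g x) = 0"
  shows "negligible {x. g x \<noteq> 0}"
proof -
  have "integral circle g = 0"
    using orth[OF trig_poly_test_function[OF trig_poly.const[of 1]]] by simp
  then obtain F where F: "periodic F" "is_prim F g" "F 0 = 0"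
    using periodic_primitive[OF per g] by blast
  have cont: "continuous_on A F" for A using is_prim_continuous[OF F(2)] continuous_on_subset by blast
  define m where "m = (1 / (2 * pi)) *\<^sub>R integral circle F"
  have F0: "integral circle (\<lambda>x. \<psi> x *\<^sub>R (F x - m)) = 0" if "test_function \<psi>" for \<psi>
    unfolding m_def
  proof (rule orthogonal_to_derivs)
    show "integral circle (\<lambda>x. deriv \<phi> x *\<^sub>R F x) = 0" if "test_function \<phi>" for \<phi>
      using integration_by_parts_period[OF F(2,1) that] orth[OF that] by simp
  qed (use that cont absolutely_integrable_continuous_real in auto)
  have "F x = m" for x
  proof (rule euclidean_eqI)
    fix b :: 'a
    have "(F x - m) \<bullet> b = 0"
    proof (rule continuous_orthogonal_to_test_functions[where F = "\<lambda>x. (F x - m) \<bullet> b"])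
      show "periodic (\<lambda>x. (F x - m) \<bullet> b)" using F(1) by (simp add: periodic_def)
      show "continuous_on UNIV (\<lambda>x. (F x - m) \<bullet> b)" using cont by (intro continuous_intros)
      show "integral circle (\<lambda>x. \<psi> x *\<^sub>R ((F x - m) \<bullet> b)) = 0" if "test_function \<psi>" for \<psi>
      proof -
        have "(\<lambda>x. \<psi> x *\<^sub>R (F x - m)) integrable_on circle"
          using cont test_function_continuous[OF that]
          by (intro integrable_continuous_interval continuous_intros)
        then have "((\<lambda>x. (\<psi> x *\<^sub>R (F x - m)) \<bullet> b) has_integral (0 \<bullet> b)) circle"
          using F0[OF that] has_integral_linear[OF _ bounded_linear_inner_left[of b], unfolded o_def]
          by (metis has_integral_iff)
        then show ?thesis by (simp add: has_integral_iff)
      qed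
    qed
    then show "F x \<bullet> b = m \<bullet> b" by (simp add: inner_diff_left)
  qed
  then have "negligible {x \<in> circle. g x \<noteq> 0}"
    using is_primD(3)[OF F(2)] by (intro zero_integrals_imp_negligible g) (auto simp: has_integral_iff)
  then show ?thesis
    using periodic_negligible[of "\<lambda>x. g x \<noteq> 0"] per by (simp add: periodic_def)
qed

section \<open>Square-integrable functions on the circle\<close>

definition sqint :: "(real \<Rightarrow> 'a::euclidean_space) \<Rightarrow> bool" where
  "sqint f \<longleftrightarrow> f \<in> borel_measurable (lebesgue_on circle) \<and>
     (\<lambda>x. (norm (f x))\<^sup>2) integrable_on circle"

definition l2 :: "(real \<Rightarrow> 'a::euclidean_space) \<Rightarrow> real" where
  "l2 f = sqrt (integral circle (\<lambda>x. (norm (f x))\<^sup>2))"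

lemma sqint_dominated:
  assumes "f \<in> borel_measurable (lebesgue_on circle)" "h integrable_on circle"
    "\<And>x. x \<in> circle \<Longrightarrow> (norm (f x))\<^sup>2 \<le> h x"
  shows "sqint f"
  unfolding sqint_def
proof
  show "(\<lambda>x. (norm (f x))\<^sup>2) integrable_on circle"
  proof (rule measurable_bounded_by_integrable_imp_integrable[OF _ assms(2)])
    show "(\<lambda>x. (norm (f x))\<^sup>2) \<in> borel_measurable (lebesgue_on circle)"
      using assms(1) by measurable
  qed (use assms(3) in auto)
qed (rule assms)

lemma l2_nonneg: "l2 f \<ge> 0"
  unfolding l2_def by (cases "(\<lambda>x. (norm (f x))\<^sup>2) integrable_on circle")
    (auto simp: not_integrable_integral intro!: Henstock_Kurzweil_Integration.integral_nonneg)

lemma l2_power2: "(l2 f)\<^sup>2 = integral circle (\<lambda>x. (norm (f x))\<^sup>2)"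
  unfolding l2_def by (cases "(\<lambda>x. (norm (f x))\<^sup>2) integrable_on circle")
    (auto simp: not_integrable_integral intro!: Henstock_Kurzweil_Integration.integral_nonneg)

lemma l2_leI:
  assumes "integral circle (\<lambda>x. (norm (f x))\<^sup>2) \<le> B\<^sup>2" "B \<ge> 0"
  shows "l2 f \<le> B"
  using assms by (simp add: l2_def real_le_lsqrt)

lemma continuous_imp_sqint:
  assumes "continuous_on circle f" shows "sqint f"
  unfolding sqint_def using assms
  by (auto intro!: continuous_imp_measurable_on_sets_lebesgue integrable_continuous_interval continuous_intros)

lemma sqint_abs_int:
  assumes "sqint f" shows "f absolutely_integrable_on circle"
proof (rule measurable_bounded_by_integrable_imp_absolutely_integrable[where g = "\<lambda>x. 1 + (norm (f x))\<^sup>2"])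
  show "norm (f x) \<le> 1 + (norm (f x))\<^sup>2" for x
    using sum_squares_bound[of 1 "norm (f x)"] norm_ge_zero[of "f x"]
    by (simp only: power2_eq_square mult_1_left mult_1_right)
  show "(\<lambda>x. 1 + (norm (f x))\<^sup>2) integrable_on circle"
    using assms by (intro integrable_add) (auto simp: sqint_def)
qed (use assms in \<open>auto simp: sqint_def\<close>)

text \<open>
  With weights in the ratio of the two norms, integration yields Minkowski's inequality.
\<close>

lemma norm_add_weighted:
  assumes "a > 0" "b > 0"
  shows "(norm (u + v))\<^sup>2 \<le> (1 + b / a) * (norm u)\<^sup>2 + (1 + a / b) * (norm v)\<^sup>2"
proof -
  have "0 \<le> (b * norm u - a * norm v)\<^sup>2 / (a * b)" using assms by simp
  also have "\<dots> = b / a * (norm u)\<^sup>2 + a / b * (norm v)\<^sup>2 - 2 * norm u * norm v"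
    using assms by (simp add: field_simps power2_eq_square)
  finally have "2 * norm u * norm v \<le> b / a * (norm u)\<^sup>2 + a / b * (norm v)\<^sup>2" by simp
  moreover have "(norm (u + v))\<^sup>2 \<le> (norm u + norm v)\<^sup>2"
    by (intro power_mono norm_triangle_ineq) auto
  ultimately show ?thesis by (simp add: algebra_simps power2_eq_square)
qed

lemma sqint_add:
  assumes "sqint f" "sqint g" shows "sqint (\<lambda>x. f x + g x)"
proof (rule sqint_dominated[where h = "\<lambda>x. 2 * (norm (f x))\<^sup>2 + 2 * (norm (g x))\<^sup>2"])
  show "(\<lambda>x. f x + g x) \<in> borel_measurable (lebesgue_on circle)"
    using assms unfolding sqint_def by (intro borel_measurable_add) auto
  show "(\<lambda>x. 2 * (norm (f x))\<^sup>2 + 2 * (norm (g x))\<^sup>2) integrable_on circle"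
    using assms unfolding sqint_def by (intro integrable_add integrable_on_mult_right) auto
  show "(norm (f x + g x))\<^sup>2 \<le> 2 * (norm (f x))\<^sup>2 + 2 * (norm (g x))\<^sup>2" for x
    using norm_add_weighted[of 1 1 "f x" "g x"] by simp
qed

lemma sqint_scaleR: "sqint f \<Longrightarrow> sqint (\<lambda>x. c *\<^sub>R f x)"
  unfolding sqint_def by (auto simp: power_mult_distrib intro!: integrable_on_mult_right)

lemma l2_scaleR: "l2 (\<lambda>x. c *\<^sub>R f x) = \<bar>c\<bar> * l2 f"
  by (simp add: l2_def power_mult_distrib real_sqrt_mult)

lemma l2_triangle:
  assumes f: "sqint f" and g: "sqint g"
  shows "l2 (\<lambda>x. f x + g x) \<le> l2 f + l2 g"
proof (rule field_le_epsilon)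
  fix e :: real assume "e > 0"
  \<comment> \<open>the shift by \<open>e / 2\<close> makes both weights positive\<close>
  define a b where "a = l2 f + e / 2" and "b = l2 g + e / 2"
  have ab: "a > 0" "b > 0" using l2_nonneg[of f] l2_nonneg[of g] \<open>e > 0\<close> by (auto simp: a_def b_def)
  have int: "(\<lambda>x. (norm (f x))\<^sup>2) integrable_on circle" "(\<lambda>x. (norm (g x))\<^sup>2) integrable_on circle"
    "(\<lambda>x. (norm (f x + g x))\<^sup>2) integrable_on circle"
    using f g sqint_add[OF f g] by (auto simp: sqint_def)
  have "integral circle (\<lambda>x. (norm (f x + g x))\<^sup>2)
      \<le> integral circle (\<lambda>x. (1 + b / a) * (norm (f x))\<^sup>2 + (1 + a / b) * (norm (g x))\<^sup>2)"
    using int ab by (intro integral_le integrable_add integrable_on_mult_right norm_add_weighted)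
  also have "\<dots> = (1 + b / a) * (l2 f)\<^sup>2 + (1 + a / b) * (l2 g)\<^sup>2"
    unfolding l2_power2 using int
    by (subst Henstock_Kurzweil_Integration.integral_add) (auto intro: integrable_on_mult_right)
  also have "\<dots> \<le> (1 + b / a) * a\<^sup>2 + (1 + a / b) * b\<^sup>2"
    using ab l2_nonneg \<open>e > 0\<close>
    by (intro add_mono mult_left_mono power_mono) (auto simp: a_def b_def)
  also have "\<dots> = (a + b)\<^sup>2"
    using ab by (simp add: field_simps power2_eq_square)
  finally have "l2 (\<lambda>x. f x + g x) \<le> a + b"
    using ab by (intro l2_leI) auto
  then show "l2 (\<lambda>x. f x + g x) \<le> l2 f + l2 g + e" by (simp add: a_def b_def)
qed

section \<open>Bounded sets of the Sobolev scale\<close>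

text \<open>
  A ball in \<open>H\<^sup>k\<close>: all derivatives of order below \<open>k\<close> are bounded by \<open>B\<close>, and the one of
  order \<open>k\<close> has root mean square at most \<open>B\<close>.  Normalising by the length \<open>2\<pi>\<close> makes the balls decrease in
  \<open>k\<close> for fixed \<open>B\<close>.  A predicate with a bound is used instead of a norm, since only bounds are ever
  combined.
\<close>

primrec sob :: "nat \<Rightarrow> real \<Rightarrow> (real \<Rightarrow> 'a::euclidean_space) \<Rightarrow> bool" where
  "sob 0 B f \<longleftrightarrow> B \<ge> 0 \<and> periodic f \<and> sqint f \<and> l2 f \<le> sqrt (2 * pi) * B"
| "sob (Suc k) B f \<longleftrightarrow> B \<ge> 0 \<and> periodic f \<and> (\<forall>x. norm (f x) \<le> B) \<and> (\<exists>g. is_prim f g \<and> sob k B g)"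

lemma sob_nonneg: "sob k B f \<Longrightarrow> B \<ge> 0"
  by (cases k) auto

lemma sob_periodic: "sob k B f \<Longrightarrow> periodic f"
  by (cases k) auto

lemma sob_bound: "sob (Suc k) B f \<Longrightarrow> norm (f x) \<le> B"
  by simp

lemma sob_continuous: "sob (Suc k) B f \<Longrightarrow> continuous_on A f"
  using is_prim_continuous continuous_on_subset by (metis sob.simps(2) subset_UNIV)

lemma l2_le_sup:
  assumes "sqint f" "\<And>x. norm (f x) \<le> B" "B \<ge> 0"
  shows "l2 f \<le> sqrt (2 * pi) * B"
proof (rule l2_leI)
  have "integral circle (\<lambda>x. (norm (f x))\<^sup>2) \<le> integral circle (\<lambda>x. B\<^sup>2)"
    using assms by (intro integral_le power_mono) (auto simp: sqint_def)
  then show "integral circle (\<lambda>x. (norm (f x))\<^sup>2) \<le> (sqrt (2 * pi) * B)\<^sup>2"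
    by (simp add: power_mult_distrib)
qed (use assms in auto)

lemma sob_0_sup:
  assumes "continuous_on circle f" "periodic f" "\<And>x. norm (f x) \<le> B"
  shows "sob 0 B f"
proof -
  have "B \<ge> 0" using assms(3)[of 0] norm_ge_zero order_trans by blast
  then show ?thesis using assms l2_le_sup[of f B] continuous_imp_sqint[OF assms(1)] by simp
qed

lemma sob_Suc_lower: "sob (Suc k) B f \<Longrightarrow> sob k B f"
proof (induction k arbitrary: f)
  case 0
  then show ?case using sob_continuous[OF 0] by (intro sob_0_sup) auto
next
  case (Suc k)
  then obtain g where "is_prim f g" "sob (Suc k) B g" by (metis sob.simps(2))
  with Suc.IH[of g] Suc.prems show ?case by auto
qed

lemma sob_le: "m \<le> k \<Longrightarrow> sob k B f \<Longrightarrow> sob m B f"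
  by (induction k) (auto simp: le_Suc_eq intro: sob_Suc_lower simp del: sob.simps)

lemma sob_mono: "sob k B f \<Longrightarrow> B \<le> B' \<Longrightarrow> sob k B' f"
proof (induction k arbitrary: f)
  case 0
  then show ?case
    by (auto intro: order_trans[of "l2 f" "sqrt (2 * pi) * B"] mult_left_mono)
next
  case (Suc k)
  then show ?case by (auto intro: order_trans)
qed

lemma sob_sqint: "sob k B f \<Longrightarrow> sqint f"
  using sob_le[of 0 k B f] by simp

lemma sob_l2: "sob k B f \<Longrightarrow> l2 f \<le> sqrt (2 * pi) * B"
  using sob_le[of 0 k B f] by simp

lemma sob_add:
  "sob k B f \<Longrightarrow> sob k B' g \<Longrightarrow> sob k (B + B') (\<lambda>x. f x + g x)"
proof (induction k arbitrary: f g)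
  case 0
  then have "l2 (\<lambda>x. f x + g x) \<le> sqrt (2 * pi) * B + sqrt (2 * pi) * B'"
    by (auto intro: order_trans[OF l2_triangle] add_mono)
  then show ?case using 0 by (auto simp: periodic_def sqint_add algebra_simps)
next
  case (Suc k)
  then obtain f' g' where "is_prim f f'" "sob k B f'" "is_prim g g'" "sob k B' g'" by auto
  then have "is_prim (\<lambda>x. f x + g x) (\<lambda>x. f' x + g' x)" "sob k (B + B') (\<lambda>x. f' x + g' x)"
    using Suc.IH is_prim_add by auto
  then show ?case using Suc.prems
    by (auto simp: periodic_def intro!: order_trans[OF norm_triangle_ineq] add_mono)
qed

lemma sob_scaleR: "sob k B f \<Longrightarrow> sob k (\<bar>c\<bar> * B) (\<lambda>x. c *\<^sub>R f x)"
proof (induction k arbitrary: f)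
  case 0
  then have "\<bar>c\<bar> * l2 f \<le> \<bar>c\<bar> * (sqrt (2 * pi) * B)" by (intro mult_left_mono) auto
  with 0 show ?case by (auto simp: periodic_def sqint_scaleR l2_scaleR algebra_simps)
next
  case (Suc k)
  then obtain f' where "is_prim f f'" "sob k B f'" by auto
  then have "is_prim (\<lambda>x. c *\<^sub>R f x) (\<lambda>x. c *\<^sub>R f' x)" "sob k (\<bar>c\<bar> * B) (\<lambda>x. c *\<^sub>R f' x)"
    using Suc.IH is_prim_linear[OF _ bounded_linear_scaleR_right] by auto
  then show ?case using Suc.prems by (auto simp: periodic_def intro!: mult_left_mono)
qed

lemma sob_minus: "sob k B f \<Longrightarrow> sob k B (\<lambda>x. - f x)"
  using sob_scaleR[of k B f "-1"] by simp

lemma sob_diff: "sob k B f \<Longrightarrow> sob k B' g \<Longrightarrow> sob k (B + B') (\<lambda>x. f x - g x)"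
  using sob_add[of k B f B' "\<lambda>x. - g x"] sob_minus[of k B' g] by simp

lemma sob_zero: "sob k 0 (\<lambda>x. 0)"
  by (induction k) (auto simp: periodic_def sqint_def l2_def intro: is_prim_const)

section \<open>Multipliers of the Sobolev scale\<close>

text \<open>
  Multipliers of \<open>H\<^sup>k\<close>.  At order 0 they must be bounded, because \<open>L\<^sup>2\<close> is no algebra; from order 1 on,
  \<open>H\<^sup>k\<close> acts on itself.
\<close>

definition mul :: "nat \<Rightarrow> real \<Rightarrow> (real \<Rightarrow> 'a::euclidean_space) \<Rightarrow> bool" where
  "mul k B f \<longleftrightarrow> (if k = 0 then continuous_on UNIV f \<and> periodic f \<and> (\<forall>x. norm (f x) \<le> B) else sob k B f)"

lemma mul_0: "mul 0 B f \<longleftrightarrow> continuous_on UNIV f \<and> periodic f \<and> (\<forall>x. norm (f x) \<le> B)"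
  by (simp add: mul_def)

lemma mul_Suc: "mul (Suc k) B f \<longleftrightarrow> sob (Suc k) B f"
  by (simp add: mul_def)

lemma sob_Suc_mul: "sob (Suc k) B f \<Longrightarrow> mul k B f"
  using sob_continuous[of k B f] sob_Suc_lower[of k B f] by (auto simp: mul_def)

lemma sob_mul: "sob m B f \<Longrightarrow> k \<le> m \<Longrightarrow> m \<ge> 1 \<Longrightarrow> mul k B f"
  using sob_le[of "Suc k" m B f] sob_Suc_mul[of k B f] sob_le[of k m B f]
  by (cases "k = m") (auto simp: mul_def simp del: sob.simps)

lemma mul_sob: "mul k B f \<Longrightarrow> sob k B f"
  by (cases k) (auto simp: mul_def intro!: sob_0_sup intro: continuous_on_subset simp del: sob.simps)

lemma mul_bound: "mul k B f \<Longrightarrow> norm (f x) \<le> B"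
  by (cases k) (auto simp: mul_def)

lemma mul_nonneg: "mul k B f \<Longrightarrow> B \<ge> 0"
  using mul_sob sob_nonneg by blast

lemma mul_continuous: "mul k B f \<Longrightarrow> continuous_on A f"
  by (cases k) (auto simp: mul_def intro: sob_continuous continuous_on_subset simp del: sob.simps)

lemma mul_periodic: "mul k B f \<Longrightarrow> periodic f"
  using mul_sob sob_periodic by blast

lemma mul_Suc_lower: "mul (Suc k) B f \<Longrightarrow> mul k B f"
  by (simp add: mul_Suc sob_Suc_mul del: sob.simps)

lemma mul_mono: "mul k B f \<Longrightarrow> B \<le> B' \<Longrightarrow> mul k B' f"
  by (cases "k = 0") (auto simp: mul_def intro: sob_mono order_trans[of "norm (f _)" B B'])

lemma sob_0_product:
  fixes prod :: "'a::euclidean_space \<Rightarrow> 'b::euclidean_space \<Rightarrow> 'c::euclidean_space"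
  assumes bil: "bounded_bilinear prod" and le: "\<And>a b. norm (prod a b) \<le> norm a * norm b"
    and f: "mul 0 B f" and g: "sob 0 B' g"
  shows "sob 0 (B * B') (\<lambda>x. prod (f x) (g x))"
proof -
  have B: "B \<ge> 0" "B' \<ge> 0" using mul_nonneg[OF f] sob_nonneg[OF g] by auto
  have g': "sqint g" "periodic g" "l2 g \<le> sqrt (2 * pi) * B'" using g by auto
  have le2: "(norm (prod (f x) (g x)))\<^sup>2 \<le> B\<^sup>2 * (norm (g x))\<^sup>2" for x
  proof -
    have "norm (prod (f x) (g x)) \<le> B * norm (g x)"
      using mul_bound[OF f] by (intro order_trans[OF le] mult_right_mono) auto
    then show ?thesis by (metis norm_ge_zero power_mono power_mult_distrib)
  qed
  have int: "(\<lambda>x. B\<^sup>2 * (norm (g x))\<^sup>2) integrable_on circle"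
    using g' by (intro integrable_on_mult_right) (auto simp: sqint_def)
  have sq: "sqint (\<lambda>x. prod (f x) (g x))"
  proof (rule sqint_dominated[OF _ int le2])
    have "f absolutely_integrable_on circle"
      using mul_continuous[OF f] by (rule absolutely_integrable_continuous_real)
    show "(\<lambda>x. prod (f x) (g x)) \<in> borel_measurable (lebesgue_on circle)"
      using bounded_bilinear_abs_int[OF bil mul_continuous[OF f] sqint_abs_int[OF g'(1)]]
      by (rule absolutely_integrable_imp_borel_measurable) auto
  qed
  have "integral circle (\<lambda>x. (norm (prod (f x) (g x)))\<^sup>2) \<le> B\<^sup>2 * (l2 g)\<^sup>2"
    using sq int le2 unfolding l2_power2 sqint_def
    by (subst integral_mult_right[symmetric]) (intro integral_le; simp)
  also have "\<dots> \<le> B\<^sup>2 * (sqrt (2 * pi) * B')\<^sup>2"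
    using g'(3) l2_nonneg by (intro mult_left_mono power_mono) auto
  finally have "l2 (\<lambda>x. prod (f x) (g x)) \<le> sqrt (2 * pi) * (B * B')"
    using B by (intro l2_leI) (auto simp: power_mult_distrib algebra_simps)
  then show ?thesis
    using sq B g'(2) mul_periodic[OF f] by (auto simp: periodic_def)
qed

text \<open>
  The product rule exchanges the role of the factors: in \<open>prod f' g\<close> the second one has a derivative to
  spare and acts as a multiplier, in \<open>prod f g'\<close> the first one.  So both forms go through the induction
  together.  Each derivative doubles the number of terms.
\<close>

lemma sob_product_both:
  fixes prod :: "'a::euclidean_space \<Rightarrow> 'b::euclidean_space \<Rightarrow> 'c::euclidean_space"
  assumes bil: "bounded_bilinear prod" and le: "\<And>a b. norm (prod a b) \<le> norm a * norm b"
  shows "(\<forall>B B' f g. mul k B f \<longrightarrow> sob k B' g \<longrightarrow> sob k (2 ^ k * (B * B')) (\<lambda>x. prod (f x) (g x))) \<and>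
    (\<forall>B B' f g. sob k B f \<longrightarrow> mul k B' g \<longrightarrow> sob k (2 ^ k * (B * B')) (\<lambda>x. prod (f x) (g x)))"
proof (induction k)
  case 0
  show ?case
  proof (intro conjI allI impI)
    fix B B' and f :: "real \<Rightarrow> 'a" and g :: "real \<Rightarrow> 'b"
    show "sob 0 (2 ^ 0 * (B * B')) (\<lambda>x. prod (f x) (g x))" if "mul 0 B f" "sob 0 B' g"
      using sob_0_product[OF bil le that] by simp
    show "sob 0 (2 ^ 0 * (B * B')) (\<lambda>x. prod (f x) (g x))" if "sob 0 B f" "mul 0 B' g"
      using sob_0_product[OF bounded_bilinear.flip[OF bil] _ that(2,1)] le
      by (simp add: mult.commute)
  qed
next
  case (Suc k)
  have "sob (Suc k) (2 ^ Suc k * (B * B')) (\<lambda>x. prod (f x) (g x))"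
    if f: "sob (Suc k) B f" and g: "sob (Suc k) B' g" for B B' f g
  proof -
    obtain f' g' where f': "is_prim f f'" "sob k B f'" and g': "is_prim g g'" "sob k B' g'"
      using f g by auto
    have BB: "B \<ge> 0" "B' \<ge> 0" using f g by auto
    have "sob k (2 ^ k * (B * B') + 2 ^ k * (B * B')) (\<lambda>x. prod (f' x) (g x) + prod (f x) (g' x))"
      using Suc.IH f' g' sob_Suc_mul[OF f] sob_Suc_mul[OF g] by (intro sob_add) auto
    then have "sob k (2 ^ Suc k * (B * B')) (\<lambda>x. prod (f' x) (g x) + prod (f x) (g' x))"
      by (simp add: algebra_simps)
    moreover have "norm (prod (f x) (g x)) \<le> 2 ^ Suc k * (B * B')" for x
    proof -
      have "norm (prod (f x) (g x)) \<le> B * B'"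
        using f g by (intro order_trans[OF le] mult_mono) auto
      also have "\<dots> \<le> 2 ^ Suc k * (B * B')"
        using BB mult_right_mono[of 1 "2 ^ Suc k" "B * B'"] one_le_power[of "2::real" "Suc k"] by simp
      finally show ?thesis .
    qed
    moreover have "periodic (\<lambda>x. prod (f x) (g x))"
      using f g by (auto simp: periodic_def)
    ultimately show ?thesis
      using is_prim_bilinear[OF bil f'(1) g'(1)] BB by auto
  qed
  then show ?case by (simp add: mul_Suc del: sob.simps)
qed

lemmas sob_product = sob_product_both[THEN conjunct1, rule_format]
lemmas sob_product' = sob_product_both[THEN conjunct2, rule_format]

lemma mul_product:
  fixes prod :: "'a::euclidean_space \<Rightarrow> 'b::euclidean_space \<Rightarrow> 'c::euclidean_space"
  assumes bil: "bounded_bilinear prod" and le: "\<And>a b. norm (prod a b) \<le> norm a * norm b"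
    and f: "mul k B f" and g: "mul k B' g"
  shows "mul k (2 ^ k * (B * B')) (\<lambda>x. prod (f x) (g x))"
proof (cases k)
  case 0
  interpret bounded_bilinear prod by (rule bil)
  show ?thesis
    using f g 0 mul_nonneg[OF f]
    by (auto simp: mul_0 periodic_def intro!: continuous_on order_trans[OF le] mult_mono)
next
  case (Suc m)
  then show ?thesis using sob_product[OF bil le f mul_sob[OF g]] by (simp add: mul_Suc del: sob.simps)
qed

lemmas sob_scaleR_mul = sob_product[OF bounded_bilinear_scaleR, simplified]
lemmas sob_scaleR_mul' = sob_product'[OF bounded_bilinear_scaleR, simplified]
lemmas mul_scaleR = mul_product[OF bounded_bilinear_scaleR, simplified]
lemmas sob_inner = sob_product[OF bounded_bilinear_inner Cauchy_Schwarz_ineq2[folded real_norm_def]]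
lemmas mul_inner = mul_product[OF bounded_bilinear_inner Cauchy_Schwarz_ineq2[folded real_norm_def]]

lemma sob_Suc_recip:
  fixes s :: "real \<Rightarrow> real"
  assumes s: "sob (Suc k) B s" and m: "m > 0" "\<And>x. s x \<ge> m"
    and u: "mul k U (\<lambda>x. 1 / s x)"
  shows "sob (Suc k) (1 / m + 4 ^ k * (B * (U * U))) (\<lambda>x. 1 / s x)"
proof -
  obtain s' where s': "is_prim s s'" "sob k B s'" using s by auto
  have B: "B \<ge> 0" "U \<ge> 0" using sob_nonneg[OF s] mul_nonneg[OF u] by auto
  have nz: "s x \<noteq> 0" for x using m(1) m(2)[of x] by linarith
  have "mul k (2 ^ k * (U * U)) (\<lambda>x. (1 / s x) * (1 / s x))"
    using mul_scaleR[OF u u] by simp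
  then have "sob k (2 ^ k * (B * (2 ^ k * (U * U)))) (\<lambda>x. s' x * ((1 / s x) * (1 / s x)))"
    using sob_scaleR_mul'[OF s'(2), of _ "\<lambda>x. (1 / s x) * (1 / s x)"] by simp
  then have "sob k (4 ^ k * (B * (U * U))) (\<lambda>x. - (s' x * ((1 / s x) * (1 / s x))))"
    using sob_minus by (simp add: power_mult_distrib[symmetric] algebra_simps)
  then have "sob k (1 / m + 4 ^ k * (B * (U * U))) (\<lambda>x. - (s' x * ((1 / s x) * (1 / s x))))"
    by (rule sob_mono) (use m in auto)
  moreover have "norm (1 / s x) \<le> 1 / m + 4 ^ k * (B * (U * U))" for x
  proof -
    have "norm (1 / s x) \<le> 1 / m" using m(1) m(2)[of x] by (simp add: frac_le)
    moreover have "4 ^ k * (B * (U * U)) \<ge> 0" using B by simp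
    ultimately show ?thesis by linarith
  qed
  moreover have "periodic (\<lambda>x. 1 / s x)" using sob_periodic[OF s] by (auto simp: periodic_def)
  ultimately show ?thesis using is_prim_inverse[OF s'(1) nz] B m by auto
qed

lemma mul_recip:
  assumes "m > 0" "B \<ge> 0"
  shows "\<exists>U. \<forall>s::real \<Rightarrow> real. mul k B s \<longrightarrow> (\<forall>x. s x \<ge> m) \<longrightarrow> mul k U (\<lambda>x. 1 / s x)"
proof (induction k)
  case 0
  have "mul 0 (1 / m) (\<lambda>x. 1 / s x)" if "mul 0 B s" "\<forall>x. s x \<ge> m" for s
  proof -
    have "s x > 0" for x using that(2) assms(1) less_le_trans by blast
    then have "s x \<noteq> 0" for x by (metis less_irrefl)
    then show ?thesis using that assms \<open>\<And>x. s x > 0\<close>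
      by (auto simp: mul_0 periodic_def abs_of_pos intro!: continuous_on_divide frac_le)
  qed
  then show ?case by blast
next
  case (Suc k)
  then obtain U where U: "\<And>s::real \<Rightarrow> real. mul k B s \<Longrightarrow> (\<And>x. s x \<ge> m) \<Longrightarrow> mul k U (\<lambda>x. 1 / s x)" by blast
  have "mul (Suc k) (1 / m + 4 ^ k * (B * (U * U))) (\<lambda>x. 1 / s x)"
    if "mul (Suc k) B s" "\<forall>x. s x \<ge> m" for s
    using sob_Suc_recip[of k B s m U] U[OF mul_Suc_lower] that assms by (simp add: mul_Suc del: sob.simps)
  then show ?case by blast
qed

text \<open>
  In the derivative \<open>(f \<bullet> f') / norm f\<close> only the factor \<open>f'\<close> carries the highest order, so the bound is
  linear in \<open>Q\<close>, with a coefficient that involves \<open>f\<close> at the lower order only.  Gronwall's argument along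
  paths depends on this linearity.
\<close>

lemma sob_Suc_norm:
  fixes f :: "real \<Rightarrow> 'a::euclidean_space"
  assumes f: "sob (Suc k) Q f" and nz: "\<And>x. f x \<noteq> 0"
    and u: "mul k U (\<lambda>x. 1 / norm (f x))" and B: "mul k B f"
  shows "sob (Suc k) ((1 + 4 ^ k * (U * B)) * Q) (\<lambda>x. norm (f x))"
proof -
  obtain f' where f': "is_prim f f'" "sob k Q f'" using f by auto
  have nn: "Q \<ge> 0" "U \<ge> 0" "B \<ge> 0" using sob_nonneg[OF f] mul_nonneg[OF u] mul_nonneg[OF B] by auto
  have "sob k (2 ^ k * (U * (2 ^ k * (B * Q)))) (\<lambda>x. (1 / norm (f x)) * (f x \<bullet> f' x))"
    using sob_scaleR_mul[OF u sob_inner[OF B f'(2)]] by simp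
  then have "sob k ((1 + 4 ^ k * (U * B)) * Q) (\<lambda>x. (1 / norm (f x)) * (f x \<bullet> f' x))"
    by (rule sob_mono) (use nn in \<open>simp add: algebra_simps flip: power_mult_distrib\<close>)
  moreover have "norm (norm (f x)) \<le> (1 + 4 ^ k * (U * B)) * Q" for x
  proof -
    have "norm (f x) \<le> Q" using f by simp
    moreover have "4 ^ k * (U * B) * Q \<ge> 0" using nn by simp
    ultimately show ?thesis by (simp add: algebra_simps)
  qed
  moreover have "periodic (\<lambda>x. norm (f x))" using sob_periodic[OF f] by (auto simp: periodic_def)
  ultimately show ?thesis using is_prim_norm[OF f'(1) nz] nn by auto
qed

text \<open>
  Norm and reciprocal norm are treated together: one more order for \<open>norm f\<close> needs the reciprocal at the
  present order, and vice versa.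
\<close>

lemma mul_norm:
  assumes m: "m > 0" and B: "B \<ge> 0"
  shows "\<exists>S U. \<forall>f::real \<Rightarrow> 'a::euclidean_space. mul k B f \<longrightarrow> (\<forall>x. norm (f x) \<ge> m) \<longrightarrow>
    mul k S (\<lambda>x. norm (f x)) \<and> mul k U (\<lambda>x. 1 / norm (f x))"
proof (induction k)
  case 0
  obtain U where U: "\<And>s::real \<Rightarrow> real. mul 0 B s \<Longrightarrow> \<forall>x. s x \<ge> m \<Longrightarrow> mul 0 U (\<lambda>x. 1 / s x)"
    using mul_recip[OF m B, of 0] by blast
  have "mul 0 B (\<lambda>x. norm (f x))" if "mul 0 B f" for f :: "real \<Rightarrow> 'a"
    using that by (auto simp: mul_0 periodic_def intro: continuous_on_norm)
  then show ?case using U by blast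
next
  case (Suc k)
  then obtain S U where SU: "\<And>f::real \<Rightarrow> 'a. mul k B f \<Longrightarrow> \<forall>x. norm (f x) \<ge> m \<Longrightarrow>
    mul k S (\<lambda>x. norm (f x)) \<and> mul k U (\<lambda>x. 1 / norm (f x))" by blast
  define S' where "S' = \<bar>(1 + 4 ^ k * (U * B)) * B\<bar>"
  have S': "mul (Suc k) S' (\<lambda>x. norm (f x))" if "mul (Suc k) B f" "\<forall>x. norm (f x) \<ge> m" for f :: "real \<Rightarrow> 'a"
  proof -
    have "f x \<noteq> 0" for x using that(2) m by (metis norm_zero not_less)
    then have "sob (Suc k) ((1 + 4 ^ k * (U * B)) * B) (\<lambda>x. norm (f x))"
      using that SU[OF mul_Suc_lower[OF that(1)] that(2)] mul_Suc_lower[OF that(1)]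
      by (intro sob_Suc_norm) (auto simp: mul_Suc simp del: sob.simps)
    then show ?thesis unfolding mul_Suc S'_def by (rule sob_mono) simp
  qed
  have "S' \<ge> 0" by (simp add: S'_def)
  then obtain U' where U': "\<And>s::real \<Rightarrow> real. mul (Suc k) S' s \<Longrightarrow> \<forall>x. s x \<ge> m \<Longrightarrow> mul (Suc k) U' (\<lambda>x. 1 / s x)"
    using mul_recip[OF m, of S' "Suc k"] by blast
  show ?case using S' U' by blast
qed

section \<open>Weak derivatives and the space of order n\<close>

lemma is_weak_deriv_unique:
  assumes "is_weak_deriv k f g" "is_weak_deriv k f h"
  shows "negligible {x. g x \<noteq> h x}"
proof -
  have g: "periodic g" "g absolutely_integrable_on circle"
    and h: "periodic h" "h absolutely_integrable_on circle"
    using assms by (auto simp: is_weak_deriv_def)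
  have "negligible {x. g x - h x \<noteq> 0}"
  proof (rule orthogonal_to_test_functions)
    fix \<psi> :: "real \<Rightarrow> real" assume \<psi>: "test_function \<psi>"
    have "integral circle (\<lambda>\<theta>. (deriv ^^ k) \<psi> \<theta> *\<^sub>R f \<theta>) =
        (- 1) ^ k *\<^sub>R integral circle (\<lambda>x. \<psi> x *\<^sub>R g x)"
      "integral circle (\<lambda>\<theta>. (deriv ^^ k) \<psi> \<theta> *\<^sub>R f \<theta>) =
        (- 1) ^ k *\<^sub>R integral circle (\<lambda>x. \<psi> x *\<^sub>R h x)"
      using assms \<psi> by (simp_all add: is_weak_deriv_def)
    then have "(- 1) ^ k *\<^sub>R integral circle (\<lambda>x. \<psi> x *\<^sub>R g x) =
        (- 1) ^ k *\<^sub>R integral circle (\<lambda>x. \<psi> x *\<^sub>R h x)"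
      by (rule trans[OF sym])
    then have "integral circle (\<lambda>x. \<psi> x *\<^sub>R g x) = integral circle (\<lambda>x. \<psi> x *\<^sub>R h x)"
      by simp
    then show "integral circle (\<lambda>x. \<psi> x *\<^sub>R (g x - h x)) = 0"
      using test_function_integrable[OF \<psi> g(2)] test_function_integrable[OF \<psi> h(2)]
      by (simp add: scaleR_diff_right Henstock_Kurzweil_Integration.integral_diff)
  qed (use g h in \<open>auto simp: periodic_def\<close>)
  then show ?thesis by simp
qed

lemma is_weak_deriv_0:
  "periodic f \<Longrightarrow> f absolutely_integrable_on circle \<Longrightarrow> is_weak_deriv 0 f f"
  by (simp add: is_weak_deriv_def)

lemma is_weak_deriv_funpow:
  assumes "is_weak_deriv 1 f g" "is_weak_deriv (Suc k) f h"
  shows "is_weak_deriv k g h"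
  unfolding is_weak_deriv_def
proof (intro conjI allI impI)
  fix \<phi> :: "real \<Rightarrow> real" assume \<phi>: "test_function \<phi>"
  have "integral circle (\<lambda>\<theta>. deriv ((deriv ^^ k) \<phi>) \<theta> *\<^sub>R f \<theta>) =
      - integral circle (\<lambda>\<theta>. (deriv ^^ k) \<phi> \<theta> *\<^sub>R g \<theta>)"
    using assms(1) test_function_funpow_deriv[OF \<phi>, of k] by (auto simp: is_weak_deriv_def)
  moreover have "integral circle (\<lambda>\<theta>. deriv ((deriv ^^ k) \<phi>) \<theta> *\<^sub>R f \<theta>) =
      (- 1) ^ Suc k *\<^sub>R integral circle (\<lambda>\<theta>. \<phi> \<theta> *\<^sub>R h \<theta>)"
    using assms(2) \<phi> by (auto simp: is_weak_deriv_def)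
  ultimately have "- integral circle (\<lambda>\<theta>. (deriv ^^ k) \<phi> \<theta> *\<^sub>R g \<theta>) =
      - ((- 1) ^ k *\<^sub>R integral circle (\<lambda>\<theta>. \<phi> \<theta> *\<^sub>R h \<theta>))"
    by simp
  then show "integral circle (\<lambda>\<theta>. (deriv ^^ k) \<phi> \<theta> *\<^sub>R g \<theta>) =
      (- 1) ^ k *\<^sub>R integral circle (\<lambda>\<theta>. \<phi> \<theta> *\<^sub>R h \<theta>)"
    by (simp only: neg_equal_iff_equal)
qed (use assms in \<open>auto simp: is_weak_deriv_def\<close>)

lemma is_prim_abs_int: "is_prim f g \<Longrightarrow> f absolutely_integrable_on {a..b}"
  using is_prim_continuous continuous_on_subset
  by (intro absolutely_integrable_continuous_real) blast

lemma is_weak_deriv_Suc: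
  assumes f: "is_prim f g" "periodic f" and h: "is_weak_deriv k g h"
  shows "is_weak_deriv (Suc k) f h"
  unfolding is_weak_deriv_def
proof (intro conjI allI impI)
  fix \<phi> :: "real \<Rightarrow> real" assume \<phi>: "test_function \<phi>"
  have "integral circle (\<lambda>\<theta>. (deriv ^^ Suc k) \<phi> \<theta> *\<^sub>R f \<theta>) =
      - integral circle (\<lambda>\<theta>. (deriv ^^ k) \<phi> \<theta> *\<^sub>R g \<theta>)"
    using integration_by_parts_period[OF f test_function_funpow_deriv[OF \<phi>, of k]] by simp
  also have "\<dots> = (- 1) ^ Suc k *\<^sub>R integral circle (\<lambda>\<theta>. \<phi> \<theta> *\<^sub>R h \<theta>)"
    using h \<phi> by (simp add: is_weak_deriv_def)
  finally show "integral circle (\<lambda>\<theta>. (deriv ^^ Suc k) \<phi> \<theta> *\<^sub>R f \<theta>) =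
      (- 1) ^ Suc k *\<^sub>R integral circle (\<lambda>\<theta>. \<phi> \<theta> *\<^sub>R h \<theta>)" .
qed (use assms is_prim_abs_int in \<open>auto simp: is_weak_deriv_def\<close>)

lemma is_weak_deriv_1_prim:
  assumes "is_prim f g" "periodic f" "periodic g" shows "is_weak_deriv 1 f g"
  using is_weak_deriv_Suc[OF assms(1,2) is_weak_deriv_0[OF assms(3) is_primD(1)[OF assms(1)]]] by simp

text \<open>
  The lemma of du Bois-Reymond: \<open>f\<close> minus a periodic primitive of \<open>g\<close> is orthogonal to all derivatives of
  test functions, hence constant almost everywhere.
\<close>

lemma is_weak_deriv_1_imp_prim:
  fixes f :: "real \<Rightarrow> real ^ 'd"
  assumes fg: "is_weak_deriv 1 f g"
  obtains F where "periodic F" "is_prim F g" "negligible {x. f x \<noteq> F x}"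
proof -
  have f: "periodic f" "f absolutely_integrable_on circle"
    and g: "periodic g" "g absolutely_integrable_on circle"
    using fg by (simp_all add: is_weak_deriv_def)
  have eq: "integral circle (\<lambda>\<theta>. deriv \<phi> \<theta> *\<^sub>R f \<theta>) =
        - integral circle (\<lambda>\<theta>. \<phi> \<theta> *\<^sub>R g \<theta>)" if "test_function \<phi>" for \<phi>
    using fg that by (simp add: is_weak_deriv_def)
  have "integral circle g = 0"
    using eq[OF trig_poly_test_function[OF trig_poly.const[of 1]]] by simp
  then obtain F where F: "periodic F" "is_prim F g"
    using periodic_primitive[OF g] by blast
  define w where "w = (\<lambda>x. f x - F x)"
  define m where "m = (1 / (2 * pi)) *\<^sub>R integral circle w"
  have w: "w absolutely_integrable_on circle"
    unfolding w_def using f(2) is_prim_abs_int[OF F(2)] by (intro set_integral_diff) auto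
  have "negligible {x. w x - m \<noteq> 0}"
  proof (rule orthogonal_to_test_functions)
    show "periodic (\<lambda>x. w x - m)" using f(1) F(1) by (simp add: periodic_def w_def)
    show "(\<lambda>x. w x - m) absolutely_integrable_on circle"
      using w by (intro set_integral_diff) auto
    show "integral circle (\<lambda>x. \<psi> x *\<^sub>R (w x - m)) = 0" if "test_function \<psi>" for \<psi>
      unfolding m_def
    proof (rule orthogonal_to_derivs[OF w _ that])
      fix \<phi> :: "real \<Rightarrow> real" assume \<phi>: "test_function \<phi>"
      have "integral circle (\<lambda>\<theta>. deriv \<phi> \<theta> *\<^sub>R f \<theta>) = integral circle (\<lambda>\<theta>. deriv \<phi> \<theta> *\<^sub>R F \<theta>)"
        using eq[OF \<phi>] integration_by_parts_period[OF F(2,1) \<phi>] by simp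
      then show "integral circle (\<lambda>x. deriv \<phi> x *\<^sub>R w x) = 0"
        unfolding w_def scaleR_diff_right
        using test_function_integrable[OF test_function_deriv[OF \<phi>] f(2)]
          test_function_integrable[OF test_function_deriv[OF \<phi>] is_prim_abs_int[OF F(2)]]
        by (simp add: Henstock_Kurzweil_Integration.integral_diff)
    qed
  qed
  moreover have "w x - m = 0 \<longleftrightarrow> f x = F x + m" for x
    by (simp only: w_def diff_diff_eq right_minus_eq)
  ultimately have "negligible {x. f x \<noteq> F x + m}" by simp
  moreover have "is_prim (\<lambda>x. F x + m) g"
    using is_prim_add[OF F(2) is_prim_const[of m]] by simp
  moreover have "periodic (\<lambda>x. F x + m)" using F(1) by (simp add: periodic_def)
  ultimately show thesis using that by blast
qed

lemma is_weak_deriv_cong: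
  fixes f f2 :: "real \<Rightarrow> real ^ 'd"
  assumes "negligible {x. f x \<noteq> f2 x}" "periodic f" "periodic f2"
  shows "is_weak_deriv k f = is_weak_deriv k f2"
proof -
  have transfer: "is_weak_deriv k f2 g" if neg: "negligible {x. f x \<noteq> f2 x}" and "periodic f2"
    and wd: "is_weak_deriv k f g" for f f2 g :: "real \<Rightarrow> real ^ 'd"
    unfolding is_weak_deriv_def
  proof (intro conjI allI impI)
    show "f2 absolutely_integrable_on circle"
    proof (rule absolutely_integrable_spike[OF _ neg])
      show "f absolutely_integrable_on circle" using wd by (simp add: is_weak_deriv_def)
    qed auto
    fix \<phi> :: "real \<Rightarrow> real" assume "test_function \<phi>"
    moreover have "integral circle (\<lambda>\<theta>. (deriv ^^ k) \<phi> \<theta> *\<^sub>R f2 \<theta>) =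
        integral circle (\<lambda>\<theta>. (deriv ^^ k) \<phi> \<theta> *\<^sub>R f \<theta>)"
      by (rule integral_spike[OF neg]) auto
    ultimately show "integral circle (\<lambda>\<theta>. (deriv ^^ k) \<phi> \<theta> *\<^sub>R f2 \<theta>) =
        (- 1) ^ k *\<^sub>R integral circle (\<lambda>\<theta>. \<phi> \<theta> *\<^sub>R g \<theta>)"
      using wd by (simp add: is_weak_deriv_def)
  qed (use \<open>periodic f2\<close> wd in \<open>simp_all add: is_weak_deriv_def\<close>)
  have "{x. f2 x \<noteq> f x} = {x. f x \<noteq> f2 x}" by auto
  then have "negligible {x. f2 x \<noteq> f x}" using assms(1) by simp
  with transfer assms show ?thesis by blast
qed

lemma continuous_ae_eq:
  fixes f g :: "real \<Rightarrow> 'a::real_normed_vector"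
  assumes "continuous_on UNIV f" "continuous_on UNIV g" "negligible {x. f x \<noteq> g x}"
  shows "f = g"
proof (rule ccontr)
  assume "f \<noteq> g"
  then have "{x. f x \<noteq> g x} \<noteq> {}" by auto
  moreover have "open {x. f x \<noteq> g x}" using assms by (intro open_Collect_neq)
  ultimately show False using assms(3) open_not_negligible by blast
qed

lemma sob_imp_weak_deriv:
  fixes f :: "real \<Rightarrow> real ^ 'd"
  shows "sob k B f \<Longrightarrow> \<exists>g. is_weak_deriv k f g \<and> sob 0 B g"
proof (induction k arbitrary: f)
  case 0
  then show ?case using is_weak_deriv_0 sqint_abs_int by (metis sob.simps(1))
next
  case (Suc k)
  then show ?case using is_weak_deriv_Suc by (metis sob.simps(2))
qed

text \<open>
  The weak derivatives of \<open>g\<^sub>1\<close>, the first weak derivative of \<open>f\<close>, are those of \<open>f\<close> shifted by one, so the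
  induction hypothesis represents \<open>g\<^sub>1\<close> by an iterated primitive \<open>G\<close>; then \<open>f\<close> is represented by a primitive
  of \<open>G\<close>.
\<close>

lemma weak_derivs_imp_sob:
  fixes f :: "real \<Rightarrow> real ^ 'd"
  assumes "\<And>k. k \<le> n \<Longrightarrow> \<exists>g. is_weak_deriv k f g \<and> (\<lambda>\<theta>. (norm (g \<theta>))\<^sup>2) integrable_on circle"
  shows "\<exists>F B. negligible {x. f x \<noteq> F x} \<and> sob n B F"
  using assms
proof (induction n arbitrary: f)
  case 0
  then obtain g where g: "is_weak_deriv 0 f g" "(\<lambda>\<theta>. (norm (g \<theta>))\<^sup>2) integrable_on circle" by blast
  then have "periodic f" "f absolutely_integrable_on circle" "periodic g" "g absolutely_integrable_on circle"
    by (auto simp: is_weak_deriv_def)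
  then have "negligible {x. f x \<noteq> g x}"
    using is_weak_deriv_unique[OF is_weak_deriv_0 g(1)] by blast
  moreover have "sqint g"
    using g(2) \<open>g absolutely_integrable_on circle\<close>
    by (simp add: sqint_def absolutely_integrable_imp_borel_measurable)
  then have "sob 0 (l2 g / sqrt (2 * pi)) g" using \<open>periodic g\<close> l2_nonneg[of g] by simp
  ultimately show ?case by blast
next
  case (Suc n)
  obtain g1 where g1: "is_weak_deriv 1 f g1" using Suc.prems[of 1] by auto
  have "\<exists>g. is_weak_deriv k g1 g \<and> (\<lambda>\<theta>. (norm (g \<theta>))\<^sup>2) integrable_on circle" if "k \<le> n" for k
    using Suc.prems[of "Suc k"] is_weak_deriv_funpow[OF g1] that by auto
  then obtain G B where G: "negligible {x. g1 x \<noteq> G x}" "sob n B G" using Suc.IH by blast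
  obtain F where F: "periodic F" "is_prim F g1" "negligible {x. f x \<noteq> F x}"
    using is_weak_deriv_1_imp_prim[OF g1] by blast
  have FG: "is_prim F G" using is_prim_spike[OF F(2) G(1)] by auto
  have "compact (F ` circle)"
    using is_prim_continuous[OF F(2)] continuous_on_subset by (intro compact_continuous_image) auto
  then obtain b where b: "\<And>x. x \<in> circle \<Longrightarrow> norm (F x) \<le> b"
    using compact_imp_bounded bounded_iff by (metis imageI)
  have "norm (F x) \<le> max b B" for x
  proof -
    obtain k :: int where k: "x - 2 * pi * of_int k \<in> {0..<2 * pi}" by (rule periodic_reduce)
    then have "norm (F (x - 2 * pi * of_int k)) \<le> b" by (intro b) auto
    then show ?thesis using periodic_add_int[OF F(1), of "x - 2 * pi * of_int k" k] by simp
  qed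
  then have "sob (Suc n) (max b B) F"
    using F(1) FG sob_mono[OF G(2), of "max b B"] sob_nonneg[OF G(2)] by auto
  then show ?case using F(3) by blast
qed

lemma Hn_iff_sob:
  fixes f :: "real \<Rightarrow> real ^ 'd"
  assumes "n \<ge> 1"
  shows "f \<in> Hn n \<longleftrightarrow> (\<exists>B. sob n B f)"
proof
  assume f: "f \<in> Hn n"
  then obtain F B where F: "negligible {x. f x \<noteq> F x}" "sob n B F"
    using weak_derivs_imp_sob[of n f] by (auto simp: Hn_def)
  moreover have "continuous_on UNIV F"
    using F(2) assms by (cases n) (auto intro: sob_continuous simp del: sob.simps)
  ultimately have "f = F" using f by (intro continuous_ae_eq) (auto simp: Hn_def)
  then show "\<exists>B. sob n B f" using F(2) by blast
next
  assume "\<exists>B. sob n B f"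
  then obtain B where B: "sob n B f" by blast
  have "\<exists>g. is_weak_deriv k f g \<and> (\<lambda>\<theta>. (norm (g \<theta>))\<^sup>2) integrable_on circle" if "k \<le> n" for k
    using sob_imp_weak_deriv[OF sob_le[OF that B]] by (auto simp: sqint_def)
  moreover have "continuous_on UNIV f"
    using B assms by (cases n) (auto intro: sob_continuous simp del: sob.simps)
  ultimately show "f \<in> Hn n" by (simp add: Hn_def)
qed

text \<open>
  The choice of a weak derivative in \<open>Hn_norm\<close> does not affect the integral, by uniqueness almost
  everywhere.
\<close>

lemma Hn_norm_eq:
  fixes f :: "real \<Rightarrow> real ^ 'd"
  assumes f: "sqint f" and g: "is_weak_deriv n f g" "sqint g"
  shows "Hn_norm n f = sqrt ((l2 f)\<^sup>2 + (l2 g)\<^sup>2)"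
proof -
  have "is_weak_deriv n f (weak_deriv n f)" unfolding weak_deriv_def using g(1) by (rule someI[where P = "is_weak_deriv n f"])
  then have neg: "negligible {x. g x \<noteq> weak_deriv n f x}" using g(1) is_weak_deriv_unique by blast
  have "integral circle (\<lambda>\<theta>. (norm (f \<theta>))\<^sup>2 + (norm (weak_deriv n f \<theta>))\<^sup>2) =
      integral circle (\<lambda>\<theta>. (norm (f \<theta>))\<^sup>2 + (norm (g \<theta>))\<^sup>2)"
    by (rule integral_spike[OF neg]) auto
  also have "\<dots> = (l2 f)\<^sup>2 + (l2 g)\<^sup>2"
    unfolding l2_power2 using f g by (intro Henstock_Kurzweil_Integration.integral_add) (auto simp: sqint_def)
  finally show ?thesis by (simp add: Hn_norm_def)
qed

lemma Hn_norm_le_sob: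
  fixes f :: "real \<Rightarrow> real ^ 'd"
  assumes "sob n B f" shows "Hn_norm n f \<le> 4 * B"
proof -
  obtain g where g: "is_weak_deriv n f g" "sob 0 B g" using sob_imp_weak_deriv[OF assms] by blast
  have B: "B \<ge> 0" using sob_nonneg[OF assms] .
  have l: "(l2 f)\<^sup>2 \<le> (sqrt (2 * pi) * B)\<^sup>2" "(l2 g)\<^sup>2 \<le> (sqrt (2 * pi) * B)\<^sup>2"
    using sob_l2[OF assms] sob_l2[OF g(2)] l2_nonneg by (auto intro!: power_mono)
  have "2 * pi * B\<^sup>2 + 2 * pi * B\<^sup>2 \<le> 16 * B\<^sup>2"
    using pi_less_4 by (simp add: algebra_simps mult_right_mono)
  then have "(l2 f)\<^sup>2 + (l2 g)\<^sup>2 \<le> (4 * B)\<^sup>2"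
    using l by (simp add: power_mult_distrib)
  then show ?thesis
    using Hn_norm_eq[OF sob_sqint[OF assms] g(1) sob_sqint[OF g(2)]] B by (simp add: real_le_lsqrt)
qed

lemma Hn_norm_nonneg: "Hn_norm n f \<ge> 0"
  unfolding Hn_norm_def
  by (cases "(\<lambda>\<theta>. (norm (f \<theta>))\<^sup>2 + (norm (weak_deriv n f \<theta>))\<^sup>2) integrable_on circle")
    (auto simp: not_integrable_integral intro!: Henstock_Kurzweil_Integration.integral_nonneg)

lemma Hn_weak_deriv:
  fixes f :: "real \<Rightarrow> real ^ 'd"
  assumes "f \<in> Hn n" "n \<ge> 1"
  obtains g where "is_weak_deriv n f g" "sqint g" "sqint f" "Hn_norm n f = sqrt ((l2 f)\<^sup>2 + (l2 g)\<^sup>2)"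
proof -
  obtain B where B: "sob n B f" using assms Hn_iff_sob by blast
  obtain g where g: "is_weak_deriv n f g" "sob 0 B g" using sob_imp_weak_deriv[OF B] by blast
  then show thesis using that Hn_norm_eq sob_sqint B by blast
qed

lemma Hn_add: "f \<in> Hn n \<Longrightarrow> g \<in> Hn n \<Longrightarrow> n \<ge> 1 \<Longrightarrow> (\<lambda>x. f x + g x) \<in> Hn n"
  using sob_add Hn_iff_sob by metis

lemma Hn_scaleR: "f \<in> Hn n \<Longrightarrow> n \<ge> 1 \<Longrightarrow> (\<lambda>x. c *\<^sub>R f x) \<in> Hn n"
  using sob_scaleR Hn_iff_sob by metis

lemma Hn_diff: "f \<in> Hn n \<Longrightarrow> g \<in> Hn n \<Longrightarrow> n \<ge> 1 \<Longrightarrow> (\<lambda>x. f x - g x) \<in> Hn n"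
  using sob_diff Hn_iff_sob by metis

lemma Hn_zero: "n \<ge> 1 \<Longrightarrow> (\<lambda>x. 0) \<in> Hn n"
  using sob_zero Hn_iff_sob by metis

lemma Hn_le: "f \<in> Hn n \<Longrightarrow> 1 \<le> k \<Longrightarrow> k \<le> n \<Longrightarrow> f \<in> Hn k"
  by (auto simp: Hn_def)

lemma is_weak_deriv_add:
  assumes "is_weak_deriv k f f'" "is_weak_deriv k g g'"
  shows "is_weak_deriv k (\<lambda>x. f x + g x) (\<lambda>x. f' x + g' x)"
  unfolding is_weak_deriv_def
proof (intro conjI allI impI)
  fix \<phi> :: "real \<Rightarrow> real" assume \<phi>: "test_function \<phi>"
  have ai: "f absolutely_integrable_on circle" "f' absolutely_integrable_on circle"
    "g absolutely_integrable_on circle" "g' absolutely_integrable_on circle"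
    using assms by (auto simp: is_weak_deriv_def)
  note int = test_function_integrable[OF \<phi>] test_function_integrable[OF test_function_funpow_deriv[OF \<phi>]]
  show "integral circle (\<lambda>\<theta>. (deriv ^^ k) \<phi> \<theta> *\<^sub>R (f \<theta> + g \<theta>)) =
      (- 1) ^ k *\<^sub>R integral circle (\<lambda>\<theta>. \<phi> \<theta> *\<^sub>R (f' \<theta> + g' \<theta>))"
    using assms \<phi>
      Henstock_Kurzweil_Integration.integral_add[OF int(1)[OF ai(2)] int(1)[OF ai(4)]]
      Henstock_Kurzweil_Integration.integral_add[OF int(2)[OF ai(1)] int(2)[OF ai(3)], of k k]
    by (simp add: scaleR_add_right is_weak_deriv_def)
qed (use assms in \<open>auto simp: is_weak_deriv_def periodic_def intro!: set_integral_add\<close>)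

lemma Hn_norm_triangle:
  fixes f g :: "real \<Rightarrow> real ^ 'd"
  assumes "f \<in> Hn n" "g \<in> Hn n" "n \<ge> 1"
  shows "Hn_norm n (\<lambda>x. f x + g x) \<le> Hn_norm n f + Hn_norm n g"
proof -
  obtain f' where f': "is_weak_deriv n f f'" "sqint f'" "sqint f" "Hn_norm n f = sqrt ((l2 f)\<^sup>2 + (l2 f')\<^sup>2)"
    using Hn_weak_deriv assms by blast
  obtain g' where g': "is_weak_deriv n g g'" "sqint g'" "sqint g" "Hn_norm n g = sqrt ((l2 g)\<^sup>2 + (l2 g')\<^sup>2)"
    using Hn_weak_deriv assms by blast
  have "Hn_norm n (\<lambda>x. f x + g x) = sqrt ((l2 (\<lambda>x. f x + g x))\<^sup>2 + (l2 (\<lambda>x. f' x + g' x))\<^sup>2)"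
    using f' g' by (intro Hn_norm_eq is_weak_deriv_add sqint_add)
  also have "\<dots> \<le> sqrt ((l2 f + l2 g)\<^sup>2 + (l2 f' + l2 g')\<^sup>2)"
    using f' g' l2_nonneg by (intro real_sqrt_le_mono add_mono power_mono l2_triangle) auto
  also have "\<dots> \<le> sqrt ((l2 f)\<^sup>2 + (l2 f')\<^sup>2) + sqrt ((l2 g)\<^sup>2 + (l2 g')\<^sup>2)"
    by (rule real_sqrt_sum_squares_triangle_ineq)
  finally show ?thesis using f' g' by simp
qed

lemma Hn_norm_scaleR:
  fixes f :: "real \<Rightarrow> real ^ 'd"
  assumes "f \<in> Hn n" "n \<ge> 1"
  shows "Hn_norm n (\<lambda>x. c *\<^sub>R f x) = \<bar>c\<bar> * Hn_norm n f"
proof -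
  obtain f' where f': "is_weak_deriv n f f'" "sqint f'" "sqint f" "Hn_norm n f = sqrt ((l2 f)\<^sup>2 + (l2 f')\<^sup>2)"
    using Hn_weak_deriv assms by blast
  have "is_weak_deriv n (\<lambda>x. c *\<^sub>R f x) (\<lambda>x. c *\<^sub>R f' x)"
    unfolding is_weak_deriv_def
  proof (intro conjI allI impI)
    fix \<phi> :: "real \<Rightarrow> real" assume \<phi>: "test_function \<phi>"
    have E: "integral circle (\<lambda>\<theta>. (deriv ^^ n) \<phi> \<theta> *\<^sub>R f \<theta>) =
        (- 1) ^ n *\<^sub>R integral circle (\<lambda>\<theta>. \<phi> \<theta> *\<^sub>R f' \<theta>)"
      using f'(1) \<phi> by (simp add: is_weak_deriv_def)
    have L: "integral circle (\<lambda>\<theta>. d \<theta> *\<^sub>R c *\<^sub>R h \<theta>) = c *\<^sub>R integral circle (\<lambda>\<theta>. d \<theta> *\<^sub>R h \<theta>)"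
      for d :: "real \<Rightarrow> real" and h :: "real \<Rightarrow> real ^ 'd"
      by (subst scaleR_left_commute) (rule integral_cmul)
    show "integral circle (\<lambda>\<theta>. (deriv ^^ n) \<phi> \<theta> *\<^sub>R c *\<^sub>R f \<theta>) =
        (- 1) ^ n *\<^sub>R integral circle (\<lambda>\<theta>. \<phi> \<theta> *\<^sub>R c *\<^sub>R f' \<theta>)"
      unfolding L E by (rule scaleR_left_commute)
  qed (use f'(1) in \<open>auto simp: is_weak_deriv_def periodic_def\<close>)
  then have "Hn_norm n (\<lambda>x. c *\<^sub>R f x) = sqrt ((\<bar>c\<bar> * l2 f)\<^sup>2 + (\<bar>c\<bar> * l2 f')\<^sup>2)"
    using f' by (subst Hn_norm_eq[where g = "\<lambda>x. c *\<^sub>R f' x"]) (auto simp: l2_scaleR intro: sqint_scaleR)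
  also have "\<dots> = \<bar>c\<bar> * sqrt ((l2 f)\<^sup>2 + (l2 f')\<^sup>2)"
    by (simp add: power_mult_distrib real_sqrt_mult flip: distrib_left)
  finally show ?thesis using f' by simp
qed

lemma Hn_norm_minus:
  fixes f :: "real \<Rightarrow> real ^ 'd"
  shows "f \<in> Hn n \<Longrightarrow> n \<ge> 1 \<Longrightarrow> Hn_norm n (\<lambda>x. - f x) = Hn_norm n f"
  using Hn_norm_scaleR[of f n "-1"] by simp

lemma Hn_norm_diff_commute:
  fixes f g :: "real \<Rightarrow> real ^ 'd"
  shows "f \<in> Hn n \<Longrightarrow> g \<in> Hn n \<Longrightarrow> n \<ge> 1 \<Longrightarrow> Hn_norm n (\<lambda>x. f x - g x) = Hn_norm n (\<lambda>x. g x - f x)"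
  using Hn_norm_minus[of "\<lambda>x. f x - g x" n] by (simp add: Hn_diff)

lemma Hn_norm_triangle_diff:
  fixes f g :: "real \<Rightarrow> real ^ 'd"
  assumes "f \<in> Hn n" "g \<in> Hn n" "n \<ge> 1"
  shows "\<bar>Hn_norm n f - Hn_norm n g\<bar> \<le> Hn_norm n (\<lambda>x. f x - g x)"
  using Hn_norm_triangle[of "\<lambda>x. f x - g x" n g] Hn_norm_triangle[of "\<lambda>x. g x - f x" n f]
    Hn_norm_diff_commute[of f n g] assms by (simp add: Hn_diff)

lemma Hn_norm_zero: "n \<ge> 1 \<Longrightarrow> Hn_norm n (\<lambda>x. 0 :: real ^ 'd) = 0"
  using Hn_norm_scaleR[of "\<lambda>x. 0" n 0] Hn_zero[of n] by simp

section \<open>Interpolation along chains of derivatives\<close>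

text \<open>
  A weight \<open>\<sigma>\<close> stands for the measure \<open>\<sigma> d\<theta>\<close>: arc length for \<open>\<sigma> = \<bar>c'\<bar>\<close>, and \<open>d\<theta>\<close> itself for \<open>\<sigma> = 1\<close>.
\<close>

definition weight :: "(real \<Rightarrow> real) \<Rightarrow> bool" where
  "weight \<sigma> \<longleftrightarrow> continuous_on UNIV \<sigma> \<and> periodic \<sigma> \<and> (\<forall>x. \<sigma> x > 0)"

definition energy :: "(real \<Rightarrow> real) \<Rightarrow> (real \<Rightarrow> 'a::euclidean_space) \<Rightarrow> real" where
  "energy \<sigma> f = integral circle (\<lambda>x. \<sigma> x * (norm (f x))\<^sup>2)"

text \<open>
  The functions \<open>e 0, \<dots>, e n\<close> are the successive derivatives of \<open>e 0\<close> with respect to the parameter whose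
  element is \<open>\<sigma> d\<theta>\<close>.
\<close>

definition chain :: "nat \<Rightarrow> (real \<Rightarrow> real) \<Rightarrow> (nat \<Rightarrow> real \<Rightarrow> 'a::euclidean_space) \<Rightarrow> bool" where
  "chain n \<sigma> e \<longleftrightarrow> (\<forall>j<n. is_prim (e j) (\<lambda>x. \<sigma> x *\<^sub>R e (Suc j) x)) \<and> (\<forall>j\<le>n. periodic (e j)) \<and> sqint (e n)"

lemma chain_continuous: "chain n \<sigma> e \<Longrightarrow> j < n \<Longrightarrow> continuous_on A (e j)"
  unfolding chain_def using is_prim_continuous continuous_on_subset by (metis subset_UNIV)

lemma chain_sqint: "chain n \<sigma> e \<Longrightarrow> j \<le> n \<Longrightarrow> sqint (e j)"
  using chain_continuous continuous_imp_sqint by (metis chain_def le_neq_implies_less)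

lemma energy_integrable:
  assumes "weight \<sigma>" "sqint f"
  shows "(\<lambda>x. \<sigma> x * (norm (f x))\<^sup>2) integrable_on circle"
proof -
  have "continuous_on circle \<sigma>" using assms continuous_on_subset by (auto simp: weight_def)
  moreover have "(\<lambda>x. (norm (f x))\<^sup>2) absolutely_integrable_on circle"
    using assms by (intro nonnegative_absolutely_integrable_1) (auto simp: sqint_def)
  ultimately have "(\<lambda>x. \<sigma> x * (norm (f x))\<^sup>2) absolutely_integrable_on circle"
    by (rule bounded_bilinear_abs_int[OF bounded_bilinear_mult])
  then show ?thesis using absolutely_integrable_on_def by blast
qed

lemma energy_nonneg:
  assumes "weight \<sigma>" "sqint f" shows "energy \<sigma> f \<ge> 0"
  unfolding energy_def using assms energy_integrable[OF assms]
  by (intro Henstock_Kurzweil_Integration.integral_nonneg) (auto simp: weight_def less_imp_le)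

lemma energy_lower:
  assumes "weight \<sigma>" "sqint f" "\<And>x. \<sigma> x \<ge> m" "m \<ge> 0"
  shows "m * (l2 f)\<^sup>2 \<le> energy \<sigma> f"
proof -
  have "integral circle (\<lambda>x. m * (norm (f x))\<^sup>2) \<le> energy \<sigma> f"
    unfolding energy_def using assms energy_integrable[OF assms(1,2)]
    by (intro integral_le integrable_on_mult_right mult_right_mono) (auto simp: sqint_def)
  then show ?thesis by (simp add: l2_power2)
qed

lemma energy_upper:
  assumes "weight \<sigma>" "sqint f" "\<And>x. \<sigma> x \<le> S"
  shows "energy \<sigma> f \<le> S * (l2 f)\<^sup>2"
proof -
  have "energy \<sigma> f \<le> integral circle (\<lambda>x. S * (norm (f x))\<^sup>2)"
    unfolding energy_def using assms energy_integrable[OF assms(1,2)]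
    by (intro integral_le integrable_on_mult_right mult_right_mono) (auto simp: sqint_def)
  then show ?thesis by (simp add: l2_power2)
qed

text \<open>
  The derivative of \<open>e j \<bullet> e (j+1)\<close> integrates to zero over the circle, so the energy of \<open>e (j+1)\<close> equals
  the integral of \<open>- \<sigma> (e j \<bullet> e (j+2))\<close>; the inequality of arithmetic and geometric means finishes.  No
  constant and no length of the circle enters.
\<close>

lemma chain_energy_convex:
  assumes \<sigma>: "weight \<sigma>" and e: "chain n \<sigma> e" and j: "Suc j < n"
  shows "energy \<sigma> (e (Suc j)) \<le> (energy \<sigma> (e j) + energy \<sigma> (e (Suc (Suc j)))) / 2"
proof -
  define g where "g = (\<lambda>x. (\<sigma> x *\<^sub>R e (Suc j) x) \<bullet> e (Suc j) x + e j x \<bullet> (\<sigma> x *\<^sub>R e (Suc (Suc j)) x))"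
  have "is_prim (\<lambda>x. e j x \<bullet> e (Suc j) x) g"
    unfolding g_def using e j by (intro is_prim_bilinear[OF bounded_bilinear_inner]) (auto simp: chain_def)
  moreover have "periodic (\<lambda>x. e j x \<bullet> e (Suc j) x)" using e j by (auto simp: chain_def periodic_def)
  ultimately have g: "(g has_integral 0) circle" by (rule is_prim_integral_period)
  have int: "((\<lambda>x. \<sigma> x * (norm (e i x))\<^sup>2) has_integral energy \<sigma> (e i)) circle" if "i \<le> n" for i
    unfolding energy_def using energy_integrable[OF \<sigma> chain_sqint[OF e that]] by auto
  have rhs: "((\<lambda>x. g x + (\<sigma> x * (norm (e j x))\<^sup>2 + \<sigma> x * (norm (e (Suc (Suc j)) x))\<^sup>2) / 2)
      has_integral (0 + (energy \<sigma> (e j) + energy \<sigma> (e (Suc (Suc j)))) / 2)) circle"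
    using j by (intro has_integral_add has_integral_divide g int) auto
  have le: "\<sigma> x * (norm (e (Suc j) x))\<^sup>2 \<le> g x + (\<sigma> x * (norm (e j x))\<^sup>2 + \<sigma> x * (norm (e (Suc (Suc j)) x))\<^sup>2) / 2" for x
  proof -
    have "- (e j x \<bullet> e (Suc (Suc j)) x) \<le> norm (e j x) * norm (e (Suc (Suc j)) x)"
      using Cauchy_Schwarz_ineq2[of "e j x" "e (Suc (Suc j)) x"] by linarith
    also have "\<dots> \<le> ((norm (e j x))\<^sup>2 + (norm (e (Suc (Suc j)) x))\<^sup>2) / 2"
      using sum_squares_bound[of "norm (e j x)" "norm (e (Suc (Suc j)) x)"] by simp
    finally have "\<sigma> x * (- (e j x \<bullet> e (Suc (Suc j)) x)) \<le> \<sigma> x * (((norm (e j x))\<^sup>2 + (norm (e (Suc (Suc j)) x))\<^sup>2) / 2)"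
      using \<sigma> by (intro mult_left_mono) (auto simp: weight_def less_imp_le)
    then show ?thesis by (simp add: g_def power2_norm_eq_inner field_simps)
  qed
  show ?thesis using has_integral_le[OF int[of "Suc j"] rhs] le j by simp
qed

text \<open>
  At the first index where the maximum is attained, an interior position would contradict convexity.
\<close>

lemma convex_sequence_le_ends:
  fixes y :: "nat \<Rightarrow> real"
  assumes "\<And>j. Suc j < n \<Longrightarrow> y (Suc j) \<le> (y j + y (Suc (Suc j))) / 2" and "j \<le> n"
  shows "y j \<le> max (y 0) (y n)"
proof -
  define M where "M = Max (y ` {..n})"
  have M: "y i \<le> M" if "i \<le> n" for i using that by (auto simp: M_def)
  have "M \<in> y ` {..n}" unfolding M_def by (intro Max_in) auto
  then have ex: "\<exists>i. i \<le> n \<and> y i = M" by auto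
  define i where "i = (LEAST i. i \<le> n \<and> y i = M)"
  have i: "i \<le> n" "y i = M" using LeastI_ex[OF ex] by (auto simp: i_def)
  have "i = 0 \<or> i = n"
  proof (rule ccontr)
    assume "\<not> (i = 0 \<or> i = n)"
    then obtain k where k: "i = Suc k" "Suc k < n" using i(1) by (cases i) auto
    have "y k \<noteq> M" using not_less_Least[of k "\<lambda>i. i \<le> n \<and> y i = M"] k by (auto simp: i_def[symmetric])
    then have "y k < M" using M[of k] k by simp
    then show False using assms(1)[OF k(2)] M[of "Suc (Suc k)"] k i(2) by simp
  qed
  then show ?thesis using M[OF \<open>j \<le> n\<close>] i(2) by auto
qed

lemma chain_energy_le:
  assumes "weight \<sigma>" "chain n \<sigma> e" "j \<le> n"
  shows "energy \<sigma> (e j) \<le> energy \<sigma> (e 0) + energy \<sigma> (e n)"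
  using convex_sequence_le_ends[of n "\<lambda>j. energy \<sigma> (e j)" j] chain_energy_convex[OF assms(1,2)] assms(3)
    energy_nonneg[OF assms(1) chain_sqint[OF assms(2)]] by (smt (verit) le0 le_refl)

lemma is_prim_osc:
  assumes F: "is_prim F g" and h: "h integrable_on {a..b}" and le: "\<And>x. x \<in> {a..b} \<Longrightarrow> norm (g x) \<le> h x"
    and x: "x \<in> {a..b}" and z: "z \<in> {a..b}"
  shows "norm (F x - F z) \<le> integral {a..b} h"
proof -
  have nn: "0 \<le> h x" if "x \<in> {a..b}" for x
    using le[OF that] norm_ge_zero[of "g x"] by linarith
  have "norm (F v - F u) \<le> integral {a..b} h" if "a \<le> u" "u \<le> v" "v \<le> b" for u v
  proof -
    have hi: "h integrable_on {u..v}" using h that integrable_on_subinterval by (metis atLeastatMost_subset_iff)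
    have "norm (F v - F u) = norm (integral {u..v} g)"
      using is_primD(3)[OF F \<open>u \<le> v\<close>] by (simp add: has_integral_iff)
    also have "\<dots> \<le> integral {u..v} h"
      using that le by (intro integral_norm_bound_integral is_primD(2)[OF F] hi) auto
    also have "\<dots> \<le> integral {a..b} h"
      using that nn by (intro integral_subset_le hi h) auto
    finally show ?thesis .
  qed
  from this[of x z] this[of z x] x z show ?thesis
    using norm_minus_commute[of "F x" "F z"] by (cases "x \<le> z") simp_all
qed

text \<open>
  The derivative of \<open>(e j \<bullet> v)\<^sup>2\<close> is \<open>2 \<sigma> (e j \<bullet> v) (e (j+1) \<bullet> v)\<close>, whose absolute value integrates to at
  most the right-hand side.
\<close>

lemma chain_sup_diff:
  assumes \<sigma>: "weight \<sigma>" and e: "chain n \<sigma> e" and j: "j < n"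
    and x: "x \<in> circle" and z: "z \<in> circle"
  shows "\<bar>(e j x \<bullet> v)\<^sup>2 - (e j z \<bullet> v)\<^sup>2\<bar> \<le> (norm v)\<^sup>2 * (energy \<sigma> (e j) + energy \<sigma> (e (Suc j)))"
proof -
  define \<phi> where "\<phi> = (\<lambda>x. e j x \<bullet> v)"
  define \<phi>' where "\<phi>' = (\<lambda>x. (\<sigma> x *\<^sub>R e (Suc j) x) \<bullet> v)"
  have \<phi>: "is_prim \<phi> \<phi>'"
    unfolding \<phi>_def \<phi>'_def using e j by (intro is_prim_linear[OF _ bounded_linear_inner_left]) (auto simp: chain_def)
  have prim: "is_prim (\<lambda>x. \<phi> x * \<phi> x) (\<lambda>x. \<phi>' x * \<phi> x + \<phi> x * \<phi>' x)"
    by (rule is_prim_bilinear[OF bounded_bilinear_mult \<phi> \<phi>])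
  define h where "h = (\<lambda>x. (norm v)\<^sup>2 * (\<sigma> x * (norm (e j x))\<^sup>2 + \<sigma> x * (norm (e (Suc j) x))\<^sup>2))"
  have h: "(h has_integral ((norm v)\<^sup>2 * (energy \<sigma> (e j) + energy \<sigma> (e (Suc j))))) circle"
    unfolding h_def energy_def using j
    by (intro has_integral_mult_right has_integral_add integrable_integral energy_integrable \<sigma> chain_sqint[OF e]) auto
  have "norm (\<phi>' x * \<phi> x + \<phi> x * \<phi>' x) \<le> h x" for x
  proof -
    have s: "\<sigma> x \<ge> 0" using \<sigma> by (simp add: weight_def less_imp_le)
    have "norm (\<phi>' x * \<phi> x + \<phi> x * \<phi>' x) = 2 * \<bar>\<phi> x\<bar> * \<bar>\<phi>' x\<bar>"
      by (simp add: abs_mult)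
    also have "\<dots> \<le> 2 * (norm (e j x) * norm v) * (\<sigma> x * (norm (e (Suc j) x) * norm v))"
      unfolding \<phi>_def \<phi>'_def inner_scaleR_left abs_mult using s
      by (intro mult_mono mult_left_mono Cauchy_Schwarz_ineq2) (auto intro: mult_nonneg_nonneg)
    also have "\<dots> = (norm v)\<^sup>2 * (\<sigma> x * (2 * norm (e j x) * norm (e (Suc j) x)))"
      by (simp add: power2_eq_square)
    also have "\<dots> \<le> (norm v)\<^sup>2 * (\<sigma> x * ((norm (e j x))\<^sup>2 + (norm (e (Suc j) x))\<^sup>2))"
      using s by (intro mult_left_mono sum_squares_bound) auto
    finally show ?thesis by (simp add: h_def algebra_simps)
  qed
  then have "norm (\<phi> x * \<phi> x - \<phi> z * \<phi> z) \<le> integral circle h"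
    using h by (intro is_prim_osc[OF prim _ _ x z]) auto
  then show ?thesis using h by (simp add: has_integral_iff \<phi>_def power2_eq_square)
qed

text \<open>
  In the direction \<open>v = e (j+1) x\<close>, the function \<open>\<sigma> (e (j+1) \<bullet> v)\<close> is the derivative of the periodic function
  \<open>e j \<bullet> v\<close> and vanishes at some point \<open>z\<close>; comparison of \<open>x\<close> with \<open>z\<close> gives the bound.
\<close>

lemma chain_sup:
  assumes \<sigma>: "weight \<sigma>" and e: "chain n \<sigma> e" and j: "Suc j < n"
  shows "(norm (e (Suc j) x))\<^sup>2 \<le> energy \<sigma> (e (Suc j)) + energy \<sigma> (e (Suc (Suc j)))"
proof -
  have on_period: "(norm (e (Suc j) x))\<^sup>2 \<le> energy \<sigma> (e (Suc j)) + energy \<sigma> (e (Suc (Suc j)))"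
    if x: "x \<in> circle" for x
  proof (cases "e (Suc j) x = 0")
    case True
    then show ?thesis using energy_nonneg[OF \<sigma> chain_sqint[OF e]] j by (simp add: add_nonneg_nonneg)
  next
    case False
    \<comment> \<open>testing against the value at \<open>x\<close> itself avoids a choice of coordinates\<close>
    define v where "v = e (Suc j) x"
    define \<phi> where "\<phi> = (\<lambda>x. e j x \<bullet> v)"
    define \<phi>' where "\<phi>' = (\<lambda>x. (\<sigma> x *\<^sub>R e (Suc j) x) \<bullet> v)"
    have \<phi>: "is_prim \<phi> \<phi>'"
      unfolding \<phi>_def \<phi>'_def using e j by (intro is_prim_linear[OF _ bounded_linear_inner_left]) (auto simp: chain_def)
    have "continuous_on UNIV \<phi>'" unfolding \<phi>'_def
      using \<sigma> chain_continuous[OF e j] by (intro continuous_intros) (auto simp: weight_def)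
    then have der: "DERIV \<phi> x :> \<phi>' x" for x
      using is_prim_has_vector_derivative[OF \<phi>]
      by (simp add: has_real_derivative_iff_has_vector_derivative continuous_on_eq_continuous_at)
    have "periodic (e j)" using e j by (simp add: chain_def)
    then have per: "\<phi> (2 * pi) = \<phi> 0" using periodic_0_2pi by (metis \<phi>_def)
    obtain z where z: "0 < z" "z < 2 * pi" "\<phi> (2 * pi) - \<phi> 0 = (2 * pi - 0) * \<phi>' z"
      using MVT2[of 0 "2 * pi" \<phi> \<phi>'] der by auto
    then have "\<phi>' z = 0" using per by simp
    moreover have "\<sigma> z > 0" using \<sigma> by (simp add: weight_def)
    ultimately have z0: "e (Suc j) z \<bullet> v = 0" by (simp add: \<phi>'_def)
    have "\<bar>(e (Suc j) x \<bullet> v)\<^sup>2 - (e (Suc j) z \<bullet> v)\<^sup>2\<bar>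
        \<le> (norm v)\<^sup>2 * (energy \<sigma> (e (Suc j)) + energy \<sigma> (e (Suc (Suc j))))"
      using z by (intro chain_sup_diff[OF \<sigma> e j x]) auto
    then have "(norm v)\<^sup>2 * (norm v)\<^sup>2 \<le> (norm v)\<^sup>2 * (energy \<sigma> (e (Suc j)) + energy \<sigma> (e (Suc (Suc j))))"
      by (simp add: z0 flip: v_def power2_norm_eq_inner)
    moreover have "(norm v)\<^sup>2 > 0" using False by (simp add: v_def)
    ultimately show ?thesis unfolding v_def by (simp only: mult_le_cancel_left_pos)
  qed
  obtain k :: int where k: "x - 2 * pi * of_int k \<in> {0..<2 * pi}" by (rule periodic_reduce)
  have "periodic (e (Suc j))" using e j by (auto simp: chain_def)
  from periodic_add_int[OF this, of "x - 2 * pi * of_int k" k]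
  have "e (Suc j) x = e (Suc j) (x - 2 * pi * of_int k)" by simp
  then show ?thesis using on_period[of "x - 2 * pi * of_int k"] k by simp
qed

text \<open>
  The function \<open>e 0\<close> itself need not vanish anywhere, so \<open>(norm (e 0 x))\<^sup>2\<close> is compared with its mean
  over the circle.
\<close>

lemma chain_one_sup_0:
  assumes e: "chain n (\<lambda>x. 1) e" and n: "n > 0" and x: "x \<in> circle"
  shows "(norm (e 0 x))\<^sup>2 \<le> 2 * (l2 (e 0))\<^sup>2 + (l2 (e 1))\<^sup>2"
proof -
  have w: "weight (\<lambda>x. 1)" by (simp add: weight_def periodic_def)
  have en: "energy (\<lambda>x. 1) f = (l2 f)\<^sup>2" for f :: "real \<Rightarrow> 'a" by (simp add: energy_def l2_power2)
  define v where "v = e 0 x"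
  define A where "A = (l2 (e 0))\<^sup>2 + (l2 (e 1))\<^sup>2"
  have pt: "(norm v)\<^sup>2 \<le> (norm (e 0 z))\<^sup>2 + A" if z: "z \<in> circle" for z
  proof (cases "v = 0")
    case True
    then show ?thesis by (simp add: A_def)
  next
    case False
    have "(norm v)\<^sup>2 * (norm v)\<^sup>2 = (e 0 x \<bullet> v)\<^sup>2"
      unfolding v_def power2_norm_eq_inner by (simp only: power2_eq_square)
    also have "\<dots> \<le> (e 0 z \<bullet> v)\<^sup>2 + (norm v)\<^sup>2 * A"
      using chain_sup_diff[OF w e n x z, of v] by (simp add: en A_def)
    also have "(e 0 z \<bullet> v)\<^sup>2 \<le> (norm (e 0 z) * norm v)\<^sup>2"
      using Cauchy_Schwarz_ineq2 by (metis abs_le_square_iff abs_mult abs_norm_cancel)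
    finally have "(norm v)\<^sup>2 * (norm v)\<^sup>2 \<le> (norm v)\<^sup>2 * ((norm (e 0 z))\<^sup>2 + A)"
      by (simp add: power_mult_distrib algebra_simps)
    moreover have "(norm v)\<^sup>2 > 0" using False by simp
    ultimately show ?thesis by (simp only: mult_le_cancel_left_pos)
  qed
  have sq: "(\<lambda>x. (norm (e 0 x))\<^sup>2) integrable_on circle"
    using chain_sqint[OF e, of 0] by (auto simp: sqint_def)
  have "integral circle (\<lambda>z. (norm v)\<^sup>2) \<le> integral circle (\<lambda>z. (norm (e 0 z))\<^sup>2 + A)"
    using pt sq by (intro integral_le integrable_add) auto
  also have "\<dots> = (l2 (e 0))\<^sup>2 + 2 * pi * A"
    using sq by (subst Henstock_Kurzweil_Integration.integral_add) (auto simp: l2_power2)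
  finally have "2 * pi * (norm v)\<^sup>2 \<le> (l2 (e 0))\<^sup>2 + 2 * pi * A" by simp
  also have "(l2 (e 0))\<^sup>2 \<le> 2 * pi * (l2 (e 0))\<^sup>2"
    using pi_gt3 by (simp add: mult_left_le_one_le mult_le_cancel_right1)
  finally have "2 * pi * (norm v)\<^sup>2 \<le> 2 * pi * ((l2 (e 0))\<^sup>2 + A)" by (simp add: algebra_simps)
  then have "(norm v)\<^sup>2 \<le> (l2 (e 0))\<^sup>2 + A" by simp
  then show ?thesis by (simp add: A_def v_def)
qed

lemma sob_imp_chain_one:
  "sob k B f \<Longrightarrow> \<exists>e. e 0 = f \<and> (\<forall>j<k. is_prim (e j) (e (Suc j))) \<and> (\<forall>j\<le>k. sob (k - j) B (e j))"
proof (induction k arbitrary: f)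
  case 0
  then show ?case by (intro exI[of _ "\<lambda>_. f"]) auto
next
  case (Suc k)
  then obtain g where g: "is_prim f g" "sob k B g" by auto
  obtain e where e: "e 0 = g" "\<forall>j<k. is_prim (e j) (e (Suc j))" "\<forall>j\<le>k. sob (k - j) B (e j)"
    using Suc.IH[OF g(2)] by blast
  show ?case
    using e g Suc.prems by (intro exI[of _ "case_nat f e"]) (auto simp: less_Suc_eq_0_disj
        split: nat.split simp del: sob.simps)
qed

lemma is_prim_chain_weak_deriv:
  fixes e :: "nat \<Rightarrow> real \<Rightarrow> real ^ 'd"
  assumes "\<And>j. j < k \<Longrightarrow> is_prim (e j) (e (Suc j))" "\<And>j. j \<le> k \<Longrightarrow> periodic (e j)" "sqint (e k)"
  shows "is_weak_deriv k (e 0) (e k)"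
  using assms
proof (induction k arbitrary: e)
  case 0
  then show ?case using is_weak_deriv_0 sqint_abs_int by blast
next
  case (Suc k)
  have "is_weak_deriv k (e (Suc 0)) (e (Suc k))"
    using Suc.IH[of "\<lambda>j. e (Suc j)"] Suc.prems by simp
  then show ?case using is_weak_deriv_Suc[of "e 0" "e (Suc 0)"] Suc.prems(1)[of 0] Suc.prems(2)[of 0] by simp
qed

text \<open>
  Interpolation with weight 1 recovers all intermediate derivatives from the two terms of the norm, so the
  norm of \<open>H\<^sup>n\<close> and the radii of \<open>sob\<close> are equivalent; the converse is \<open>Hn_norm_le_sob\<close>.
\<close>

lemma sob_Hn_norm:
  fixes f :: "real \<Rightarrow> real ^ 'd"
  assumes f: "f \<in> Hn n" and n: "n \<ge> 1"
  shows "sob n (2 * Hn_norm n f) f"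
proof -
  obtain B where "sob n B f" using f n Hn_iff_sob by blast
  then obtain e where e: "e 0 = f" "\<And>j. j < n \<Longrightarrow> is_prim (e j) (e (Suc j))" "\<And>j. j \<le> n \<Longrightarrow> sob (n - j) B (e j)"
    using sob_imp_chain_one by metis
  have per: "periodic (e j)" if "j \<le> n" for j using e(3)[OF that] sob_periodic by blast
  have sq: "sqint (e j)" if "j \<le> n" for j using e(3)[OF that] sob_sqint by blast
  have w: "weight (\<lambda>x. 1)" by (simp add: weight_def periodic_def)
  have c: "chain n (\<lambda>x. 1) e" using e per sq by (simp add: chain_def)
  have en: "energy (\<lambda>x. 1) f = (l2 f)\<^sup>2" for f :: "real \<Rightarrow> real ^ 'd" by (simp add: energy_def l2_power2)
  define N where "N = Hn_norm n f"
  have "is_weak_deriv n f (e n)"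
    using is_prim_chain_weak_deriv[of n e] e(1,2) per sq by simp
  then have N: "N\<^sup>2 = (l2 (e 0))\<^sup>2 + (l2 (e n))\<^sup>2" "N \<ge> 0"
    unfolding N_def using Hn_norm_eq[of f n "e n"] sq[of 0] sq[of n] e(1) Hn_norm_nonneg by auto
  have l2: "(l2 (e j))\<^sup>2 \<le> N\<^sup>2" if "j \<le> n" for j
    using chain_energy_le[OF w c that] by (simp add: en N(1))
  have sup: "norm (e j x) \<le> 2 * N" if "j < n" for j x
  proof -
    have "(norm (e j x))\<^sup>2 \<le> 4 * N\<^sup>2"
    proof (cases j)
      case 0
      obtain k :: int where k: "x - 2 * pi * of_int k \<in> {0..<2 * pi}" by (rule periodic_reduce)
      have "e 0 x = e 0 (x - 2 * pi * of_int k)"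
        using periodic_add_int[OF per[of 0], of "x - 2 * pi * of_int k" k] by simp
      then have "(norm (e 0 x))\<^sup>2 \<le> 2 * (l2 (e 0))\<^sup>2 + (l2 (e 1))\<^sup>2"
        using chain_one_sup_0[OF c, of "x - 2 * pi * of_int k"] k n by simp
      moreover have "(l2 (e 0))\<^sup>2 \<le> N\<^sup>2" "(l2 (e 1))\<^sup>2 \<le> N\<^sup>2" using l2 n by auto
      ultimately show ?thesis unfolding 0 using zero_le_power2[of N] by linarith
    next
      case (Suc i)
      then have "(norm (e j x))\<^sup>2 \<le> (l2 (e j))\<^sup>2 + (l2 (e (Suc j)))\<^sup>2"
        using chain_sup[OF w c, of i x] that by (simp add: en)
      then show ?thesis using l2[of j] l2[of "Suc j"] that zero_le_power2[of N] by linarith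
    qed
    then have "(norm (e j x))\<^sup>2 \<le> (2 * N)\<^sup>2" by (simp add: power_mult_distrib)
    then show ?thesis by (rule power2_le_imp_le) (use N(2) in simp)
  qed
  have "sob i (2 * N) (e (n - i))" if "i \<le> n" for i
    using that
  proof (induction i)
    case 0
    have "l2 (e n) \<le> N" using l2[of n] N(2) l2_nonneg by (simp add: abs_le_square_iff[symmetric])
    also have "N \<le> sqrt (2 * pi) * (2 * N)"
    proof -
      have "1 \<le> sqrt (2 * pi)" using pi_gt3 by (intro real_le_rsqrt) simp
      then have "1 * (2 * N) \<le> sqrt (2 * pi) * (2 * N)" using N(2) by (intro mult_right_mono) auto
      then show ?thesis using N(2) by linarith
    qed
    finally show ?case using per[of n] sq[of n] N(2) by simp
  next
    case (Suc i)
    have "is_prim (e (n - Suc i)) (e (n - i))"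
      using e(2)[of "n - Suc i"] Suc.prems by (simp add: Suc_diff_Suc)
    then show ?case using Suc sup[of "n - Suc i"] per[of "n - Suc i"] N(2) by auto
  qed
  from this[of n] show ?thesis using e(1) by (simp add: N_def)
qed

lemma Hn_norm_mono:
  fixes f :: "real \<Rightarrow> real ^ 'd"
  assumes f: "f \<in> Hn n" and k: "1 \<le> k" "k \<le> n"
  shows "Hn_norm k f \<le> 8 * Hn_norm n f"
  using Hn_norm_le_sob[OF sob_le[OF k(2) sob_Hn_norm[OF f]]] k by simp

section \<open>Arc length derivatives and the metric\<close>

abbreviation tangent :: "(real \<Rightarrow> real ^ 'd) \<Rightarrow> real \<Rightarrow> real ^ 'd" where
  "tangent c \<theta> \<equiv> vector_derivative c (at \<theta>)"

lemma sob_Suc_Suc_tangent: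
  fixes c :: "real \<Rightarrow> real ^ 'd"
  assumes "sob (Suc (Suc k)) B c"
  shows "is_prim c (tangent c)" "sob (Suc k) B (tangent c)"
proof -
  obtain g where g: "is_prim c g" "sob (Suc k) B g" using assms by (metis sob.simps(2))
  have "isCont g \<theta>" for \<theta>
    using sob_continuous[OF g(2), of UNIV] by (simp add: continuous_on_eq_continuous_at)
  then have "tangent c \<theta> = g \<theta>" for \<theta>
    using is_prim_has_vector_derivative[OF g(1)] vector_derivative_at by blast
  then show "is_prim c (tangent c)" "sob (Suc k) B (tangent c)"
    using g by simp_all
qed

lemma sob_has_tangent:
  fixes c :: "real \<Rightarrow> real ^ 'd"
  assumes "sob (Suc (Suc k)) B c"
  shows "(c has_vector_derivative tangent c \<theta>) (at \<theta>)"
  using is_prim_has_vector_derivative[OF sob_Suc_Suc_tangent(1)[OF assms]] sob_continuous[OF sob_Suc_Suc_tangent(2)[OF assms], of UNIV]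
  by (simp add: continuous_on_eq_continuous_at)

lemma Hn_has_tangent:
  fixes c :: "real \<Rightarrow> real ^ 'd"
  assumes "c \<in> Hn n" "n \<ge> 2"
  shows "(c has_vector_derivative tangent c \<theta>) (at \<theta>)"
proof -
  obtain B where "sob n B c" using assms Hn_iff_sob[of n] by auto
  then have "sob (Suc (Suc 0)) B c" using sob_le[of "Suc (Suc 0)" n B c] assms(2) by (simp del: sob.simps)
  then show ?thesis by (rule sob_has_tangent)
qed

lemma tangent_diff:
  fixes c1 c2 :: "real \<Rightarrow> real ^ 'd"
  assumes "c1 \<in> Hn n" "c2 \<in> Hn n" "n \<ge> 2"
  shows "tangent (\<lambda>\<theta>. c1 \<theta> - c2 \<theta>) \<theta> = tangent c1 \<theta> - tangent c2 \<theta>"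
  using Hn_has_tangent[OF assms(1,3)] Hn_has_tangent[OF assms(2,3)]
  by (intro vector_derivative_at has_vector_derivative_diff)

lemma sob_tangent:
  fixes c :: "real \<Rightarrow> real ^ 'd"
  assumes "c \<in> Hn n" "n \<ge> 2"
  shows "sob (n - 1) (2 * Hn_norm n c) (tangent c)"
    "norm (tangent c \<theta>) \<le> 2 * Hn_norm n c"
proof -
  obtain k where k: "n = Suc (Suc k)" using assms(2) by (metis Suc_le_D numeral_2_eq_2 Suc_le_mono)
  have "sob (Suc (Suc k)) (2 * Hn_norm n c) c" using sob_Hn_norm[OF assms(1)] k by (simp del: sob.simps)
  from sob_Suc_Suc_tangent(2)[OF this]
  have *: "sob (Suc k) (2 * Hn_norm n c) (tangent c)" .
  show "sob (n - 1) (2 * Hn_norm n c) (tangent c)" using * k by (simp del: sob.simps)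
  show "norm (tangent c \<theta>) \<le> 2 * Hn_norm n c" using sob_bound[OF *] .
qed

lemma continuous_periodic_min:
  fixes f :: "real \<Rightarrow> real"
  assumes "continuous_on UNIV f" "periodic f" "\<And>x. f x > 0"
  obtains m where "m > 0" "\<And>x. f x \<ge> m"
proof -
  have "continuous_on circle f" using assms(1) continuous_on_subset by blast
  then obtain z where z: "\<And>x. x \<in> circle \<Longrightarrow> f z \<le> f x"
    using continuous_attains_inf[of "circle" f] by fastforce
  have "f z \<le> f x" for x
  proof -
    obtain k :: int where k: "x - 2 * pi * of_int k \<in> {0..<2 * pi}" by (rule periodic_reduce)
    then show ?thesis using z[of "x - 2 * pi * of_int k"] periodic_add_int[OF assms(2), of "x - 2 * pi * of_int k" k] by simp
  qed
  then show thesis using that[of "f z"] assms(3) by blast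
qed

lemma Imm_Hn: "c \<in> Imm n \<Longrightarrow> c \<in> Hn n"
  by (simp add: Imm_def)

lemma Imm_weight:
  assumes "c \<in> Imm n" "n \<ge> 2"
  shows "weight (speed c)"
proof -
  have *: "sob (Suc (n - 2)) (2 * Hn_norm n c) (tangent c)"
    using sob_tangent(1)[OF Imm_Hn[OF assms(1)] assms(2)] assms(2)
    by (metis Suc_1 Suc_diff_Suc Suc_le_lessD diff_Suc_1 diff_Suc_eq_diff_pred le_add_diff_inverse2 add_2_eq_Suc' diff_add_inverse2)
  have "continuous_on UNIV (speed c)"
    unfolding speed_def using sob_continuous[OF *] by (intro continuous_intros)
  moreover have "periodic (speed c)"
    using sob_periodic[OF *] unfolding speed_def periodic_def by metis
  moreover have "speed c x > 0" for x using assms(1) by (simp add: Imm_def speed_def)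
  ultimately show ?thesis by (simp add: weight_def)
qed

lemma Imm_min_speed:
  assumes "c \<in> Imm n" "n \<ge> 2"
  shows "\<exists>m>0. \<forall>\<theta>. speed c \<theta> \<ge> m"
  using continuous_periodic_min[of "speed c"] Imm_weight[OF assms] by (metis weight_def)

lemma ImmI: "c \<in> Hn n \<Longrightarrow> (\<And>\<theta>. speed c \<theta> \<ge> m) \<Longrightarrow> m > 0 \<Longrightarrow> c \<in> Imm n"
  unfolding Imm_def speed_def mem_Collect_eq by (metis norm_zero not_less)

text \<open>
  The function \<open>weak_deriv\<close> depends only on the class of its argument modulo null sets, so the iterates of
  \<open>Ds\<close>, although defined through arbitrary representatives, agree almost everywhere with any chain.
\<close>

lemma Ds_funpow_ae:
  fixes e :: "nat \<Rightarrow> real \<Rightarrow> real ^ 'd"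
  assumes \<sigma>: "weight (speed c)" and e: "chain n (speed c) e" and "j \<le> n"
  shows "periodic ((Ds c ^^ j) (e 0)) \<and> negligible {x. (Ds c ^^ j) (e 0) x \<noteq> e j x}"
  using \<open>j \<le> n\<close>
proof (induction j)
  case 0
  then show ?case using e by (auto simp: chain_def)
next
  case (Suc j)
  define f where "f = (Ds c ^^ j) (e 0)"
  have f: "periodic f" "negligible {x. f x \<noteq> e j x}" using Suc by (auto simp: f_def)
  have ej: "is_prim (e j) (\<lambda>x. speed c x *\<^sub>R e (Suc j) x)" "periodic (e j)" "periodic (e (Suc j))"
    using e Suc.prems by (auto simp: chain_def)
  have per: "periodic (\<lambda>x. speed c x *\<^sub>R e (Suc j) x)"
    using ej(3) \<sigma> by (auto simp: periodic_def weight_def)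
  have wd: "is_weak_deriv 1 f (\<lambda>x. speed c x *\<^sub>R e (Suc j) x)"
    using is_weak_deriv_1_prim[OF ej(1,2) per] is_weak_deriv_cong[OF f(2,1) ej(2)] by simp
  then have wd': "is_weak_deriv 1 f (weak_deriv 1 f)"
    unfolding weak_deriv_def by (rule someI[where P = "is_weak_deriv 1 f"])
  then have ae: "negligible {x. weak_deriv 1 f x \<noteq> speed c x *\<^sub>R e (Suc j) x}"
    using wd is_weak_deriv_unique by blast
  have Ds: "(Ds c ^^ Suc j) (e 0) = (\<lambda>x. (1 / speed c x) *\<^sub>R weak_deriv 1 f x)"
    by (simp add: f_def Ds_def)
  have "periodic (weak_deriv 1 f)" using wd' by (simp add: is_weak_deriv_def)
  then have "periodic ((Ds c ^^ Suc j) (e 0))"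
    using \<sigma> unfolding Ds by (auto simp: periodic_def weight_def)
  moreover have "{x. (Ds c ^^ Suc j) (e 0) x \<noteq> e (Suc j) x} \<subseteq> {x. weak_deriv 1 f x \<noteq> speed c x *\<^sub>R e (Suc j) x}"
  proof
    fix x assume "x \<in> {x. (Ds c ^^ Suc j) (e 0) x \<noteq> e (Suc j) x}"
    moreover have "speed c x \<noteq> 0" using \<sigma> by (metis less_irrefl weight_def)
    ultimately show "x \<in> {x. weak_deriv 1 f x \<noteq> speed c x *\<^sub>R e (Suc j) x}" unfolding Ds by auto
  qed
  ultimately show ?case using ae negligible_subset by blast
qed

lemma sobolev_metric_chain:
  fixes e :: "nat \<Rightarrow> real \<Rightarrow> real ^ 'd"
  assumes \<sigma>: "weight (speed c)" and e: "chain n (speed c) e"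
  shows "sobolev_metric a n c (e 0) (e 0) = (\<Sum>j\<le>n. a j * energy (speed c) (e j))"
proof -
  have neg: "negligible (\<Union>j\<le>n. {x. (Ds c ^^ j) (e 0) x \<noteq> e j x})"
    using Ds_funpow_ae[OF \<sigma> e] by (intro negligible_Union) auto
  have "sobolev_metric a n c (e 0) (e 0) =
      integral circle (\<lambda>x. \<Sum>j\<le>n. a j * (speed c x * (norm (e j x))\<^sup>2))"
    unfolding sobolev_metric_def
  proof (rule integral_spike[OF neg])
    fix x assume "x \<in> circle - (\<Union>j\<le>n. {x. (Ds c ^^ j) (e 0) x \<noteq> e j x})"
    then have "(Ds c ^^ j) (e 0) x = e j x" if "j \<le> n" for j using that by auto
    then show "(\<Sum>j\<le>n. a j * (speed c x * (norm (e j x))\<^sup>2)) =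
        (\<Sum>j\<le>n. a j * ((Ds c ^^ j) (e 0) x \<bullet> (Ds c ^^ j) (e 0) x)) * speed c x"
      unfolding sum_distrib_right by (intro sum.cong) (auto simp: power2_norm_eq_inner)
  qed
  also have "\<dots> = (\<Sum>j\<le>n. a j * energy (speed c) (e j))"
    unfolding energy_def using energy_integrable[OF \<sigma> chain_sqint[OF e]]
    by (subst integral_sum) (auto intro: integrable_on_mult_right)
  finally show ?thesis .
qed

text \<open>
  With \<open>u = 1 / \<sigma>\<close>, the next member of a chain is \<open>u\<close> times a derivative.  Here \<open>e\<close> is a chain for \<open>h\<close>
  with weight \<open>\<sigma>2\<close>, and \<open>e + f\<close> one for the perturbed function \<open>h + d\<close> with weight \<open>\<sigma>1\<close>.  The perturbation
  propagates by \<open>u1 (h' + d') - u2 h' = (u1 - u2) h' + u1 d'\<close>, two products of size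
  \<open>\<delta>\<close>; as each of them is estimated with the factor \<open>2 ^ m\<close>, the exponent in \<open>W\<close> is \<open>m + 1\<close>.
\<close>

lemma chain_pair:
  fixes h d :: "real \<Rightarrow> 'a::euclidean_space"
  assumes m: "m \<ge> 1" and u: "sob m U u1" "sob m U u2" "sob m (\<delta> * U) (\<lambda>x. u1 x - u2 x)"
    and \<sigma>: "\<And>x. \<sigma>1 x * u1 x = 1" "\<And>x. \<sigma>2 x * u2 x = 1" and "\<delta> \<ge> 0"
    and W: "W = 2 ^ (m + 1) * U"
  shows "k \<le> m + 1 \<Longrightarrow> sob k B h \<Longrightarrow> sob k (\<delta> * B) d \<Longrightarrow>
    \<exists>e f. e 0 = h \<and> f 0 = d \<and> (\<forall>j<k. is_prim (e j) (\<lambda>x. \<sigma>2 x *\<^sub>R e (Suc j) x)) \<and>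
      (\<forall>j<k. is_prim (\<lambda>x. e j x + f j x) (\<lambda>x. \<sigma>1 x *\<^sub>R (e (Suc j) x + f (Suc j) x))) \<and>
      (\<forall>j\<le>k. sob (k - j) (W ^ j * B) (e j) \<and> sob (k - j) (\<delta> * (W ^ j * B)) (f j))"
proof (induction k arbitrary: h d B)
  case 0
  then show ?case by (intro exI[of _ "\<lambda>_. h"] exI[of _ "\<lambda>_. d"]) simp
next
  case (Suc k)
  obtain h' where h': "is_prim h h'" "sob k B h'" using Suc.prems by auto
  obtain d' where d': "is_prim d d'" "sob k (\<delta> * B) d'" using Suc.prems by auto
  have B: "B \<ge> 0" "U \<ge> 0" using Suc.prems(2) sob_nonneg u(1) by auto
  have k: "k \<le> m" using Suc.prems by simp
  note mul = sob_mul[OF u(1) k m] sob_mul[OF u(2) k m] sob_mul[OF u(3) k m]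
  define e1 where "e1 = (\<lambda>x. u2 x *\<^sub>R h' x)"
  define f1 where "f1 = (\<lambda>x. (u1 x - u2 x) *\<^sub>R h' x + u1 x *\<^sub>R d' x)"
  have pw: "(2::real) ^ k \<le> 2 ^ m" using k by (intro power_increasing) auto
  have "2 ^ k * (U * B) \<le> 2 ^ m * (U * B)" using pw B by (intro mult_right_mono) auto
  moreover have "0 \<le> 2 ^ m * (U * B)" using B by simp
  ultimately have WB: "2 * (2 ^ k * (U * B)) \<le> W * B" "2 ^ k * (U * B) \<le> W * B" unfolding W by simp_all
  have e1: "sob k (W * B) e1"
    unfolding e1_def using sob_scaleR_mul[OF mul(2) h'(2)] WB(2) by (rule sob_mono)
  have "sob k (2 ^ k * (\<delta> * U * B) + 2 ^ k * (U * (\<delta> * B))) f1"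
    unfolding f1_def by (intro sob_add sob_scaleR_mul mul h' d')
  moreover have "2 ^ k * (\<delta> * U * B) + 2 ^ k * (U * (\<delta> * B)) = \<delta> * (2 * (2 ^ k * (U * B)))"
    by (simp add: algebra_simps)
  moreover have "\<dots> \<le> \<delta> * (W * B)" using WB(1) \<open>\<delta> \<ge> 0\<close> by (rule mult_left_mono)
  ultimately have f1: "sob k (\<delta> * (W * B)) f1" using sob_mono by metis
  obtain e f where ef: "e 0 = e1" "f 0 = f1" "\<forall>j<k. is_prim (e j) (\<lambda>x. \<sigma>2 x *\<^sub>R e (Suc j) x)"
      "\<forall>j<k. is_prim (\<lambda>x. e j x + f j x) (\<lambda>x. \<sigma>1 x *\<^sub>R (e (Suc j) x + f (Suc j) x))"
      "\<forall>j\<le>k. sob (k - j) (W ^ j * (W * B)) (e j) \<and> sob (k - j) (\<delta> * (W ^ j * (W * B))) (f j)"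
    using Suc.IH[OF _ e1 f1] k by auto
  have eq: "\<sigma>2 x *\<^sub>R e1 x = h' x" "\<sigma>1 x *\<^sub>R (e1 x + f1 x) = h' x + d' x" for x
  proof -
    show "\<sigma>2 x *\<^sub>R e1 x = h' x" using \<sigma>(2)[of x] by (simp add: e1_def)
    have "e1 x + f1 x = u1 x *\<^sub>R (h' x + d' x)"
      by (simp add: e1_def f1_def algebra_simps)
    then show "\<sigma>1 x *\<^sub>R (e1 x + f1 x) = h' x + d' x" using \<sigma>(1)[of x] by simp
  qed
  have h0: "is_prim h (\<lambda>x. \<sigma>2 x *\<^sub>R e1 x)" "is_prim (\<lambda>x. h x + d x) (\<lambda>x. \<sigma>1 x *\<^sub>R (e1 x + f1 x))"
    using h'(1) is_prim_add[OF h'(1) d'(1)] by (simp_all add: eq)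
  define E where "E = case_nat h e"
  define F where "F = case_nat d f"
  have EF: "E 0 = h" "F 0 = d" "E (Suc j) = e j" "F (Suc j) = f j" for j by (auto simp: E_def F_def)
  have "is_prim (E j) (\<lambda>x. \<sigma>2 x *\<^sub>R E (Suc j) x)" "is_prim (\<lambda>x. E j x + F j x) (\<lambda>x. \<sigma>1 x *\<^sub>R (E (Suc j) x + F (Suc j) x))"
    if "j < Suc k" for j
    using that h0 ef by (cases j; simp add: EF)+
  moreover have "sob (Suc k - j) (W ^ j * B) (E j) \<and> sob (Suc k - j) (\<delta> * (W ^ j * B)) (F j)" if "j \<le> Suc k" for j
    using that Suc.prems ef(5) by (cases j) (simp_all add: EF power_Suc2 mult.assoc del: sob.simps power_Suc)
  ultimately show ?case using EF by blast
qed

lemma chain_exists: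
  fixes h :: "real \<Rightarrow> 'a::euclidean_space"
  assumes n: "n \<ge> 2" and u: "sob (n - 1) U u" and \<sigma>: "\<And>x. \<sigma> x * u x = 1" and h: "sob n B h"
  obtains e where "e 0 = h" "chain n \<sigma> e" "\<And>j. j \<le> n \<Longrightarrow> sob (n - j) ((2 ^ n * U) ^ j * B) (e j)"
proof -
  have n1: "n - 1 \<ge> 1" "n - 1 + 1 = n" using n by auto
  have z: "sob (n - 1) (0 * U) (\<lambda>x. u x - u x)" "sob n (0 * B) (\<lambda>x. 0 :: 'a)" using sob_zero by simp_all
  obtain e where e: "e 0 = h" "\<forall>j<n. is_prim (e j) (\<lambda>x. \<sigma> x *\<^sub>R e (Suc j) x)"
      "\<forall>j\<le>n. sob (n - j) ((2 ^ n * U) ^ j * B) (e j)"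
    using chain_pair[OF n1(1) u u z(1) \<sigma> \<sigma> order_refl refl, of n B h "\<lambda>x. 0"] h z(2) n1(2) by auto
  moreover have "chain n \<sigma> e"
    unfolding chain_def using e sob_periodic sob_sqint by blast
  ultimately show thesis using that by blast
qed

text \<open>
  Passing from derivatives along the chain to ordinary ones costs one multiplication by \<open>\<sigma>\<close> per order, and
  a bound of order \<open>k\<close> for \<open>e j\<close> needs \<open>\<sigma>\<close> only up to order \<open>k - 1\<close>.  The highest member \<open>e n\<close> is controlled
  in \<open>L\<^sup>2\<close> only, which matches order 0.
\<close>

lemma chain_sob:
  fixes e :: "nat \<Rightarrow> real \<Rightarrow> 'a::euclidean_space"
  assumes e: "chain n \<sigma> e" and sup: "\<And>j x. 1 \<le> j \<Longrightarrow> j < n \<Longrightarrow> norm (e j x) \<le> E"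
    and l2: "l2 (e n) \<le> sqrt (2 * pi) * E" and "E \<ge> 0" "B \<ge> 0"
  shows "k \<le> n \<Longrightarrow> (k > 0 \<Longrightarrow> mul (k - 1) B \<sigma>) \<Longrightarrow> 1 \<le> j \<Longrightarrow> j + k \<le> n \<Longrightarrow>
    sob k ((1 + 2 ^ n * B) ^ k * E) (e j)"
proof (induction k arbitrary: j)
  case 0
  show ?case
  proof (cases "j = n")
    case True
    then show ?thesis using e l2 \<open>E \<ge> 0\<close> by (simp add: chain_def)
  next
    case False
    then show ?thesis using 0 sup[of j] e chain_continuous[OF e, of j]
      by (auto intro!: sob_0_sup simp: chain_def simp del: sob.simps)
  qed
next
  case (Suc k)
  let ?A = "1 + 2 ^ n * B"
  have A: "?A \<ge> 1" using \<open>B \<ge> 0\<close> by simp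
  have m: "mul k B \<sigma>" using Suc.prems by simp
  have "sob k (?A ^ k * E) (e (Suc j))"
  proof (rule Suc.IH)
    show "mul (k - 1) B \<sigma>" if "k > 0" using mul_Suc_lower[of "k - 1"] m that by simp
  qed (use Suc.prems in auto)
  then have "sob k (2 ^ k * (B * (?A ^ k * E))) (\<lambda>x. \<sigma> x *\<^sub>R e (Suc j) x)"
    using sob_scaleR_mul[OF m] by blast
  moreover have "2 ^ k * (B * (?A ^ k * E)) \<le> ?A ^ Suc k * E"
  proof -
    have "(2::real) ^ k * B \<le> 2 ^ n * B" using Suc.prems \<open>B \<ge> 0\<close> by (intro mult_right_mono power_increasing) auto
    then have "2 ^ k * B \<le> ?A" by simp
    then have "(2 ^ k * B) * (?A ^ k * E) \<le> ?A * (?A ^ k * E)"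
      using A \<open>E \<ge> 0\<close> by (intro mult_right_mono) auto
    then show ?thesis by (simp add: mult.assoc)
  qed
  ultimately have "sob k (?A ^ Suc k * E) (\<lambda>x. \<sigma> x *\<^sub>R e (Suc j) x)" by (rule sob_mono)
  moreover have "norm (e j x) \<le> ?A ^ Suc k * E" for x
  proof -
    have "norm (e j x) \<le> 1 * E" using sup[of j x] Suc.prems by simp
    also have "\<dots> \<le> ?A ^ Suc k * E" using A \<open>E \<ge> 0\<close> by (intro mult_right_mono one_le_power) auto
    finally show ?thesis .
  qed
  moreover have "?A ^ Suc k * E \<ge> 0" using A \<open>E \<ge> 0\<close> by simp
  moreover have "is_prim (e j) (\<lambda>x. \<sigma> x *\<^sub>R e (Suc j) x)" "periodic (e j)"
    using e Suc.prems by (auto simp: chain_def)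
  ultimately show ?case unfolding sob.simps by blast
qed

section \<open>Estimates at a fixed curve\<close>

locale sobolev_coefficients =
  fixes n :: nat and a :: "nat \<Rightarrow> real"
  assumes order: "n \<ge> 2" and nonneg: "\<And>j. j \<le> n \<Longrightarrow> a j \<ge> 0" and a0: "a 0 > 0" and an: "a n > 0"
begin

lemma n1: "n \<ge> 1" and Suc_n1: "Suc (n - 1) = n" and n1_pos: "n - 1 \<ge> 1"
  using order by auto

lemma sob_n1_mul: "sob (n - 1) B f \<longleftrightarrow> mul (n - 1) B f"
  using order by (simp add: mul_def)

lemma speed_multiplier:
  assumes "m > 0"
  shows "\<exists>S U. S \<ge> 0 \<and> U \<ge> 0 \<and> (\<forall>c :: real \<Rightarrow> real ^ 'd. c \<in> Hn n \<longrightarrow> (\<forall>\<theta>. speed c \<theta> \<ge> m) \<longrightarrow> Hn_norm n c \<le> M \<longrightarrow>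
     sob (n - 1) S (speed c) \<and> sob (n - 1) U (\<lambda>\<theta>. 1 / speed c \<theta>))"
proof -
  have "\<exists>S U. \<forall>f::real \<Rightarrow> real ^ 'd. mul (n - 1) (2 * \<bar>M\<bar>) f \<longrightarrow> (\<forall>x. norm (f x) \<ge> m) \<longrightarrow>
    mul (n - 1) S (\<lambda>x. norm (f x)) \<and> mul (n - 1) U (\<lambda>x. 1 / norm (f x))"
    using mul_norm[OF assms, of "2 * \<bar>M\<bar>" "n - 1"] by simp
  then obtain S U where SU: "\<And>f::real \<Rightarrow> real ^ 'd. mul (n - 1) (2 * \<bar>M\<bar>) f \<Longrightarrow> (\<And>x. norm (f x) \<ge> m) \<Longrightarrow>
    mul (n - 1) S (\<lambda>x. norm (f x)) \<and> mul (n - 1) U (\<lambda>x. 1 / norm (f x))" by blast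
  have abs: "mul (n - 1) \<bar>S\<bar> (speed c) \<and> mul (n - 1) \<bar>U\<bar> (\<lambda>\<theta>. 1 / speed c \<theta>)"
    if c: "c \<in> Hn n" "\<And>\<theta>. speed c \<theta> \<ge> m" "Hn_norm n c \<le> M" for c :: "real \<Rightarrow> real ^ 'd"
  proof -
    have "sob (n - 1) (2 * \<bar>M\<bar>) (tangent c)"
      using sob_tangent(1)[OF c(1) order] by (rule sob_mono) (use c(3) in simp)
    then have "mul (n - 1) S (speed c) \<and> mul (n - 1) U (\<lambda>x. 1 / speed c x)"
      using SU[of "\<lambda>\<theta>. tangent c \<theta>"] c(2) unfolding sob_n1_mul speed_def by simp
    then show ?thesis using mul_mono[OF _ abs_ge_self] by blast
  qed
  show ?thesis
    unfolding sob_n1_mul using abs by (intro exI[of _ "\<bar>S\<bar>"] exI[of _ "\<bar>U\<bar>"]) auto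
qed

lemma Ds_chain:
  fixes c h :: "real \<Rightarrow> real ^ 'd"
  assumes c: "c \<in> Imm n" and h: "h \<in> Hn n"
  obtains e where "e 0 = h" "chain n (speed c) e"
proof -
  obtain m where m: "m > 0" "\<forall>\<theta>. speed c \<theta> \<ge> m" using Imm_min_speed[OF c order] by blast
  obtain S U where "sob (n - 1) S (speed c)" and u: "sob (n - 1) U (\<lambda>\<theta>. 1 / speed c \<theta>)"
    using speed_multiplier[OF m(1), of "Hn_norm n c"] Imm_Hn[OF c] m(2) by blast
  obtain B where B: "sob n B h" using h Hn_iff_sob n1 by blast
  have one: "speed c x * (1 / speed c x) = 1" for x using m(1) m(2)[rule_format, of x] by simp
  show thesis by (rule chain_exists[OF order u one B]) (rule that)
qed

lemma metric_eq:
  fixes e :: "nat \<Rightarrow> real \<Rightarrow> real ^ 'd"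
  assumes "c \<in> Imm n" "chain n (speed c) e"
  shows "sobolev_metric a n c (e 0) (e 0) = (\<Sum>j\<le>n. a j * energy (speed c) (e j))"
  using sobolev_metric_chain[OF Imm_weight[OF assms(1) order] assms(2)] .

lemma metric_lower:
  fixes e :: "nat \<Rightarrow> real \<Rightarrow> real ^ 'd"
  assumes c: "c \<in> Imm n" and e: "chain n (speed c) e"
  shows "min (a 0) (a n) * (energy (speed c) (e 0) + energy (speed c) (e n)) \<le> sobolev_metric a n c (e 0) (e 0)"
proof -
  have E: "energy (speed c) (e j) \<ge> 0" if "j \<le> n" for j
    using energy_nonneg[OF Imm_weight[OF c order] chain_sqint[OF e that]] .
  have "min (a 0) (a n) * (energy (speed c) (e 0) + energy (speed c) (e n)) \<le>
      (\<Sum>j\<in>{0, n}. a j * energy (speed c) (e j))"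
    using E[of 0] E[of n] order
    by (simp add: distrib_left add_mono mult_right_mono)
  also have "\<dots> \<le> (\<Sum>j\<le>n. a j * energy (speed c) (e j))"
    using E nonneg by (intro sum_mono2) auto
  finally show ?thesis using metric_eq[OF c e] by simp
qed

lemma metric_nonneg:
  fixes c h :: "real \<Rightarrow> real ^ 'd"
  assumes c: "c \<in> Imm n" and h: "h \<in> Hn n"
  shows "sobolev_metric a n c h h \<ge> 0"
proof -
  obtain e where e: "e 0 = h" "chain n (speed c) e" using Ds_chain[OF c h] .
  have E: "energy (speed c) (e j) \<ge> 0" if "j \<le> n" for j
    using energy_nonneg[OF Imm_weight[OF c order] chain_sqint[OF e(2) that]] .
  show ?thesis using metric_eq[OF c e(2)] E nonneg unfolding e(1) by (auto intro!: sum_nonneg)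
qed

text \<open>
  The metric is at least this constant times the sum of the energies of orders 0 and \<open>n\<close>.
\<close>

definition coercivity :: real where "coercivity = min (a 0) (a n)"

lemma coercivity_pos: "coercivity > 0"
  using a0 an by (simp add: coercivity_def)

definition sup_const :: real where "sup_const = sqrt (2 / coercivity)"

lemma sup_const_pos: "sup_const > 0"
  using coercivity_pos by (simp add: sup_const_def)

lemma Ds_chain_sup:
  fixes e :: "nat \<Rightarrow> real \<Rightarrow> real ^ 'd"
  assumes c: "c \<in> Imm n" and e: "chain n (speed c) e" and j: "1 \<le> j" "j < n"
  shows "norm (e j x) \<le> sup_const * sqrt (sobolev_metric a n c (e 0) (e 0))"
proof -
  let ?E = "\<lambda>j. energy (speed c) (e j)" and ?G = "sobolev_metric a n c (e 0) (e 0)"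
  have w: "weight (speed c)" using Imm_weight[OF c order] .
  have "(norm (e j x))\<^sup>2 \<le> ?E j + ?E (Suc j)"
    using chain_sup[OF w e, of "j - 1" x] j by simp
  also have "\<dots> \<le> 2 * (?E 0 + ?E n)"
    using chain_energy_le[OF w e, of j] chain_energy_le[OF w e, of "Suc j"] j by simp
  also have "\<dots> \<le> 2 / coercivity * ?G"
    using metric_lower[OF c e] coercivity_pos by (simp add: coercivity_def[symmetric] field_simps)
  finally have "norm (e j x) \<le> sqrt (2 / coercivity * ?G)" by (rule real_le_rsqrt)
  then show ?thesis by (simp only: sup_const_def real_sqrt_mult)
qed

lemma Ds_chain_l2:
  fixes e :: "nat \<Rightarrow> real \<Rightarrow> real ^ 'd"
  assumes c: "c \<in> Imm n" and e: "chain n (speed c) e" and j: "j = 0 \<or> j = n"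
    and m: "m > 0" "\<And>\<theta>. speed c \<theta> \<ge> m"
  shows "l2 (e j) \<le> sqrt (1 / (coercivity * m)) * sqrt (sobolev_metric a n c (e 0) (e 0))"
proof -
  let ?E = "\<lambda>j. energy (speed c) (e j)" and ?G = "sobolev_metric a n c (e 0) (e 0)"
  have w: "weight (speed c)" using Imm_weight[OF c order] .
  have "m * (l2 (e j))\<^sup>2 \<le> ?E j"
    using energy_lower[OF w chain_sqint[OF e] m(2)] m(1) j by auto
  also have "?E j \<le> ?E 0 + ?E n" using chain_energy_le[OF w e] j by auto
  also have "\<dots> \<le> ?G / coercivity"
    using metric_lower[OF c e] coercivity_pos by (simp add: coercivity_def[symmetric] field_simps)
  finally have "(l2 (e j))\<^sup>2 \<le> 1 / (coercivity * m) * ?G"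
    using m(1) coercivity_pos by (simp add: field_simps)
  then have "l2 (e j) \<le> sqrt (1 / (coercivity * m) * ?G)" by (rule real_le_rsqrt)
  then show ?thesis by (simp only: real_sqrt_mult)
qed

text \<open>
  This is the uniform bound of \<open>D\<^sub>s h\<close>, with a constant that is independent of \<open>c\<close>.
\<close>

lemma velocity_sup:
  fixes c h :: "real \<Rightarrow> real ^ 'd"
  assumes c: "c \<in> Imm n" and h: "h \<in> Hn n"
  shows "norm (tangent h \<theta>) \<le> speed c \<theta> * (sup_const * sqrt (sobolev_metric a n c h h))"
proof -
  obtain e where e: "e 0 = h" "chain n (speed c) e" using Ds_chain[OF c h] .
  have p: "is_prim h (\<lambda>x. speed c x *\<^sub>R e 1 x)" using e order by (auto simp: chain_def)
  have "continuous_on UNIV (speed c)" using Imm_weight[OF c order] by (simp add: weight_def)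
  moreover have "continuous_on UNIV (e 1)" using chain_continuous[OF e(2), of 1] order by simp
  ultimately have "continuous_on UNIV (\<lambda>x. speed c x *\<^sub>R e 1 x)" by (intro continuous_intros)
  then have "(h has_vector_derivative speed c \<theta> *\<^sub>R e 1 \<theta>) (at \<theta>)"
    using is_prim_has_vector_derivative[OF p] by (simp add: continuous_on_eq_continuous_at)
  then have "tangent h \<theta> = speed c \<theta> *\<^sub>R e 1 \<theta>" by (rule vector_derivative_at)
  moreover have "norm (e 1 \<theta>) \<le> sup_const * sqrt (sobolev_metric a n c h h)"
    using Ds_chain_sup[OF c e(2), of 1 \<theta>] order e(1) by simp
  moreover have "speed c \<theta> \<ge> 0" by (simp add: speed_def)
  ultimately show ?thesis by (simp add: mult_left_mono)
qed

text \<open>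
  Write \<open>h' = \<sigma> e\<^sub>1\<close> with \<open>\<sigma> = speed c\<close>.  The factor \<open>e\<^sub>1 = D\<^sub>s h\<close> of order \<open>k + 1\<close> is controlled by the metric
  and by \<open>\<sigma>\<close> of order \<open>k\<close>; only the factor \<open>\<sigma>\<close> of order \<open>k + 1\<close> involves the highest derivative of \<open>c\<close>, and it
  does so linearly.
\<close>

lemma Hn_norm_velocity_stage:
  assumes m: "m > 0" and B: "B \<ge> 0" and k: "Suc (Suc k) \<le> n"
  shows "\<exists>C\<ge>0. \<forall>c h :: real \<Rightarrow> real ^ 'd. c \<in> Imm n \<longrightarrow> h \<in> Hn n \<longrightarrow> (\<forall>\<theta>. speed c \<theta> \<ge> m) \<longrightarrow>
    mul k B (tangent c) \<longrightarrow>
    Hn_norm (Suc (Suc k)) h \<le> C * (1 + Hn_norm (Suc (Suc k)) c) * sqrt (sobolev_metric a n c h h)"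
proof -
  have "\<exists>S U. \<forall>f::real \<Rightarrow> real ^ 'd. mul k B f \<longrightarrow> (\<forall>x. norm (f x) \<ge> m) \<longrightarrow>
    mul k S (\<lambda>x. norm (f x)) \<and> mul k U (\<lambda>x. 1 / norm (f x))"
    using mul_norm[OF m B, of k] .
  then obtain S U where SU: "\<And>f::real \<Rightarrow> real ^ 'd. mul k B f \<Longrightarrow> (\<forall>x. norm (f x) \<ge> m) \<Longrightarrow>
    mul k S (\<lambda>x. norm (f x)) \<and> mul k U (\<lambda>x. 1 / norm (f x))" by blast
  define \<kappa> where "\<kappa> = sqrt (1 / (coercivity * m))"
  define A where "A = (1 + 2 ^ n * \<bar>S\<bar>) ^ Suc k * (sup_const + \<kappa>)"
  define R where "R = 2 ^ Suc k * ((1 + 4 ^ k * (\<bar>U\<bar> * B)) * 2 * A)"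
  define C where "C = \<kappa> + sqrt (2 * pi) * R"
  have \<kappa>: "\<kappa> \<ge> 0" using coercivity_pos m by (simp add: \<kappa>_def)
  have A: "A \<ge> 0" using \<kappa> sup_const_pos by (simp add: A_def)
  have R: "R \<ge> 0" using A B by (simp add: R_def)
  have sqrt_pi: "1 \<le> sqrt (2 * pi)" using pi_gt3 by (intro real_le_rsqrt) simp
  have "Hn_norm (Suc (Suc k)) h \<le> C * (1 + Hn_norm (Suc (Suc k)) c) * sqrt (sobolev_metric a n c h h)"
    if c: "c \<in> Imm n" and h: "h \<in> Hn n" and ms: "\<forall>\<theta>. speed c \<theta> \<ge> m"
      and mul: "mul k B (tangent c)" for c h :: "real \<Rightarrow> real ^ 'd"
  proof -
    define g where "g = sqrt (sobolev_metric a n c h h)"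
    define N where "N = Hn_norm (Suc (Suc k)) c"
    have g: "g \<ge> 0" using metric_nonneg[OF c h] by (simp add: g_def)
    have N: "N \<ge> 0" by (simp add: N_def Hn_norm_nonneg)
    obtain e where e: "e 0 = h" "chain n (speed c) e" using Ds_chain[OF c h] .
    have "mul k S (speed c)" "mul k U (\<lambda>x. 1 / speed c x)"
      using SU[OF mul] ms by (simp_all add: speed_def[abs_def])
    then have S: "mul k \<bar>S\<bar> (speed c)" and U: "mul k \<bar>U\<bar> (\<lambda>x. 1 / speed c x)"
      using mul_mono[OF _ abs_ge_self] by blast+
    have "sob (Suc k) ((1 + 2 ^ n * \<bar>S\<bar>) ^ Suc k * ((sup_const + \<kappa>) * g)) (e 1)"
    proof (rule chain_sob[OF e(2)])
      show "norm (e j x) \<le> (sup_const + \<kappa>) * g" if "1 \<le> j" "j < n" for j x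
      proof -
        have "norm (e j x) \<le> sup_const * g"
          using Ds_chain_sup[OF c e(2) that] by (simp add: e(1) g_def)
        also have "\<dots> \<le> (sup_const + \<kappa>) * g" using \<kappa> g by (intro mult_right_mono) auto
        finally show ?thesis .
      qed
      have "l2 (e n) \<le> \<kappa> * g"
        using Ds_chain_l2[OF c e(2), of n m] m ms by (simp add: e(1) g_def \<kappa>_def)
      also have "\<dots> \<le> 1 * ((sup_const + \<kappa>) * g)"
        using sup_const_pos g by (simp add: mult_right_mono)
      also have "\<dots> \<le> sqrt (2 * pi) * ((sup_const + \<kappa>) * g)"
        using sup_const_pos g \<kappa> by (intro mult_right_mono sqrt_pi) auto
      finally show "l2 (e n) \<le> sqrt (2 * pi) * ((sup_const + \<kappa>) * g)" .
      show "(sup_const + \<kappa>) * g \<ge> 0" using sup_const_pos g \<kappa> by simp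
    qed (use k S in auto)
    then have e1: "sob (Suc k) (A * g) (e 1)" by (simp add: A_def mult.assoc del: sob.simps power_Suc)
    have "c \<in> Hn (Suc (Suc k))" using Hn_le[OF Imm_Hn[OF c] _ k] by simp
    then have c': "sob (Suc k) (2 * N) (tangent c)"
      using sob_tangent(1)[of c "Suc (Suc k)"] by (simp add: N_def del: sob.simps)
    have "tangent c \<theta> \<noteq> 0" for \<theta> using c by (simp add: Imm_def)
    from sob_Suc_norm[OF c' this U[unfolded speed_def] mul]
    have "sob (Suc k) ((1 + 4 ^ k * (\<bar>U\<bar> * B)) * (2 * N)) (speed c)"
      by (simp add: speed_def[abs_def] del: sob.simps)
    then have "sob (Suc k) (2 ^ Suc k * (((1 + 4 ^ k * (\<bar>U\<bar> * B)) * (2 * N)) * (A * g))) (\<lambda>x. speed c x *\<^sub>R e 1 x)"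
      using e1 by (intro sob_scaleR_mul) (simp add: mul_Suc del: sob.simps)
    moreover have "2 ^ Suc k * (((1 + 4 ^ k * (\<bar>U\<bar> * B)) * (2 * N)) * (A * g)) = R * N * g"
      by (simp add: R_def)
    ultimately have h': "sob (Suc k) (R * N * g) (\<lambda>x. speed c x *\<^sub>R e 1 x)" by metis
    obtain w where w: "is_weak_deriv (Suc k) (\<lambda>x. speed c x *\<^sub>R e 1 x) w" "sob 0 (R * N * g) w"
      using sob_imp_weak_deriv[OF h'] by blast
    have p: "is_prim h (\<lambda>x. speed c x *\<^sub>R e 1 x)" "periodic h"
      using e order by (auto simp: chain_def)
    have "is_weak_deriv (Suc (Suc k)) h w" using is_weak_deriv_Suc[OF p w(1)] .
    moreover have "sqint h" using chain_sqint[OF e(2), of 0] e(1) by simp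
    ultimately have "Hn_norm (Suc (Suc k)) h = sqrt ((l2 h)\<^sup>2 + (l2 w)\<^sup>2)"
      using Hn_norm_eq sob_sqint[OF w(2)] by blast
    also have "\<dots> \<le> l2 h + l2 w"
      using l2_nonneg[of h] l2_nonneg[of w] by (intro real_le_lsqrt) (auto simp: power2_sum)
    also have "\<dots> \<le> \<kappa> * g + sqrt (2 * pi) * (R * N * g)"
      using Ds_chain_l2[OF c e(2), of 0 m] m ms w(2) by (intro add_mono) (auto simp: e(1) g_def \<kappa>_def)
    also have "\<dots> = (\<kappa> + sqrt (2 * pi) * R * N) * g" by (simp add: algebra_simps)
    also have "\<dots> \<le> (C * (1 + N)) * g"
    proof (rule mult_right_mono[OF _ g])
      have "0 \<le> \<kappa> * N + sqrt (2 * pi) * R" using \<kappa> N R by simp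
      then show "\<kappa> + sqrt (2 * pi) * R * N \<le> C * (1 + N)" by (simp add: C_def algebra_simps)
    qed
    finally show ?thesis by (simp add: g_def N_def)
  qed
  moreover have "C \<ge> 0" using \<kappa> R by (simp add: C_def)
  ultimately show ?thesis by blast
qed

lemma metric_upper:
  assumes m: "m > 0"
  shows "\<exists>C\<ge>0. \<forall>c h :: real \<Rightarrow> real ^ 'd. c \<in> Imm n \<longrightarrow> h \<in> Hn n \<longrightarrow> (\<forall>\<theta>. speed c \<theta> \<ge> m) \<longrightarrow>
    Hn_norm n c \<le> M \<longrightarrow> sqrt (sobolev_metric a n c h h) \<le> C * Hn_norm n h"
proof -
  obtain S U where SU: "S \<ge> 0" "U \<ge> 0" "\<And>c :: real \<Rightarrow> real ^ 'd. c \<in> Hn n \<Longrightarrow> \<forall>\<theta>. speed c \<theta> \<ge> m \<Longrightarrow> Hn_norm n c \<le> M \<Longrightarrow>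
     sob (n - 1) S (speed c) \<and> sob (n - 1) U (\<lambda>\<theta>. 1 / speed c \<theta>)"
    using speed_multiplier[OF m, of M] by blast
  define W where "W = 2 ^ n * U"
  define C where "C = (\<Sum>j\<le>n. a j * (S * (sqrt (2 * pi) * (W ^ j * 2))\<^sup>2))"
  have C: "C \<ge> 0" unfolding C_def using nonneg SU by (intro sum_nonneg) auto
  have "sqrt (sobolev_metric a n c h h) \<le> sqrt C * Hn_norm n h"
    if c: "c \<in> Imm n" and h: "h \<in> Hn n" and ms: "\<forall>\<theta>. speed c \<theta> \<ge> m" and M: "Hn_norm n c \<le> M"
    for c h :: "real \<Rightarrow> real ^ 'd"
  proof -
    define N where "N = Hn_norm n h"
    have SUc: "sob (n - 1) S (speed c)" "sob (n - 1) U (\<lambda>\<theta>. 1 / speed c \<theta>)"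
      using SU(3)[OF Imm_Hn[OF c]] ms M by auto
    have one: "speed c x * (1 / speed c x) = 1" for x using m ms by (metis divide_self_if mult.right_neutral not_less times_divide_eq_right)
    obtain e where e: "e 0 = h" "chain n (speed c) e" "\<And>j. j \<le> n \<Longrightarrow> sob (n - j) (W ^ j * (2 * N)) (e j)"
      using chain_exists[OF order SUc(2) one sob_Hn_norm[OF h n1]] unfolding W_def N_def by blast
    have w: "weight (speed c)" using Imm_weight[OF c order] .
    have sS: "speed c x \<le> S" for x
      using mul_bound[of "n - 1" S "speed c" x] SUc(1) unfolding sob_n1_mul by simp
    have "sobolev_metric a n c h h = (\<Sum>j\<le>n. a j * energy (speed c) (e j))"
      using metric_eq[OF c e(2)] e(1) by simp
    also have "\<dots> \<le> (\<Sum>j\<le>n. a j * (S * (sqrt (2 * pi) * (W ^ j * (2 * N)))\<^sup>2))"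
    proof (intro sum_mono mult_left_mono)
      fix j assume j: "j \<in> {..n}"
      have "energy (speed c) (e j) \<le> S * (l2 (e j))\<^sup>2"
        using energy_upper[OF w chain_sqint[OF e(2)] sS] j by auto
      also have "\<dots> \<le> S * (sqrt (2 * pi) * (W ^ j * (2 * N)))\<^sup>2"
        using SU(1) sob_l2[OF e(3)] l2_nonneg j by (intro mult_left_mono power_mono) auto
      finally show "energy (speed c) (e j) \<le> S * (sqrt (2 * pi) * (W ^ j * (2 * N)))\<^sup>2" .
    qed (use nonneg in auto)
    also have "\<dots> = C * N\<^sup>2"
      unfolding C_def sum_distrib_right by (intro sum.cong) (auto simp: power_mult_distrib)
    finally have "sqrt (sobolev_metric a n c h h) \<le> sqrt (C * N\<^sup>2)" by (rule real_sqrt_le_mono)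
    then show ?thesis using Hn_norm_nonneg[of n h] by (simp add: real_sqrt_mult N_def)
  qed
  then show ?thesis using C by (intro exI[of _ "sqrt C"]) auto
qed

text \<open>
  The parameter \<open>\<delta>\<close> also serves as the weight in \<open>2 (e \<bullet> f) \<le> \<delta> \<bar>e\<bar>\<^sup>2 + \<bar>f\<bar>\<^sup>2 / \<delta>\<close>, where \<open>f\<close> is of size \<open>\<delta>\<close>;
  so every term is of order \<open>\<delta>\<close>.
\<close>

lemma energy_diff:
  fixes e f :: "real \<Rightarrow> 'a::euclidean_space"
  assumes w: "weight \<sigma>1" "weight \<sigma>2" and e: "sqint e" "l2 e \<le> A" and f: "sqint f" "l2 f \<le> \<delta> * A"
    and S: "\<And>x. \<sigma>1 x \<le> S" and T: "\<And>x. \<bar>\<sigma>1 x - \<sigma>2 x\<bar> \<le> T * \<delta>" and \<delta>: "0 < \<delta>" "\<delta> \<le> 1" and T0: "T \<ge> 0"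
  shows "\<bar>energy \<sigma>1 (\<lambda>x. e x + f x) - energy \<sigma>2 e\<bar> \<le> (3 * S + T) * A\<^sup>2 * \<delta>"
proof -
  have S0: "S \<ge> 0" using w(1) S[of 0] by (meson less_imp_le less_le_trans weight_def)
  have ie: "(\<lambda>x. (norm (e x))\<^sup>2) integrable_on circle" "(\<lambda>x. (norm (f x))\<^sup>2) integrable_on circle"
    using e f by (auto simp: sqint_def)
  define h where "h = (\<lambda>x. (S * \<delta> + T * \<delta>) * (norm (e x))\<^sup>2 + (S * (1 + 1 / \<delta>)) * (norm (f x))\<^sup>2)"
  have int: "(h has_integral ((S * \<delta> + T * \<delta>) * (l2 e)\<^sup>2 + (S * (1 + 1 / \<delta>)) * (l2 f)\<^sup>2)) circle"
    unfolding h_def l2_power2 using ie by (intro has_integral_add has_integral_mult_right) auto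
  have d: "((\<lambda>x. \<sigma>1 x * (norm (e x + f x))\<^sup>2 - \<sigma>2 x * (norm (e x))\<^sup>2) has_integral
      (energy \<sigma>1 (\<lambda>x. e x + f x) - energy \<sigma>2 e)) circle"
    unfolding energy_def using energy_integrable[OF w(1) sqint_add[OF e(1) f(1)]] energy_integrable[OF w(2) e(1)]
    by (intro has_integral_diff) auto
  have pt: "norm (\<sigma>1 x * (norm (e x + f x))\<^sup>2 - \<sigma>2 x * (norm (e x))\<^sup>2) \<le> h x" for x
  proof -
    have s1: "0 \<le> \<sigma>1 x" using w(1) by (simp add: weight_def less_imp_le)
    have exp: "(norm (e x + f x))\<^sup>2 - (norm (e x))\<^sup>2 = 2 * (e x \<bullet> f x) + (norm (f x))\<^sup>2"
      by (simp add: power2_norm_eq_inner inner_add_left inner_add_right inner_commute)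
    have "2 * norm (e x) * norm (f x) \<le> \<delta> * (norm (e x))\<^sup>2 + 1 / \<delta> * (norm (f x))\<^sup>2"
    proof -
      have "0 \<le> (\<delta> * norm (e x) - norm (f x))\<^sup>2 / \<delta>" using \<delta> by simp
      then show ?thesis using \<delta> by (simp add: field_simps power2_eq_square)
    qed
    have "\<bar>(norm (e x + f x))\<^sup>2 - (norm (e x))\<^sup>2\<bar> \<le> \<delta> * (norm (e x))\<^sup>2 + (1 + 1 / \<delta>) * (norm (f x))\<^sup>2"
    proof -
      have "\<bar>e x \<bullet> f x\<bar> \<le> norm (e x) * norm (f x)" by (rule Cauchy_Schwarz_ineq2)
      moreover have "(norm (f x))\<^sup>2 \<ge> 0" by simp
      moreover have "(1 + 1 / \<delta>) * (norm (f x))\<^sup>2 = (norm (f x))\<^sup>2 + 1 / \<delta> * (norm (f x))\<^sup>2"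
        by (simp add: distrib_right)
      ultimately show ?thesis
        unfolding exp using \<open>2 * norm (e x) * norm (f x) \<le> _\<close> by linarith
    qed
    then have 1: "\<sigma>1 x * \<bar>(norm (e x + f x))\<^sup>2 - (norm (e x))\<^sup>2\<bar> \<le> S * (\<delta> * (norm (e x))\<^sup>2 + (1 + 1 / \<delta>) * (norm (f x))\<^sup>2)"
      using S s1 \<delta> S0 by (intro mult_mono) auto
    have 2: "\<bar>\<sigma>1 x - \<sigma>2 x\<bar> * (norm (e x))\<^sup>2 \<le> (T * \<delta>) * (norm (e x))\<^sup>2"
      using T by (intro mult_right_mono) auto
    have "\<sigma>1 x * (norm (e x + f x))\<^sup>2 - \<sigma>2 x * (norm (e x))\<^sup>2 =
        \<sigma>1 x * ((norm (e x + f x))\<^sup>2 - (norm (e x))\<^sup>2) + (\<sigma>1 x - \<sigma>2 x) * (norm (e x))\<^sup>2"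
      by (simp add: algebra_simps)
    also have "norm \<dots> \<le> \<sigma>1 x * \<bar>(norm (e x + f x))\<^sup>2 - (norm (e x))\<^sup>2\<bar> + \<bar>\<sigma>1 x - \<sigma>2 x\<bar> * (norm (e x))\<^sup>2"
      using s1 by (intro order_trans[OF norm_triangle_ineq]) (simp add: abs_mult)
    also have "\<dots> \<le> h x" using 1 2 by (simp add: h_def algebra_simps)
    finally show ?thesis .
  qed
  have "norm (energy \<sigma>1 (\<lambda>x. e x + f x) - energy \<sigma>2 e) \<le>
      (S * \<delta> + T * \<delta>) * (l2 e)\<^sup>2 + (S * (1 + 1 / \<delta>)) * (l2 f)\<^sup>2"
    using integral_norm_bound_integral[of "\<lambda>x. \<sigma>1 x * (norm (e x + f x))\<^sup>2 - \<sigma>2 x * (norm (e x))\<^sup>2" "circle" h]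
      d int pt by (simp add: has_integral_iff)
  also have "\<dots> \<le> (S * \<delta> + T * \<delta>) * A\<^sup>2 + (S * (1 + 1 / \<delta>)) * (\<delta> * A)\<^sup>2"
    using e(2) f(2) l2_nonneg S0 \<delta> T0 by (intro add_mono mult_left_mono power_mono) auto
  also have "\<dots> = (2 * S + T + S * \<delta>) * A\<^sup>2 * \<delta>"
    using \<delta> by (simp add: field_simps power2_eq_square)
  also have "\<dots> \<le> (3 * S + T) * A\<^sup>2 * \<delta>"
    using \<delta> S0 mult_left_mono[of \<delta> 1 S] by (intro mult_right_mono) auto
  finally show ?thesis by simp
qed

text \<open>
  The speeds satisfy \<open>s1 - s2 = (v1 + v2) \<bullet> (v1 - v2) / (s1 + s2)\<close>, and \<open>1 / s1 - 1 / s2\<close> is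
  \<open>- (s1 - s2) / (s1 s2)\<close>; so both differences are of size \<open>\<delta>\<close> as multipliers, and the chains of the two
  velocities can be compared.
\<close>

lemma metric_lipschitz:
  assumes m: "m > 0"
  shows "\<exists>C\<ge>0. \<forall>(c1 :: real \<Rightarrow> real ^ 'd) c2 h1 h2 \<delta>. c1 \<in> Imm n \<longrightarrow> c2 \<in> Imm n \<longrightarrow> h1 \<in> Hn n \<longrightarrow> h2 \<in> Hn n \<longrightarrow>
    (\<forall>\<theta>. speed c1 \<theta> \<ge> m) \<longrightarrow> (\<forall>\<theta>. speed c2 \<theta> \<ge> m) \<longrightarrow> Hn_norm n c1 \<le> M \<longrightarrow> Hn_norm n c2 \<le> M \<longrightarrow>
    Hn_norm n h2 \<le> M \<longrightarrow> Hn_norm n (\<lambda>x. c1 x - c2 x) \<le> \<delta> \<longrightarrow> Hn_norm n (\<lambda>x. h1 x - h2 x) \<le> \<delta> \<longrightarrow>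
    0 < \<delta> \<longrightarrow> \<delta> \<le> 1 \<longrightarrow>
    \<bar>sobolev_metric a n c1 h1 h1 - sobolev_metric a n c2 h2 h2\<bar> \<le> C * \<delta>"
proof -
  obtain S U where SU: "S \<ge> 0" "U \<ge> 0" "\<And>c :: real \<Rightarrow> real ^ 'd. c \<in> Hn n \<Longrightarrow> \<forall>\<theta>. speed c \<theta> \<ge> m \<Longrightarrow> Hn_norm n c \<le> M \<Longrightarrow>
     sob (n - 1) S (speed c) \<and> sob (n - 1) U (\<lambda>\<theta>. 1 / speed c \<theta>)"
    using speed_multiplier[OF m, of M] by blast
  obtain R where R: "\<And>s :: real \<Rightarrow> real. mul (n - 1) (S + S) s \<Longrightarrow> \<forall>x. s x \<ge> m \<Longrightarrow> mul (n - 1) R (\<lambda>x. 1 / s x)"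
    using mul_recip[OF m, of "S + S" "n - 1"] SU(1) by auto
  define p where "p = (2::real) ^ (n - 1)"
  define T where "T = p * (\<bar>R\<bar> * (p * ((2 * \<bar>M\<bar> + 2 * \<bar>M\<bar>) * 2)))"
  define U' where "U' = U + p * (T * (p * (U * U)))"
  define W where "W = 2 ^ n * U'"
  define B where "B = 2 * \<bar>M\<bar> + 2"
  define A where "A j = sqrt (2 * pi) * (W ^ j * B)" for j
  define C where "C = (\<Sum>j\<le>n. a j * ((3 * S + T) * (A j)\<^sup>2))"
  have p: "p \<ge> 0" by (simp add: p_def)
  have T0: "T \<ge> 0" using p by (simp add: T_def)
  have U': "U' \<ge> U" "p * (T * (p * (U * U))) \<le> U'" using SU p T0 by (auto simp: U'_def)
  have C: "C \<ge> 0" unfolding C_def using nonneg SU T0 by (intro sum_nonneg) auto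
  have "\<bar>sobolev_metric a n c1 h1 h1 - sobolev_metric a n c2 h2 h2\<bar> \<le> C * \<delta>"
    if c: "c1 \<in> Imm n" "c2 \<in> Imm n" and h: "h1 \<in> Hn n" "h2 \<in> Hn n"
      and ms: "\<forall>\<theta>. speed c1 \<theta> \<ge> m" "\<forall>\<theta>. speed c2 \<theta> \<ge> m" and M: "Hn_norm n c1 \<le> M" "Hn_norm n c2 \<le> M"
        "Hn_norm n h2 \<le> M" and \<delta>: "Hn_norm n (\<lambda>x. c1 x - c2 x) \<le> \<delta>" "Hn_norm n (\<lambda>x. h1 x - h2 x) \<le> \<delta>"
        "0 < \<delta>" "\<delta> \<le> 1" for c1 c2 h1 h2 :: "real \<Rightarrow> real ^ 'd" and \<delta>
  proof -
    define s1 where "s1 = speed c1"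
    define s2 where "s2 = speed c2"
    define v1 where "v1 = (tangent c1)"
    define v2 where "v2 = (tangent c2)"
    have s: "s1 = (\<lambda>x. norm (v1 x))" "s2 = (\<lambda>x. norm (v2 x))"
      by (simp_all add: s1_def s2_def v1_def v2_def speed_def[abs_def])
    have sS: "mul (n - 1) S s1" "mul (n - 1) S s2" and sU: "mul (n - 1) U (\<lambda>x. 1 / s1 x)" "mul (n - 1) U (\<lambda>x. 1 / s2 x)"
      using SU(3)[of c1] SU(3)[of c2] Imm_Hn c ms M unfolding s1_def s2_def sob_n1_mul by auto
    have sm: "s1 x \<ge> m" "s2 x \<ge> m" for x using ms by (auto simp: s1_def s2_def)
    have vM: "mul (n - 1) (2 * \<bar>M\<bar>) v1" "mul (n - 1) (2 * \<bar>M\<bar>) v2"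
      unfolding v1_def v2_def sob_n1_mul[symmetric]
      using sob_mono[OF sob_tangent(1)[OF Imm_Hn[OF c(1)] order], of "2 * \<bar>M\<bar>"]
        sob_mono[OF sob_tangent(1)[OF Imm_Hn[OF c(2)] order], of "2 * \<bar>M\<bar>"] M by auto
    have vd: "mul (n - 1) (2 * \<delta>) (\<lambda>x. v1 x - v2 x)"
    proof -
      have "sob (n - 1) (2 * Hn_norm n (\<lambda>x. c1 x - c2 x)) (\<lambda>x. v1 x - v2 x)"
        using sob_tangent(1)[OF Hn_diff[OF Imm_Hn[OF c(1)] Imm_Hn[OF c(2)] n1] order]
        by (simp only: v1_def v2_def tangent_diff[OF Imm_Hn[OF c(1)] Imm_Hn[OF c(2)] order])
      then show ?thesis unfolding sob_n1_mul[symmetric] by (rule sob_mono) (use \<delta> in simp)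
    qed
    have add: "mul (n - 1) (2 * \<bar>M\<bar> + 2 * \<bar>M\<bar>) (\<lambda>x. v1 x + v2 x)" "mul (n - 1) (S + S) (\<lambda>x. s1 x + s2 x)"
      using sob_add[of "n - 1" "2 * \<bar>M\<bar>" v1 "2 * \<bar>M\<bar>" v2] sob_add[of "n - 1" S s1 S s2] vM sS
      unfolding sob_n1_mul by blast+
    have "mul (n - 1) R (\<lambda>x. 1 / (s1 x + s2 x))"
    proof (rule R[OF add(2)], intro allI)
      show "s1 x + s2 x \<ge> m" for x using sm[of x] m by linarith
    qed
    then have r: "mul (n - 1) \<bar>R\<bar> (\<lambda>x. 1 / (s1 x + s2 x))" by (rule mul_mono) simp
    have eq: "s1 x - s2 x = (1 / (s1 x + s2 x)) *\<^sub>R ((v1 x + v2 x) \<bullet> (v1 x - v2 x))" for x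
    proof -
      have "(v1 x + v2 x) \<bullet> (v1 x - v2 x) = (s1 x)\<^sup>2 - (s2 x)\<^sup>2"
        by (simp add: s inner_add_left inner_add_right inner_diff_left inner_diff_right inner_commute power2_norm_eq_inner)
      also have "\<dots> = (s1 x + s2 x) * (s1 x - s2 x)" by (simp add: power2_eq_square algebra_simps)
      finally show ?thesis using sm[of x] m by simp
    qed
    have "mul (n - 1) (p * (\<bar>R\<bar> * (p * ((2 * \<bar>M\<bar> + 2 * \<bar>M\<bar>) * (2 * \<delta>))))) (\<lambda>x. s1 x - s2 x)"
      unfolding eq p_def by (intro mul_scaleR mul_inner r add vd)
    then have sd: "mul (n - 1) (T * \<delta>) (\<lambda>x. s1 x - s2 x)" by (simp add: T_def mult.assoc)
    have u_eq: "1 / s1 x - 1 / s2 x = - ((s1 x - s2 x) *\<^sub>R ((1 / s1 x) *\<^sub>R (1 / s2 x)))" for x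
      using sm[of x] m by (simp add: field_simps)
    have "mul (n - 1) (p * ((T * \<delta>) * (p * (U * U)))) (\<lambda>x. (s1 x - s2 x) *\<^sub>R ((1 / s1 x) *\<^sub>R (1 / s2 x)))"
      unfolding p_def by (intro mul_scaleR sd sU)
    then have "sob (n - 1) (p * ((T * \<delta>) * (p * (U * U)))) (\<lambda>x. 1 / s1 x - 1 / s2 x)"
      unfolding u_eq sob_n1_mul[symmetric] by (rule sob_minus)
    moreover have "p * ((T * \<delta>) * (p * (U * U))) \<le> \<delta> * U'"
      using mult_left_mono[OF U'(2), of \<delta>] \<delta>(3) by (simp add: algebra_simps)
    ultimately have ud: "sob (n - 1) (\<delta> * U') (\<lambda>x. 1 / s1 x - 1 / s2 x)" by (rule sob_mono)
    have u: "sob (n - 1) U' (\<lambda>x. 1 / s1 x)" "sob (n - 1) U' (\<lambda>x. 1 / s2 x)"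
      using sU U'(1) unfolding sob_n1_mul[symmetric] by (auto intro: sob_mono)
    have one: "s1 x * (1 / s1 x) = 1" "s2 x * (1 / s2 x) = 1" for x using sm[of x] m by auto
    have hB: "sob n B h2" using sob_Hn_norm[OF h(2) n1] by (rule sob_mono) (use M(3) in \<open>simp add: B_def\<close>)
    have "\<delta> * 2 \<le> \<delta> * B" using \<delta>(3) by (intro mult_left_mono) (auto simp: B_def)
    then have dB: "sob n (\<delta> * B) (\<lambda>x. h1 x - h2 x)"
      using \<delta>(2) by (intro sob_mono[OF sob_Hn_norm[OF Hn_diff[OF h n1] n1]]) auto
    have W: "W = 2 ^ (n - 1 + 1) * U'" and le: "n \<le> n - 1 + 1" using order by (auto simp: W_def)
    obtain e f where ef: "e 0 = h2" "f 0 = (\<lambda>x. h1 x - h2 x)"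
        "\<forall>j<n. is_prim (e j) (\<lambda>x. s2 x *\<^sub>R e (Suc j) x)"
        "\<forall>j<n. is_prim (\<lambda>x. e j x + f j x) (\<lambda>x. s1 x *\<^sub>R (e (Suc j) x + f (Suc j) x))"
        "\<forall>j\<le>n. sob (n - j) (W ^ j * B) (e j) \<and> sob (n - j) (\<delta> * (W ^ j * B)) (f j)"
      using chain_pair[OF n1_pos u ud one less_imp_le[OF \<delta>(3)] W le hB dB] by blast
    have per: "periodic (e j)" "periodic (\<lambda>x. e j x + f j x)" "sqint (e j)" "sqint (f j)"
        "l2 (e j) \<le> A j" "l2 (f j) \<le> \<delta> * A j" if "j \<le> n" for j
    proof -
      have s: "sob (n - j) (W ^ j * B) (e j)" "sob (n - j) (\<delta> * (W ^ j * B)) (f j)" using ef(5) that by auto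
      show "periodic (e j)" "periodic (\<lambda>x. e j x + f j x)"
        using sob_periodic[OF s(1)] sob_periodic[OF s(2)] by (auto simp: periodic_def)
      show "sqint (e j)" "sqint (f j)" using sob_sqint s by blast+
      show "l2 (e j) \<le> A j" "l2 (f j) \<le> \<delta> * A j"
        using sob_l2[OF s(1)] sob_l2[OF s(2)] by (auto simp: A_def algebra_simps)
    qed
    have ch2: "chain n (speed c2) e" unfolding chain_def using ef(3) per by (auto simp: s2_def)
    have ch1: "chain n (speed c1) (\<lambda>j x. e j x + f j x)"
      unfolding chain_def using ef(4) per by (auto simp: s1_def intro: sqint_add)
    have G2: "sobolev_metric a n c2 h2 h2 = (\<Sum>j\<le>n. a j * energy s2 (e j))"
      using metric_eq[OF c(2) ch2] ef(1) by (simp add: s2_def)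
    have G1: "sobolev_metric a n c1 h1 h1 = (\<Sum>j\<le>n. a j * energy s1 (\<lambda>x. e j x + f j x))"
      using metric_eq[OF c(1) ch1] ef(1,2) by (simp add: s1_def)
    have w: "weight s1" "weight s2" using Imm_weight[OF _ order] c by (auto simp: s1_def s2_def)
    have "\<bar>energy s1 (\<lambda>x. e j x + f j x) - energy s2 (e j)\<bar> \<le> (3 * S + T) * (A j)\<^sup>2 * \<delta>" if "j \<le> n" for j
      using mul_bound[OF sS(1)] mul_bound[OF sd] per[OF that] \<delta> T0
      by (intro energy_diff w) (auto intro: order_trans[OF abs_ge_self])
    then have "(\<Sum>j\<le>n. \<bar>a j * (energy s1 (\<lambda>x. e j x + f j x) - energy s2 (e j))\<bar>) \<le>
        (\<Sum>j\<le>n. a j * ((3 * S + T) * (A j)\<^sup>2 * \<delta>))"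
      using nonneg by (intro sum_mono) (auto simp: abs_mult intro!: mult_left_mono)
    also have "\<dots> = C * \<delta>" unfolding C_def sum_distrib_right by (simp add: mult.assoc)
    finally show ?thesis
      unfolding G1 G2 sum_subtractf[symmetric] right_diff_distrib[symmetric]
      using sum_abs[of "\<lambda>j. a j * (energy s1 (\<lambda>x. e j x + f j x) - energy s2 (e j))" "{..n}"] by linarith
  qed
  then show ?thesis using C by blast
qed

end

section \<open>Mean value inequalities along paths\<close>

text \<open>
  The number \<open>g t\<close> bounds the local rate of change of \<open>f\<close> at \<open>t\<close>, without differentiability of \<open>f\<close>: the
  functions of interest are norms of points on a path.
\<close>

definition loc_lip :: "(real \<Rightarrow> real) \<Rightarrow> (real \<Rightarrow> real) \<Rightarrow> real set \<Rightarrow> bool" where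
  "loc_lip f g S \<longleftrightarrow> (\<forall>t\<in>S. \<forall>\<epsilon>>0. \<forall>\<^sub>F s in at t within S. \<bar>f s - f t\<bar> \<le> (g t + \<epsilon>) * \<bar>s - t\<bar>)"

lemma loc_lip_subset: "loc_lip f g S \<Longrightarrow> T \<subseteq> S \<Longrightarrow> loc_lip f g T"
  unfolding loc_lip_def using filter_leD[OF at_le] by (meson subsetD)

text \<open>
  Bisection again: near \<open>x\<close> the increment of \<open>f\<close> is at most \<open>(g x + \<epsilon>) (v - u)\<close>, and by continuity the
  integral of \<open>g\<close> is at least \<open>(g x - \<epsilon>) (v - u)\<close>.
\<close>

lemma loc_lip_integral:
  assumes ab: "a \<le> b" and f: "loc_lip f g {a..b}" and g: "continuous_on {a..b} g"
  shows "\<bar>f b - f a\<bar> \<le> integral {a..b} g"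
proof (rule field_le_epsilon)
  fix e :: real assume "e > 0"
  define \<epsilon> where "\<epsilon> = e / (2 * (b - a + 1))"
  have \<epsilon>: "\<epsilon> > 0" using \<open>e > 0\<close> ab by (simp add: \<epsilon>_def)
  have gi: "g integrable_on {u..v}" if "a \<le> u" "v \<le> b" for u v
    using g that by (intro integrable_continuous_interval) (auto intro: continuous_on_subset)
  have "a \<le> a \<longrightarrow> b \<le> b \<longrightarrow> \<bar>f b - f a\<bar> \<le> integral {a..b} g + 2 * \<epsilon> * (b - a)"
    using ab
  proof (rule Bolzano[where P = "\<lambda>u v. a \<le> u \<longrightarrow> v \<le> b \<longrightarrow> \<bar>f v - f u\<bar> \<le> integral {u..v} g + 2 * \<epsilon> * (v - u)"])
    fix u v w assume uv: "a \<le> u \<longrightarrow> v \<le> b \<longrightarrow> \<bar>f v - f u\<bar> \<le> integral {u..v} g + 2 * \<epsilon> * (v - u)"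
      and vw: "a \<le> v \<longrightarrow> w \<le> b \<longrightarrow> \<bar>f w - f v\<bar> \<le> integral {v..w} g + 2 * \<epsilon> * (w - v)" and le: "u \<le> v" "v \<le> w"
    show "a \<le> u \<longrightarrow> w \<le> b \<longrightarrow> \<bar>f w - f u\<bar> \<le> integral {u..w} g + 2 * \<epsilon> * (w - u)"
    proof (intro impI)
      assume aw: "a \<le> u" "w \<le> b"
      have "integral {u..v} g + integral {v..w} g = integral {u..w} g"
        using le aw by (intro Henstock_Kurzweil_Integration.integral_combine gi)
      moreover have "2 * \<epsilon> * (w - u) = 2 * \<epsilon> * (v - u) + 2 * \<epsilon> * (w - v)" by (simp add: algebra_simps)
      ultimately show "\<bar>f w - f u\<bar> \<le> integral {u..w} g + 2 * \<epsilon> * (w - u)"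
        using uv vw le aw by linarith
    qed
  next
    fix x assume x: "a \<le> x" "x \<le> b"
    then have "\<forall>\<^sub>F s in at x within {a..b}. \<bar>f s - f x\<bar> \<le> (g x + \<epsilon>) * \<bar>s - x\<bar>"
      using f \<epsilon> by (simp add: loc_lip_def)
    then obtain d1 where d1: "d1 > 0" "\<And>s. s \<in> {a..b} \<Longrightarrow> s \<noteq> x \<Longrightarrow> dist s x < d1 \<Longrightarrow> \<bar>f s - f x\<bar> \<le> (g x + \<epsilon>) * \<bar>s - x\<bar>"
      unfolding eventually_at by blast
    obtain d2 where d2: "d2 > 0" "\<And>s. s \<in> {a..b} \<Longrightarrow> dist s x < d2 \<Longrightarrow> dist (g s) (g x) < \<epsilon>"
      using g x \<epsilon> unfolding continuous_on_iff by (metis atLeastAtMost_iff)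
    have "\<bar>f v - f u\<bar> \<le> integral {u..v} g + 2 * \<epsilon> * (v - u)"
      if "u \<le> x" "x \<le> v" "v - u < min d1 d2" "a \<le> u" "v \<le> b" for u v
    proof -
      have "\<bar>f v - f x\<bar> \<le> (g x + \<epsilon>) * (v - x)" using d1(2)[of v] that x by (cases "v = x") (auto simp: dist_real_def)
      moreover have "\<bar>f u - f x\<bar> \<le> (g x + \<epsilon>) * (x - u)" using d1(2)[of u] that x by (cases "u = x") (auto simp: dist_real_def)
      moreover have "(g x + \<epsilon>) * (v - x) + (g x + \<epsilon>) * (x - u) = (g x + \<epsilon>) * (v - u)" by (simp add: algebra_simps)
      ultimately have 1: "\<bar>f v - f u\<bar> \<le> (g x + \<epsilon>) * (v - u)" by linarith
      have "integral {u..v} (\<lambda>s. g x - \<epsilon>) \<le> integral {u..v} g"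
      proof (rule integral_le)
        fix s assume "s \<in> {u..v}"
        then have "dist (g s) (g x) < \<epsilon>" using that by (intro d2(2)) (auto simp: dist_real_def)
        then show "g x - \<epsilon> \<le> g s" by (simp add: dist_real_def)
      qed (use that gi in auto)
      moreover have "integral {u..v} (\<lambda>s. g x - \<epsilon>) = (v - u) * (g x - \<epsilon>)" using that by simp
      moreover have "(g x + \<epsilon>) * (v - u) = (v - u) * (g x - \<epsilon>) + 2 * \<epsilon> * (v - u)" by (simp add: algebra_simps)
      ultimately show ?thesis using 1 by linarith
    qed
    then show "\<exists>d>0. \<forall>u v. u \<le> x \<and> x \<le> v \<and> v - u < d \<longrightarrow>
        (a \<le> u \<longrightarrow> v \<le> b \<longrightarrow> \<bar>f v - f u\<bar> \<le> integral {u..v} g + 2 * \<epsilon> * (v - u))"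
      using d1(1) d2(1) by (intro exI[of _ "min d1 d2"]) auto
  qed
  moreover have "2 * \<epsilon> * (b - a) \<le> e"
    using ab \<open>e > 0\<close> by (simp add: \<epsilon>_def field_simps)
  ultimately show "\<bar>f b - f a\<bar> \<le> integral {a..b} g + e" by simp
qed

lemma abs_ln_diff_le:
  fixes x y z :: real
  assumes "0 < z" "z \<le> x" "z \<le> y"
  shows "\<bar>ln x - ln y\<bar> \<le> \<bar>x - y\<bar> / z"
proof -
  have *: "ln u - ln v \<le> \<bar>u - v\<bar> / z" if "z \<le> u" "z \<le> v" for u v
  proof -
    have "ln u - ln v \<le> (u - v) / v" using that assms by (intro ln_diff_le) auto
    also have "\<dots> \<le> \<bar>u - v\<bar> / z" using that assms by (intro frac_le) auto
    finally show ?thesis .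
  qed
  from *[OF assms(2,3)] *[OF assms(3,2)] show ?thesis by (simp add: abs_le_iff abs_minus_commute)
qed

text \<open>
  Combined with \<open>loc_lip_integral\<close>, this is Gronwall's inequality.
\<close>

lemma loc_lip_ln:
  assumes f: "loc_lip f (\<lambda>t. f t * g t) S" and pos: "\<And>t. t \<in> S \<Longrightarrow> f t > 0" and g: "\<And>t. t \<in> S \<Longrightarrow> g t \<ge> 0"
  shows "loc_lip (\<lambda>t. ln (f t)) g S"
  unfolding loc_lip_def
proof (intro ballI allI impI)
  fix t and \<epsilon> :: real assume t: "t \<in> S" and \<epsilon>: "\<epsilon> > 0"
  define P where "P = f t"
  define G where "G = g t"
  \<comment> \<open>a relative change of \<open>f\<close> by \<open>\<kappa>\<close> spends one half of \<open>\<epsilon>\<close>, the additive error in \<open>c\<close> the other half\<close>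
  define \<kappa> where "\<kappa> = \<epsilon> / (2 * (G + \<epsilon>))"
  have PG: "P > 0" "G \<ge> 0" using pos[OF t] g[OF t] by (auto simp: P_def G_def)
  have \<kappa>: "0 < \<kappa>" "\<kappa> < 1" "\<kappa> * (G + \<epsilon>) = \<epsilon> / 2"
    using \<epsilon> PG by (auto simp: \<kappa>_def field_simps)
  define c where "c = P * G + \<epsilon> * P / 2"
  have c: "c > 0" using \<epsilon> PG by (simp add: c_def add_nonneg_pos)
  have c_eq: "c = (G + \<epsilon>) * (P - \<kappa> * P)"
  proof -
    have "(G + \<epsilon>) * (P - \<kappa> * P) = (G + \<epsilon>) * P - (\<kappa> * (G + \<epsilon>)) * P" by (simp add: algebra_simps)
    then show ?thesis unfolding \<kappa>(3) by (simp add: c_def algebra_simps)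
  qed
  have near: "\<forall>\<^sub>F s in at t within S. \<bar>f s - f t\<bar> \<le> c * \<bar>s - t\<bar>"
    using f t \<epsilon> PG unfolding loc_lip_def by (auto simp: c_def P_def G_def)
  have "\<forall>\<^sub>F s in at t within S. dist s t < \<kappa> * P / c"
    using \<kappa> PG c unfolding eventually_at by (intro exI[of _ "\<kappa> * P / c"]) auto
  moreover have "\<forall>\<^sub>F s in at t within S. s \<in> S" by (simp add: eventually_at_filter)
  ultimately show "\<forall>\<^sub>F s in at t within S. \<bar>ln (f s) - ln (f t)\<bar> \<le> (g t + \<epsilon>) * \<bar>s - t\<bar>"
    using near
  proof eventually_elim
    case (elim s)
    have "c * \<bar>s - t\<bar> \<le> \<kappa> * P" using elim(1) c by (simp add: dist_real_def field_simps)
    then have "f s \<ge> P - \<kappa> * P" using elim(3) by (simp add: P_def)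
    moreover have "P - \<kappa> * P > 0" using \<kappa> PG by simp
    moreover have "P - \<kappa> * P \<le> f t" using \<kappa> PG by (simp add: P_def)
    ultimately have "\<bar>ln (f s) - ln (f t)\<bar> \<le> \<bar>f s - f t\<bar> / (P - \<kappa> * P)" by (intro abs_ln_diff_le)
    also have "\<dots> \<le> (c * \<bar>s - t\<bar>) / (P - \<kappa> * P)" using elim(3) \<open>P - \<kappa> * P > 0\<close> by (intro divide_right_mono) auto
    also have "\<dots> = (G + \<epsilon>) * \<bar>s - t\<bar>"
    proof -
      have "(u * d * w) / d = u * w" if "d > 0" for u d w :: real using that by simp
      from this[OF \<open>P - \<kappa> * P > 0\<close>] show ?thesis unfolding c_eq .
    qed
    finally show ?case by (simp add: G_def)
  qed
qed

text \<open>
  Lower order norms and the norm of the tangent at a fixed point are seminorms \<open>N\<close> dominated by the norm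
  of \<open>H\<^sup>n\<close>, so the convergence of difference quotients passes to them.
\<close>

lemma Hn_has_derivative_functional:
  fixes p :: "real \<Rightarrow> real \<Rightarrow> real ^ 'd" and N :: "(real \<Rightarrow> real ^ 'd) \<Rightarrow> real"
  assumes n: "n \<ge> 1" and p: "Hn_has_derivative n p v t S" and t: "t \<in> S" and \<epsilon>: "\<epsilon> > 0"
    and add: "\<And>f g. f \<in> Hn n \<Longrightarrow> g \<in> Hn n \<Longrightarrow> N (\<lambda>x. f x + g x) \<le> N f + N g"
    and scale: "\<And>f c. f \<in> Hn n \<Longrightarrow> N (\<lambda>x. c *\<^sub>R f x) = \<bar>c\<bar> * N f"
    and le: "\<And>f. f \<in> Hn n \<Longrightarrow> N f \<le> C * Hn_norm n f" and C: "C > 0"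
  shows "\<forall>\<^sub>F s in at t within S. N (\<lambda>x. p s x - p t x) \<le> (N v + \<epsilon>) * \<bar>s - t\<bar>"
proof -
  have v: "v \<in> Hn n" and pH: "\<And>s. s \<in> S \<Longrightarrow> p s \<in> Hn n"
    and lim: "((\<lambda>s. Hn_norm n (\<lambda>\<theta>. (1 / (s - t)) *\<^sub>R (p s \<theta> - p t \<theta>) - v \<theta>)) \<longlongrightarrow> 0) (at t within S)"
    using p by (auto simp: Hn_has_derivative_def)
  have "\<forall>\<^sub>F s in at t within S. Hn_norm n (\<lambda>\<theta>. (1 / (s - t)) *\<^sub>R (p s \<theta> - p t \<theta>) - v \<theta>) < \<epsilon> / C"
    using lim \<epsilon> C by (intro order_tendstoD) auto
  moreover have "\<forall>\<^sub>F s in at t within S. s \<in> S \<and> s \<noteq> t" by (simp add: eventually_at_filter)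
  ultimately show ?thesis
  proof eventually_elim
    case (elim s)
    define q where "q = (\<lambda>\<theta>. (1 / (s - t)) *\<^sub>R (p s \<theta> - p t \<theta>))"
    have diff: "(\<lambda>\<theta>. p s \<theta> - p t \<theta>) \<in> Hn n" using pH elim(2) t n by (intro Hn_diff) auto
    then have q: "q \<in> Hn n" unfolding q_def using n by (intro Hn_scaleR)
    have qv: "(\<lambda>\<theta>. q \<theta> - v \<theta>) \<in> Hn n" using q v n by (intro Hn_diff)
    have "N q \<le> N (\<lambda>\<theta>. q \<theta> - v \<theta>) + N v" using add[OF qv v] by simp
    moreover have "N (\<lambda>\<theta>. q \<theta> - v \<theta>) \<le> \<epsilon>"
    proof -
      have "N (\<lambda>\<theta>. q \<theta> - v \<theta>) \<le> C * Hn_norm n (\<lambda>\<theta>. q \<theta> - v \<theta>)" by (rule le[OF qv])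
      also have "\<dots> \<le> C * (\<epsilon> / C)" using elim(1) C by (intro mult_left_mono) (auto simp: q_def)
      finally show ?thesis using C by simp
    qed
    ultimately have "N q * \<bar>s - t\<bar> \<le> (N v + \<epsilon>) * \<bar>s - t\<bar>" by (intro mult_right_mono) auto
    moreover have "N q = \<bar>1 / (s - t)\<bar> * N (\<lambda>\<theta>. p s \<theta> - p t \<theta>)" unfolding q_def by (rule scale[OF diff])
    ultimately show ?case using elim(2) by simp
  qed
qed

lemma Hn_derivative_unique:
  fixes p :: "real \<Rightarrow> real \<Rightarrow> real ^ 'd"
  assumes n: "n \<ge> 1" and v: "Hn_has_derivative n p v t S" and w: "Hn_has_derivative n p w t S"
    and t: "t \<in> S" and nt: "at t within S \<noteq> bot"
  shows "v = w"
proof -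
  have vH: "v \<in> Hn n" "w \<in> Hn n" and pH: "\<And>s. s \<in> S \<Longrightarrow> p s \<in> Hn n" using v w by (auto simp: Hn_has_derivative_def)
  let ?q = "\<lambda>s \<theta>. (1 / (s - t)) *\<^sub>R (p s \<theta> - p t \<theta>)"
  have "((\<lambda>s. Hn_norm n (\<lambda>\<theta>. ?q s \<theta> - v \<theta>) + Hn_norm n (\<lambda>\<theta>. ?q s \<theta> - w \<theta>)) \<longlongrightarrow> 0 + 0) (at t within S)"
    using v w unfolding Hn_has_derivative_def by (intro tendsto_add) auto
  moreover have "\<forall>\<^sub>F s in at t within S. Hn_norm n (\<lambda>\<theta>. v \<theta> - w \<theta>) \<le> Hn_norm n (\<lambda>\<theta>. ?q s \<theta> - v \<theta>) + Hn_norm n (\<lambda>\<theta>. ?q s \<theta> - w \<theta>)"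
  proof -
    have "\<forall>\<^sub>F s in at t within S. s \<in> S" by (simp add: eventually_at_filter)
    then show ?thesis
    proof eventually_elim
      case (elim s)
      have q: "?q s \<in> Hn n" using pH elim t n by (intro Hn_scaleR Hn_diff) auto
      have "Hn_norm n (\<lambda>\<theta>. (v \<theta> - ?q s \<theta>) + (?q s \<theta> - w \<theta>)) \<le> Hn_norm n (\<lambda>\<theta>. v \<theta> - ?q s \<theta>) + Hn_norm n (\<lambda>\<theta>. ?q s \<theta> - w \<theta>)"
        using q vH n by (intro Hn_norm_triangle Hn_diff)
      also have "Hn_norm n (\<lambda>\<theta>. v \<theta> - ?q s \<theta>) = Hn_norm n (\<lambda>\<theta>. ?q s \<theta> - v \<theta>)"
        using q vH n by (intro Hn_norm_diff_commute)
      finally show ?case by simp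
    qed
  qed
  ultimately have "Hn_norm n (\<lambda>\<theta>. v \<theta> - w \<theta>) \<le> 0 + 0"
    using tendsto_lowerbound[OF _ _ nt] by blast
  moreover obtain k where k: "n = Suc k" using n by (cases n) auto
  ultimately have "sob (Suc k) 0 (\<lambda>\<theta>. v \<theta> - w \<theta>)"
    using sob_Hn_norm[OF Hn_diff[OF vH n] n] Hn_norm_nonneg[of n "\<lambda>\<theta>. v \<theta> - w \<theta>"] by (simp del: sob.simps)
  then have "norm (v x - w x) \<le> 0" for x by (rule sob_bound)
  then show ?thesis by auto
qed

lemma Hn_has_derivative_interior:
  assumes "Hn_has_derivative n p v t S" "t \<in> interior S" "S \<subseteq> T" "\<And>s. s \<in> T \<Longrightarrow> p s \<in> Hn n"
  shows "Hn_has_derivative n p v t T"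
proof -
  have "t \<in> interior T" using assms(2,3) interior_mono by blast
  then have "at t within S = at t within T" using assms(2) by (simp only: at_within_interior)
  then show ?thesis using assms(1,4) unfolding Hn_has_derivative_def by (simp only:) blast
qed

context sobolev_coefficients
begin

definition metric_norm :: "(real \<Rightarrow> real ^ 'd) \<Rightarrow> (real \<Rightarrow> real ^ 'd) \<Rightarrow> real" where
  "metric_norm c h = sqrt (sobolev_metric a n c h h)"

lemma metric_norm_nonneg: "c \<in> Imm n \<Longrightarrow> h \<in> Hn n \<Longrightarrow> metric_norm c h \<ge> 0"
  by (simp add: metric_norm_def metric_nonneg)

lemma eventually_Hn_norm_small:
  fixes p :: "real \<Rightarrow> real \<Rightarrow> real ^ 'd"
  assumes p: "Hn_has_derivative n p v t S" and t: "t \<in> S" and "\<delta> > 0"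
  shows "\<forall>\<^sub>F s in at t within S. Hn_norm n (\<lambda>x. p s x - p t x) < \<delta>"
proof -
  have "\<forall>\<^sub>F s in at t within S. Hn_norm n (\<lambda>x. p s x - p t x) \<le> (Hn_norm n v + 1) * \<bar>s - t\<bar>"
    by (rule Hn_has_derivative_functional[OF n1 p t, where C = 1])
      (auto intro: Hn_norm_triangle[OF _ _ n1] Hn_norm_scaleR[OF _ n1])
  moreover have "((\<lambda>s. (Hn_norm n v + 1) * \<bar>s - t\<bar>) \<longlongrightarrow> (Hn_norm n v + 1) * \<bar>t - t\<bar>) (at t within S)"
    by (intro tendsto_intros)
  then have "\<forall>\<^sub>F s in at t within S. (Hn_norm n v + 1) * \<bar>s - t\<bar> < \<delta>"
    using \<open>\<delta> > 0\<close> by (intro order_tendstoD) auto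
  ultimately show ?thesis by eventually_elim simp
qed

lemma speed_diff_le:
  fixes c1 c2 :: "real \<Rightarrow> real ^ 'd"
  assumes "c1 \<in> Hn n" "c2 \<in> Hn n"
  shows "\<bar>speed c1 \<theta> - speed c2 \<theta>\<bar> \<le> norm (tangent (\<lambda>x. c1 x - c2 x) \<theta>)"
    "\<bar>speed c1 \<theta> - speed c2 \<theta>\<bar> \<le> 2 * Hn_norm n (\<lambda>x. c1 x - c2 x)"
proof -
  show 1: "\<bar>speed c1 \<theta> - speed c2 \<theta>\<bar> \<le> norm (tangent (\<lambda>x. c1 x - c2 x) \<theta>)"
    unfolding tangent_diff[OF assms order] speed_def by (rule norm_triangle_ineq3)
  show "\<bar>speed c1 \<theta> - speed c2 \<theta>\<bar> \<le> 2 * Hn_norm n (\<lambda>x. c1 x - c2 x)"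
    using 1 sob_tangent(2)[OF Hn_diff[OF assms n1] order] by (rule order_trans)
qed

text \<open>
  The velocity \<open>V\<close> is differentiable as well, which makes it continuous in \<open>H\<^sup>n\<close>.
\<close>

definition smooth_piece :: "(real \<Rightarrow> real \<Rightarrow> real ^ 'd) \<Rightarrow> (real \<Rightarrow> real \<Rightarrow> real ^ 'd) \<Rightarrow> real set \<Rightarrow> bool" where
  "smooth_piece p V S \<longleftrightarrow> (\<forall>t\<in>S. p t \<in> Imm n \<and> Hn_has_derivative n p (V t) t S) \<and>
     (\<exists>V'. \<forall>t\<in>S. Hn_has_derivative n V (V' t) t S)"

lemma smooth_pieceD:
  assumes "smooth_piece p V S" "t \<in> S"
  shows "p t \<in> Imm n" "p t \<in> Hn n" "V t \<in> Hn n" "Hn_has_derivative n p (V t) t S"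
  using assms Imm_Hn by (auto simp: smooth_piece_def Hn_has_derivative_def)

text \<open>
  Both the path and its velocity are differentiable, hence continuous in \<open>H\<^sup>n\<close>, and the metric is locally
  Lipschitz in both arguments.
\<close>

lemma metric_norm_continuous:
  fixes p :: "real \<Rightarrow> real \<Rightarrow> real ^ 'd"
  assumes S: "smooth_piece p V S"
  shows "continuous_on S (\<lambda>t. metric_norm (p t) (V t))"
  unfolding metric_norm_def
proof (intro continuous_on_real_sqrt)
  show "continuous_on S (\<lambda>t. sobolev_metric a n (p t) (V t) (V t))"
    unfolding continuous_on_def
  proof
    fix t assume t: "t \<in> S"
    note pt = smooth_pieceD[OF S t]
    obtain V' where V': "Hn_has_derivative n V (V' t) t S" using S t by (auto simp: smooth_piece_def)
    obtain m where m: "m > 0" "\<forall>\<theta>. speed (p t) \<theta> \<ge> m" using Imm_min_speed[OF pt(1) order] by blast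
    define M where "M = Hn_norm n (p t) + Hn_norm n (V t) + 1"
    have m2: "m / 2 > 0" using m by simp
    obtain C where C: "C \<ge> 0" "\<And>(c1 :: real \<Rightarrow> real ^ 'd) c2 h1 h2 \<delta>. c1 \<in> Imm n \<Longrightarrow> c2 \<in> Imm n \<Longrightarrow> h1 \<in> Hn n \<Longrightarrow> h2 \<in> Hn n \<Longrightarrow>
    \<forall>\<theta>. speed c1 \<theta> \<ge> m / 2 \<Longrightarrow> \<forall>\<theta>. speed c2 \<theta> \<ge> m / 2 \<Longrightarrow> Hn_norm n c1 \<le> M \<Longrightarrow> Hn_norm n c2 \<le> M \<Longrightarrow>
    Hn_norm n h2 \<le> M \<Longrightarrow> Hn_norm n (\<lambda>x. c1 x - c2 x) \<le> \<delta> \<Longrightarrow> Hn_norm n (\<lambda>x. h1 x - h2 x) \<le> \<delta> \<Longrightarrow>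
    0 < \<delta> \<Longrightarrow> \<delta> \<le> 1 \<Longrightarrow> \<bar>sobolev_metric a n c1 h1 h1 - sobolev_metric a n c2 h2 h2\<bar> \<le> C * \<delta>"
      using metric_lipschitz[OF m2, of M] by blast
    show "((\<lambda>t. sobolev_metric a n (p t) (V t) (V t)) \<longlongrightarrow> sobolev_metric a n (p t) (V t) (V t)) (at t within S)"
    proof (rule tendstoI)
      fix e :: real assume "e > 0"
      define \<delta> where "\<delta> = min (min 1 (m / 4)) (e / (C + 1))"
      have "0 < e / (C + 1)" using \<open>e > 0\<close> C(1) by simp
      then have \<delta>: "0 < \<delta>" "\<delta> \<le> 1" "\<delta> \<le> m / 4" using m(1) unfolding \<delta>_def by linarith+
      have "C * \<delta> \<le> C * (e / (C + 1))" using C(1) by (intro mult_left_mono) (auto simp: \<delta>_def)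
      also have "\<dots> < e" using C(1) \<open>e > 0\<close> by (simp add: field_simps)
      finally have Ce: "C * \<delta> < e" .
      have "\<forall>\<^sub>F s in at t within S. s \<in> S" by (simp add: eventually_at_filter)
      then show "\<forall>\<^sub>F s in at t within S. dist (sobolev_metric a n (p s) (V s) (V s)) (sobolev_metric a n (p t) (V t) (V t)) < e"
        using eventually_Hn_norm_small[OF pt(4) t \<delta>(1)] eventually_Hn_norm_small[OF V' t \<delta>(1)]
      proof eventually_elim
        case (elim s)
        note ps = smooth_pieceD[OF S elim(1)]
        have sp: "speed (p s) \<theta> \<ge> m / 2" for \<theta>
          using speed_diff_le(2)[OF ps(2) pt(2), of \<theta>] elim(2) \<delta>(3) m(2)[rule_format, of \<theta>] by linarith
        have "Hn_norm n (p s) \<le> M"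
          using Hn_norm_triangle_diff[OF ps(2) pt(2) n1] elim(2) \<delta>(2) Hn_norm_nonneg[of n "V t"] by (simp add: M_def)
        moreover have "Hn_norm n (p t) \<le> M" "Hn_norm n (V t) \<le> M"
          using Hn_norm_nonneg[of n "V t"] Hn_norm_nonneg[of n "p t"] by (auto simp: M_def)
        moreover have "speed (p t) \<theta> \<ge> m / 2" for \<theta> using m(1) m(2)[rule_format, of \<theta>] by linarith
        ultimately have "\<bar>sobolev_metric a n (p s) (V s) (V s) - sobolev_metric a n (p t) (V t) (V t)\<bar> \<le> C * \<delta>"
          using elim(2,3) sp \<delta> ps pt by (intro C(2)) auto
        then show ?case using Ce by (simp add: dist_real_def)
      qed
    qed
  qed
qed

definition path_in :: "(real \<Rightarrow> real \<Rightarrow> real ^ 'd) \<Rightarrow> bool" where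
  "path_in p \<longleftrightarrow> piecewise_smooth_path n p \<and> (\<forall>t\<in>{0..1}. p t \<in> Imm n)"

text \<open>
  In the interior of a piece the velocity is unique, because limits in \<open>H\<^sup>n\<close> are; the two end points
  form a null set.
\<close>

lemma path_speed_integral:
  fixes p :: "real \<Rightarrow> real \<Rightarrow> real ^ 'd"
  assumes p: "path_in p" and piece: "smooth_piece p V {\<alpha>..\<beta>}" and sub: "{\<alpha>..\<beta>} \<subseteq> {0..1}" and st: "\<alpha> \<le> s" "s \<le> t" "t \<le> \<beta>"
  shows "((\<lambda>t. metric_norm (p t) (Hn_velocity n p t)) has_integral integral {s..t} (\<lambda>t. metric_norm (p t) (V t))) {s..t}"
proof (rule has_integral_spike_finite[of "{\<alpha>, \<beta>}"])
  show "((\<lambda>t. metric_norm (p t) (V t)) has_integral integral {s..t} (\<lambda>t. metric_norm (p t) (V t))) {s..t}"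
    using metric_norm_continuous[OF piece] st
    by (intro integrable_integral integrable_continuous_interval) (auto intro: continuous_on_subset)
  fix x assume x: "x \<in> {s..t} - {\<alpha>, \<beta>}"
  then have int: "x \<in> interior {\<alpha>..\<beta>}" using st by auto
  have x01: "x \<in> {0..1}" using x st sub by auto
  have pH: "p s \<in> Hn n" if "s \<in> {0..1}" for s
    using p that by (intro Imm_Hn) (simp add: path_in_def)
  have "Hn_has_derivative n p (V x) x {\<alpha>..\<beta>}" using x st by (intro smooth_pieceD[OF piece]) auto
  then have V: "Hn_has_derivative n p (V x) x {0..1}"
    by (rule Hn_has_derivative_interior[where p = p, OF _ int sub pH])
  then have "Hn_has_derivative n p (Hn_velocity n p x) x {0..1}"
    unfolding Hn_velocity_def by (rule someI[where P = "\<lambda>v. Hn_has_derivative n p v x {0..1}"])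
  moreover have "at x within {0..1} \<noteq> bot" using x01 by (simp add: trivial_limit_within)
  ultimately have "Hn_velocity n p x = V x" using Hn_derivative_unique[OF n1 _ V x01] by blast
  then show "metric_norm (p x) (Hn_velocity n p x) = metric_norm (p x) (V x)" by simp
qed simp

text \<open>
  On each piece the mean value inequality applies, and the estimates add up over the pieces.  The
  induction also carries the integrability of the speed of the path.
\<close>

lemma path_estimate:
  fixes p :: "real \<Rightarrow> real \<Rightarrow> real ^ 'd"
  assumes p: "path_in p" and K: "K \<ge> 0"
    and f: "\<And>V S. S \<subseteq> {0..1} \<Longrightarrow> smooth_piece p V S \<Longrightarrow> loc_lip f (\<lambda>t. K * metric_norm (p t) (V t)) S"
    and t: "t \<in> {0..1}"
  shows "\<bar>f t - f 0\<bar> \<le> K * path_len a n p"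
proof -
  define F where "F = (\<lambda>t. metric_norm (p t) (Hn_velocity n p t))"
  obtain m \<tau> where \<tau>: "\<tau> 0 = 0" "\<tau> m = 1" "\<And>i. i < m \<Longrightarrow> \<tau> i < \<tau> (Suc i)"
      "\<And>i. i < m \<Longrightarrow> Hn_smooth_on n p {\<tau> i..\<tau> (Suc i)}"
    using p by (auto simp: path_in_def piecewise_smooth_path_def)
  have \<tau>_mono: "\<tau> i \<le> \<tau> j" if "i \<le> j" "j \<le> m" for i j
    using that
  proof (induction j)
    case (Suc j)
    then show ?case using \<tau>(3)[of j] by (cases "i = Suc j") auto
  qed simp
  have step: "F integrable_on {s..t} \<and> \<bar>f t - f s\<bar> \<le> K * integral {s..t} F \<and> integral {s..t} F \<ge> 0"
    if i: "i < m" and st: "\<tau> i \<le> s" "s \<le> t" "t \<le> \<tau> (Suc i)" for i s t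
  proof -
    have sub: "{\<tau> i..\<tau> (Suc i)} \<subseteq> {0..1}" using \<tau>_mono[of 0 i] \<tau>_mono[of "Suc i" m] i \<tau>(1,2) by auto
    obtain D where D: "D 0 = p" "\<And>k t. t \<in> {\<tau> i..\<tau> (Suc i)} \<Longrightarrow> Hn_has_derivative n (D k) (D (Suc k) t) t {\<tau> i..\<tau> (Suc i)}"
      using \<tau>(4)[OF i] unfolding Hn_smooth_on_def by blast
    have piece: "smooth_piece p (D 1) {\<tau> i..\<tau> (Suc i)}"
      unfolding smooth_piece_def
    proof (intro conjI ballI exI[of _ "D 2"])
      fix t assume t: "t \<in> {\<tau> i..\<tau> (Suc i)}"
      show "p t \<in> Imm n" using p sub t by (auto simp: path_in_def)
      show "Hn_has_derivative n p (D 1 t) t {\<tau> i..\<tau> (Suc i)}" using D(2)[OF t, of 0] D(1) by simp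
      show "Hn_has_derivative n (D 1) (D 2 t) t {\<tau> i..\<tau> (Suc i)}"
        using D(2)[OF t, of 1] by (simp only: Suc_1)
    qed
    have int: "(F has_integral integral {s..t} (\<lambda>t. metric_norm (p t) (D 1 t))) {s..t}"
      unfolding F_def by (rule path_speed_integral[OF p piece sub st])
    have subst: "{s..t} \<subseteq> {\<tau> i..\<tau> (Suc i)}" using st by auto
    have cont: "continuous_on {s..t} (\<lambda>t. metric_norm (p t) (D 1 t))"
      using metric_norm_continuous[OF piece] subst continuous_on_subset by blast
    have "\<bar>f t - f s\<bar> \<le> integral {s..t} (\<lambda>t. K * metric_norm (p t) (D 1 t))"
      using loc_lip_subset[OF f[OF sub piece] subst] cont st by (intro loc_lip_integral continuous_intros)
    moreover have "integral {s..t} (\<lambda>t. metric_norm (p t) (D 1 t)) \<ge> 0"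
      using smooth_pieceD[OF piece] subst cont
      by (intro Henstock_Kurzweil_Integration.integral_nonneg integrable_continuous_interval) (auto intro: metric_norm_nonneg)
    ultimately show ?thesis using int by (simp add: has_integral_iff)
  qed
  have all: "i \<le> m \<Longrightarrow> \<forall>t\<in>{0..\<tau> i}. F integrable_on {0..t} \<and> \<bar>f t - f 0\<bar> \<le> K * integral {0..t} F \<and>
      F integrable_on {t..\<tau> i} \<and> integral {t..\<tau> i} F \<ge> 0" for i
  proof (induction i)
    case 0
    have "F integrable_on {0..0}" using integrable_on_refl[of F 0] by simp
    then show ?case using \<tau>(1) by auto
  next
    case (Suc i)
    have i: "i < m" using Suc.prems by simp
    have \<tau>0: "0 \<le> \<tau> i" using \<tau>_mono[of 0 i] \<tau>(1) i by simp
    have IH: "F integrable_on {0..t}" "\<bar>f t - f 0\<bar> \<le> K * integral {0..t} F"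
      "F integrable_on {t..\<tau> i}" "integral {t..\<tau> i} F \<ge> 0" if "0 \<le> t" "t \<le> \<tau> i" for t
      using Suc.IH[rule_format, of t] i that by simp_all
    show ?case
    proof
      fix t assume t: "t \<in> {0..\<tau> (Suc i)}"
      show "F integrable_on {0..t} \<and> \<bar>f t - f 0\<bar> \<le> K * integral {0..t} F \<and>
        F integrable_on {t..\<tau> (Suc i)} \<and> integral {t..\<tau> (Suc i)} F \<ge> 0"
      proof (cases "t \<le> \<tau> i")
        case True
        have t0: "0 \<le> t" using t by simp
        have s: "F integrable_on {\<tau> i..\<tau> (Suc i)}" "integral {\<tau> i..\<tau> (Suc i)} F \<ge> 0"
          using step[OF i, of "\<tau> i" "\<tau> (Suc i)"] less_imp_le[OF \<tau>(3)[OF i]] by simp_all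
        have c: "F integrable_on {t..\<tau> (Suc i)}"
          by (rule Henstock_Kurzweil_Integration.integrable_combine[OF True less_imp_le[OF \<tau>(3)[OF i]] IH(3)[OF t0 True] s(1)])
        have "integral {t..\<tau> i} F + integral {\<tau> i..\<tau> (Suc i)} F = integral {t..\<tau> (Suc i)} F"
          using c True \<tau>(3)[OF i] by (intro Henstock_Kurzweil_Integration.integral_combine) auto
        then show ?thesis using IH[OF t0 True] c s by simp
      next
        case False
        have s: "F integrable_on {\<tau> i..t}" "\<bar>f t - f (\<tau> i)\<bar> \<le> K * integral {\<tau> i..t} F"
          using step[OF i, of "\<tau> i" t] False t by simp_all
        have s2: "F integrable_on {t..\<tau> (Suc i)}" "integral {t..\<tau> (Suc i)} F \<ge> 0"
          using step[OF i, of t "\<tau> (Suc i)"] False t by simp_all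
        have c: "F integrable_on {0..t}"
          by (rule Henstock_Kurzweil_Integration.integrable_combine[OF \<tau>0 _ IH(1)[OF \<tau>0 order_refl] s(1)]) (use False in simp)
        have "integral {0..\<tau> i} F + integral {\<tau> i..t} F = integral {0..t} F"
          using c False \<tau>0 by (intro Henstock_Kurzweil_Integration.integral_combine) auto
        then have "K * integral {0..t} F = K * integral {0..\<tau> i} F + K * integral {\<tau> i..t} F"
          by (simp flip: distrib_left)
        then have "\<bar>f t - f 0\<bar> \<le> K * integral {0..t} F"
          using IH(2)[OF \<tau>0 order_refl] s(2) by linarith
        then show ?thesis using c s2 by simp
      qed
    qed
  qed
  have A: "F integrable_on {0..t}" "\<bar>f t - f 0\<bar> \<le> K * integral {0..t} F" "F integrable_on {t..1}" "integral {t..1} F \<ge> 0"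
    "F integrable_on {0..1}"
    using all[of m] t \<tau>(2) by auto
  have "integral {0..t} F + integral {t..1} F = integral {0..1} F"
    using A(5) t by (intro Henstock_Kurzweil_Integration.integral_combine) auto
  then have "integral {0..t} F \<le> integral {0..1} F" using A(4) by linarith
  then have "K * integral {0..t} F \<le> K * integral {0..1} F" using K by (rule mult_left_mono)
  moreover have "path_len a n p = integral {0..1} F" by (simp add: path_len_def F_def metric_norm_def)
  ultimately show ?thesis using A(2) by simp
qed

end

section \<open>A priori bounds along paths of bounded length\<close>

context sobolev_coefficients
begin

lemma loc_lip_functional:
  fixes p :: "real \<Rightarrow> real \<Rightarrow> real ^ 'd" and N :: "(real \<Rightarrow> real ^ 'd) \<Rightarrow> real"
  assumes S: "smooth_piece p V S"
    and add: "\<And>f g. f \<in> Hn n \<Longrightarrow> g \<in> Hn n \<Longrightarrow> N (\<lambda>x. f x + g x) \<le> N f + N g"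
    and scale: "\<And>f c. f \<in> Hn n \<Longrightarrow> N (\<lambda>x. c *\<^sub>R f x) = \<bar>c\<bar> * N f"
    and le: "\<And>f. f \<in> Hn n \<Longrightarrow> N f \<le> C * Hn_norm n f" and C: "C > 0"
    and b: "\<And>t. t \<in> S \<Longrightarrow> N (V t) \<le> b t"
    and f: "\<And>s t. s \<in> S \<Longrightarrow> t \<in> S \<Longrightarrow> \<bar>f s - f t\<bar> \<le> N (\<lambda>x. p s x - p t x)"
  shows "loc_lip f b S"
  unfolding loc_lip_def
proof (intro ballI allI impI)
  fix t and \<epsilon> :: real assume t: "t \<in> S" and \<epsilon>: "\<epsilon> > 0"
  have "\<forall>\<^sub>F s in at t within S. N (\<lambda>x. p s x - p t x) \<le> (N (V t) + \<epsilon>) * \<bar>s - t\<bar>"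
    by (rule Hn_has_derivative_functional[OF n1 smooth_pieceD(4)[OF S t] t \<epsilon> add scale le C])
  moreover have "\<forall>\<^sub>F s in at t within S. s \<in> S" by (simp add: eventually_at_filter)
  ultimately show "\<forall>\<^sub>F s in at t within S. \<bar>f s - f t\<bar> \<le> (b t + \<epsilon>) * \<bar>s - t\<bar>"
  proof eventually_elim
    case (elim s)
    have "\<bar>f s - f t\<bar> \<le> (N (V t) + \<epsilon>) * \<bar>s - t\<bar>" using f[OF elim(2) t] elim(1) by linarith
    also have "\<dots> \<le> (b t + \<epsilon>) * \<bar>s - t\<bar>" using b[OF t] by (intro mult_right_mono) auto
    finally show ?case .
  qed
qed

lemma loc_lip_Hn_norm:
  fixes p :: "real \<Rightarrow> real \<Rightarrow> real ^ 'd"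
  assumes S: "smooth_piece p V S" and k: "1 \<le> k" "k \<le> n"
    and b: "\<And>t. t \<in> S \<Longrightarrow> Hn_norm k (V t) \<le> b t"
    and f: "\<And>s t. s \<in> S \<Longrightarrow> t \<in> S \<Longrightarrow> \<bar>f s - f t\<bar> \<le> Hn_norm k (\<lambda>x. p s x - p t x)"
  shows "loc_lip f b S"
proof (rule loc_lip_functional[OF S, where N = "Hn_norm k" and C = 8])
  fix f g :: "real \<Rightarrow> real ^ 'd" and c :: real
  assume fH: "f \<in> Hn n"
  have fk: "f \<in> Hn k" using Hn_le[OF fH k] .
  show "Hn_norm k (\<lambda>x. c *\<^sub>R f x) = \<bar>c\<bar> * Hn_norm k f" using Hn_norm_scaleR[OF fk k(1)] .
  show "Hn_norm k f \<le> 8 * Hn_norm n f" using Hn_norm_mono[OF fH k] .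
  assume "g \<in> Hn n"
  then show "Hn_norm k (\<lambda>x. f x + g x) \<le> Hn_norm k f + Hn_norm k g"
    using Hn_norm_triangle[OF fk Hn_le[OF _ k] k(1)] by blast
qed (use b f in auto)

lemma loc_lip_speed:
  fixes p :: "real \<Rightarrow> real \<Rightarrow> real ^ 'd"
  assumes S: "smooth_piece p V S"
  shows "loc_lip (\<lambda>t. speed (p t) \<theta>) (\<lambda>t. speed (p t) \<theta> * (sup_const * metric_norm (p t) (V t))) S"
proof (rule loc_lip_functional[OF S, where N = "\<lambda>f. norm (tangent f \<theta>)" and C = 2])
  fix f g :: "real \<Rightarrow> real ^ 'd" and c :: real
  assume fH: "f \<in> Hn n"
  note f = Hn_has_tangent[OF fH order, of \<theta>]
  have "((\<lambda>x. c *\<^sub>R f x) has_vector_derivative c *\<^sub>R tangent f \<theta>) (at \<theta>)"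
    using bounded_linear.has_vector_derivative[OF bounded_linear_scaleR_right f] .
  then show "norm (tangent (\<lambda>x. c *\<^sub>R f x) \<theta>) = \<bar>c\<bar> * norm (tangent f \<theta>)"
    by (simp add: vector_derivative_at)
  show "norm (tangent f \<theta>) \<le> 2 * Hn_norm n f"
    using sob_tangent(2)[OF fH order] .
  assume "g \<in> Hn n"
  note g = Hn_has_tangent[OF this order, of \<theta>]
  show "norm (tangent (\<lambda>x. f x + g x) \<theta>) \<le> norm (tangent f \<theta>) + norm (tangent g \<theta>)"
    using vector_derivative_at[OF has_vector_derivative_add[OF f g]] norm_triangle_ineq by metis
next
  fix t assume t: "t \<in> S"
  show "norm (tangent (V t) \<theta>) \<le> speed (p t) \<theta> * (sup_const * metric_norm (p t) (V t))"
    using velocity_sup[OF smooth_pieceD(1,3)[OF S t]] by (simp add: metric_norm_def)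
  fix s assume s: "s \<in> S"
  show "\<bar>speed (p s) \<theta> - speed (p t) \<theta>\<bar> \<le> norm (tangent (\<lambda>x. p s x - p t x) \<theta>)"
    using speed_diff_le(1) smooth_pieceD(2)[OF S s] smooth_pieceD(2)[OF S t] .
qed simp

lemma path_len_nonneg:
  fixes p :: "real \<Rightarrow> real \<Rightarrow> real ^ 'd"
  assumes p: "path_in p" shows "path_len a n p \<ge> 0"
proof -
  have "\<bar>0 - 0 :: real\<bar> \<le> 1 * path_len a n p"
  proof (rule path_estimate[OF p, of 1 "\<lambda>_. 0" 0])
    fix V S assume "S \<subseteq> {0..1}" and S: "smooth_piece p V S"
    show "loc_lip (\<lambda>_. 0) (\<lambda>t. 1 * metric_norm (p t) (V t)) S"
      unfolding loc_lip_def using metric_norm_nonneg[OF smooth_pieceD(1,3)[OF S]]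
      by (auto intro!: always_eventually mult_nonneg_nonneg add_nonneg_nonneg simp: less_imp_le)
  qed auto
  then show ?thesis by simp
qed

text \<open>
  The rate of change of \<open>ln (speed (p t) \<theta>)\<close> is at most \<open>\<bar>D\<^sub>s h\<bar>\<close> for the velocity \<open>h\<close>, which \<open>velocity_sup\<close>
  bounds by a constant times the metric norm of \<open>h\<close>.
\<close>

lemma path_log_speed:
  fixes p :: "real \<Rightarrow> real \<Rightarrow> real ^ 'd"
  assumes p: "path_in p" and t: "t \<in> {0..1}"
  shows "\<bar>ln (speed (p t) \<theta>) - ln (speed (p 0) \<theta>)\<bar> \<le> sup_const * path_len a n p"
proof (rule path_estimate[OF p _ _ t])
  fix V S assume "S \<subseteq> {0..1}" and S: "smooth_piece p V S"
  show "loc_lip (\<lambda>t. ln (speed (p t) \<theta>)) (\<lambda>t. sup_const * metric_norm (p t) (V t)) S"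
  proof (rule loc_lip_ln[OF loc_lip_speed[OF S]])
    fix t assume t: "t \<in> S"
    show "speed (p t) \<theta> > 0" using Imm_weight[OF smooth_pieceD(1)[OF S t] order] by (simp add: weight_def)
    show "sup_const * metric_norm (p t) (V t) \<ge> 0"
      using metric_norm_nonneg[OF smooth_pieceD(1,3)[OF S t]] sup_const_pos by simp
  qed
qed (use sup_const_pos in simp)

lemma path_speed_bounds:
  fixes p :: "real \<Rightarrow> real \<Rightarrow> real ^ 'd"
  assumes p: "path_in p" and t: "t \<in> {0..1}" and R: "path_len a n p \<le> R"
  shows "speed (p 0) \<theta> * exp (- (sup_const * R)) \<le> speed (p t) \<theta>"
    "speed (p t) \<theta> \<le> speed (p 0) \<theta> * exp (sup_const * R)"
proof -
  have pos: "speed (p t) \<theta> > 0" if "t \<in> {0..1}" for t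
    using Imm_weight[of "p t" n] order p that by (simp add: path_in_def weight_def)
  have "sup_const * path_len a n p \<le> sup_const * R" using R sup_const_pos by (intro mult_left_mono) auto
  with path_log_speed[OF p t, of \<theta>]
  have "\<bar>ln (speed (p t) \<theta>) - ln (speed (p 0) \<theta>)\<bar> \<le> sup_const * R" by linarith
  then have "ln (speed (p 0) \<theta>) - sup_const * R \<le> ln (speed (p t) \<theta>)" "ln (speed (p t) \<theta>) \<le> ln (speed (p 0) \<theta>) + sup_const * R"
    by (auto simp: abs_le_iff)
  then have "exp (ln (speed (p 0) \<theta>) + - (sup_const * R)) \<le> exp (ln (speed (p t) \<theta>))"
    "exp (ln (speed (p t) \<theta>)) \<le> exp (ln (speed (p 0) \<theta>) + sup_const * R)"
    by auto
  then show "speed (p 0) \<theta> * exp (- (sup_const * R)) \<le> speed (p t) \<theta>"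
    "speed (p t) \<theta> \<le> speed (p 0) \<theta> * exp (sup_const * R)"
    using pos[OF t] pos[of 0] by (simp_all only: exp_add exp_ln atLeastAtMost_iff order_refl zero_le_one)
qed

definition controlled_path :: "real \<Rightarrow> real \<Rightarrow> real \<Rightarrow> (real \<Rightarrow> real \<Rightarrow> real ^ 'd) \<Rightarrow> bool" where
  "controlled_path m M R p \<longleftrightarrow> path_in p \<and> (\<forall>\<theta>. speed (p 0) \<theta> \<ge> m) \<and> Hn_norm n (p 0) \<le> M \<and> path_len a n p \<le> R"

lemma controlled_pathD:
  assumes "controlled_path m M R p"
  shows "path_in p" "\<And>\<theta>. speed (p 0) \<theta> \<ge> m" "Hn_norm n (p 0) \<le> M" "path_len a n p \<le> R"
    "t \<in> {0..1} \<Longrightarrow> p t \<in> Imm n" "t \<in> {0..1} \<Longrightarrow> p t \<in> Hn n"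
proof -
  show Imm: "p t \<in> Imm n" if "t \<in> {0..1}" using assms that by (simp add: controlled_path_def path_in_def)
  show "p t \<in> Hn n" if "t \<in> {0..1}" using Imm_Hn[OF Imm[OF that]] .
qed (use assms in \<open>auto simp: controlled_path_def\<close>)

lemma controlled_path_speed:
  fixes p :: "real \<Rightarrow> real \<Rightarrow> real ^ 'd"
  assumes p: "controlled_path m M R p" and t: "t \<in> {0..1}"
  shows "m * exp (- (sup_const * R)) \<le> speed (p t) \<theta>" "speed (p t) \<theta> \<le> 2 * M * exp (sup_const * R)"
proof -
  note pD = controlled_pathD[OF p]
  have "m * exp (- (sup_const * R)) \<le> speed (p 0) \<theta> * exp (- (sup_const * R))"
    using pD(2) by (intro mult_right_mono) auto
  also have "\<dots> \<le> speed (p t) \<theta>" by (rule path_speed_bounds(1)[OF pD(1) t pD(4)])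
  finally show "m * exp (- (sup_const * R)) \<le> speed (p t) \<theta>" .
  have "speed (p t) \<theta> \<le> speed (p 0) \<theta> * exp (sup_const * R)" by (rule path_speed_bounds(2)[OF pD(1) t pD(4)])
  also have "\<dots> \<le> 2 * M * exp (sup_const * R)"
    using sob_tangent(2)[OF pD(6)[of 0] order, of \<theta>] pD(3)
    by (intro mult_right_mono) (auto simp: speed_def)
  finally show "speed (p t) \<theta> \<le> 2 * M * exp (sup_const * R)" .
qed

text \<open>
  By \<open>Hn_norm_velocity_stage\<close> the rate of change of \<open>ln (1 + \<parallel>p t\<parallel>\<^bsub>k+2\<^esub>)\<close> is at most \<open>C\<close> times the metric norm of
  the velocity.
\<close>

lemma Hn_norm_path_step:
  assumes m: "m > 0" and k: "Suc (Suc k) \<le> n" and B: "B \<ge> 0"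
    and mul: "\<forall>(p :: real \<Rightarrow> real \<Rightarrow> real ^ 'd) t. controlled_path m M R p \<longrightarrow> t \<in> {0..1} \<longrightarrow>
        mul k B (tangent (p t))"
  shows "\<exists>Q\<ge>0. \<forall>(p :: real \<Rightarrow> real \<Rightarrow> real ^ 'd) t. controlled_path m M R p \<longrightarrow> t \<in> {0..1} \<longrightarrow>
    Hn_norm (Suc (Suc k)) (p t) \<le> Q"
proof -
  let ?k = "Suc (Suc k)"
  define m1 where "m1 = m * exp (- (sup_const * R))"
  have m1: "m1 > 0" using m by (simp add: m1_def)
  obtain C where C: "C \<ge> 0" "\<And>c h :: real \<Rightarrow> real ^ 'd. c \<in> Imm n \<Longrightarrow> h \<in> Hn n \<Longrightarrow> \<forall>\<theta>. speed c \<theta> \<ge> m1 \<Longrightarrow>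
    mul k B (tangent c) \<Longrightarrow>
    Hn_norm ?k h \<le> C * (1 + Hn_norm ?k c) * sqrt (sobolev_metric a n c h h)"
    using Hn_norm_velocity_stage[OF m1 B k] by blast
  define Q where "Q = (1 + 8 * \<bar>M\<bar>) * exp (C * R)"
  have "Hn_norm ?k (p t) \<le> Q" if p: "controlled_path m M R p" and t: "t \<in> {0..1}"
    for p :: "real \<Rightarrow> real \<Rightarrow> real ^ 'd" and t
  proof -
    note pD = controlled_pathD[OF p]
    let ?\<phi> = "\<lambda>t. 1 + Hn_norm ?k (p t)"
    have pos: "?\<phi> t > 0" for t using Hn_norm_nonneg[of ?k "p t"] by linarith
    have "\<bar>ln (?\<phi> t) - ln (?\<phi> 0)\<bar> \<le> C * path_len a n p"
    proof (rule path_estimate[OF pD(1) C(1) _ t])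
      fix V S assume sub: "S \<subseteq> {0..1}" and S: "smooth_piece p V S"
      show "loc_lip (\<lambda>t. ln (?\<phi> t)) (\<lambda>t. C * metric_norm (p t) (V t)) S"
      proof (rule loc_lip_ln)
        show "loc_lip ?\<phi> (\<lambda>t. ?\<phi> t * (C * metric_norm (p t) (V t))) S"
        proof (rule loc_lip_Hn_norm[OF S _ k])
          fix t assume t: "t \<in> S"
          note pt = smooth_pieceD[OF S t]
          have t01: "t \<in> {0..1}" using t sub by blast
          have "\<forall>\<theta>. speed (p t) \<theta> \<ge> m1" using controlled_path_speed(1)[OF p t01] by (simp add: m1_def)
          from C(2)[OF pt(1,3) this mul[rule_format, OF p t01]]
          show "Hn_norm ?k (V t) \<le> ?\<phi> t * (C * metric_norm (p t) (V t))"
            by (simp add: metric_norm_def mult_ac)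
          fix s assume s: "s \<in> S"
          show "\<bar>?\<phi> s - ?\<phi> t\<bar> \<le> Hn_norm ?k (\<lambda>x. p s x - p t x)"
            using Hn_norm_triangle_diff[OF Hn_le[OF smooth_pieceD(2)[OF S s] _ k] Hn_le[OF pt(2) _ k]] by simp
        qed simp
        show "C * metric_norm (p t) (V t) \<ge> 0" if "t \<in> S" for t
          using metric_norm_nonneg[OF smooth_pieceD(1,3)[OF S that]] C(1) by simp
      qed (rule pos)
    qed
    moreover have "C * path_len a n p \<le> C * R" using pD(4) C(1) by (rule mult_left_mono)
    ultimately have "ln (?\<phi> t) \<le> ln (?\<phi> 0) + C * R" by linarith
    then have "exp (ln (?\<phi> t)) \<le> exp (ln (?\<phi> 0) + C * R)" by simp
    then have "?\<phi> t \<le> ?\<phi> 0 * exp (C * R)" using pos by (simp only: exp_add exp_ln)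
    also have "\<dots> \<le> Q"
    proof -
      have "Hn_norm ?k (p 0) \<le> 8 * Hn_norm n (p 0)" using Hn_norm_mono[OF pD(6) _ k] by simp
      then show ?thesis unfolding Q_def using pD(3) by (intro mult_right_mono) auto
    qed
    finally show ?thesis by simp
  qed
  moreover have "Q \<ge> 0" by (simp add: Q_def)
  ultimately show ?thesis by blast
qed

text \<open>
  The induction alternates with \<open>Hn_norm_path_step\<close>: tangents bounded as multipliers of order \<open>k\<close> bound the
  curves in \<open>H\<^bsup>k+2\<^esup>\<close>, hence the tangents in \<open>H\<^bsup>k+1\<^esup>\<close>.  It starts from the bounds on the speed.
\<close>

lemma controlled_path_multiplier:
  assumes m: "m > 0"
  shows "Suc (Suc k) \<le> n \<Longrightarrow> \<exists>B\<ge>0. \<forall>(p :: real \<Rightarrow> real \<Rightarrow> real ^ 'd) t. controlled_path m M R p \<longrightarrow> t \<in> {0..1} \<longrightarrow>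
    mul k B (tangent (p t))"
proof (induction k)
  case 0
  have "mul 0 (2 * \<bar>M\<bar> * exp (sup_const * R)) (tangent (p t))"
    if p: "controlled_path m M R p" and t: "t \<in> {0..1}" for p :: "real \<Rightarrow> real \<Rightarrow> real ^ 'd" and t
  proof -
    have "sob (n - 1) (2 * Hn_norm n (p t)) (tangent (p t))"
      using sob_tangent(1)[OF controlled_pathD(6)[OF p t] order] .
    then have "mul 0 (2 * Hn_norm n (p t)) (tangent (p t))"
      using n1_pos by (intro sob_mul) auto
    moreover have "norm (tangent (p t) \<theta>) \<le> 2 * \<bar>M\<bar> * exp (sup_const * R)" for \<theta>
    proof -
      have "norm (tangent (p t) \<theta>) \<le> 2 * M * exp (sup_const * R)"
        using controlled_path_speed(2)[OF p t, of \<theta>] by (simp add: speed_def)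
      also have "\<dots> \<le> 2 * \<bar>M\<bar> * exp (sup_const * R)" by (intro mult_right_mono) auto
      finally show ?thesis .
    qed
    ultimately show ?thesis by (simp add: mul_0)
  qed
  then show ?case by (intro exI[of _ "2 * \<bar>M\<bar> * exp (sup_const * R)"]) auto
next
  case (Suc k)
  then have k: "Suc (Suc k) \<le> n" by simp
  obtain B where B: "B \<ge> 0" "\<forall>(p :: real \<Rightarrow> real \<Rightarrow> real ^ 'd) t. controlled_path m M R p \<longrightarrow> t \<in> {0..1} \<longrightarrow>
        mul k B (tangent (p t))"
    using Suc.IH[OF k] by blast
  from Hn_norm_path_step[OF m k B]
  obtain Q where Q: "Q \<ge> 0" "\<And>(p :: real \<Rightarrow> real \<Rightarrow> real ^ 'd) t. controlled_path m M R p \<Longrightarrow> t \<in> {0..1} \<Longrightarrow>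
    Hn_norm (Suc (Suc k)) (p t) \<le> Q" by blast
  have "mul (Suc k) (2 * Q) (tangent (p t))"
    if p: "controlled_path m M R p" and t: "t \<in> {0..1}" for p :: "real \<Rightarrow> real \<Rightarrow> real ^ 'd" and t
  proof -
    have "p t \<in> Hn (Suc (Suc k))" using Hn_le[OF controlled_pathD(6)[OF p t] _ k] by simp
    then have "sob (Suc k) (2 * Hn_norm (Suc (Suc k)) (p t)) (tangent (p t))"
      using sob_tangent(1)[of "p t" "Suc (Suc k)"] by (simp del: sob.simps)
    then show ?thesis unfolding mul_Suc by (rule sob_mono) (use Q(2)[OF p t] in simp)
  qed
  then show ?case using Q(1) by (intro exI[of _ "2 * Q"]) auto
qed

lemma controlled_path_estimate:
  assumes m: "m > 0"
  shows "\<exists>m'>0. \<exists>M'\<ge>0. \<exists>C>0. \<forall>p :: real \<Rightarrow> real \<Rightarrow> real ^ 'd. controlled_path m M R p \<longrightarrow>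
    (\<forall>\<theta>. speed (p 1) \<theta> \<ge> m') \<and> Hn_norm n (p 1) \<le> M' \<and> Hn_norm n (\<lambda>x. p 1 x - p 0 x) \<le> C * path_len a n p"
proof -
  obtain k where k: "n = Suc (Suc k)" using order by (metis Suc_le_D numeral_2_eq_2 Suc_le_mono)
  have kn: "Suc (Suc k) \<le> n" using k by simp
  define m1 where "m1 = m * exp (- (sup_const * R))"
  have m1: "m1 > 0" using m by (simp add: m1_def)
  obtain B where B: "B \<ge> 0" "\<forall>(p :: real \<Rightarrow> real \<Rightarrow> real ^ 'd) t. controlled_path m M R p \<longrightarrow> t \<in> {0..1} \<longrightarrow>
        mul k B (tangent (p t))"
    using controlled_path_multiplier[OF m kn] by blast
  from Hn_norm_path_step[OF m kn B]
  obtain Q where Q: "Q \<ge> 0" "\<And>(p :: real \<Rightarrow> real \<Rightarrow> real ^ 'd) t. controlled_path m M R p \<Longrightarrow> t \<in> {0..1} \<Longrightarrow>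
    Hn_norm n (p t) \<le> Q" unfolding k by blast
  obtain C where C: "C \<ge> 0" "\<And>c h :: real \<Rightarrow> real ^ 'd. c \<in> Imm n \<Longrightarrow> h \<in> Hn n \<Longrightarrow> \<forall>\<theta>. speed c \<theta> \<ge> m1 \<Longrightarrow>
    mul k B (tangent c) \<Longrightarrow>
    Hn_norm n h \<le> C * (1 + Hn_norm n c) * sqrt (sobolev_metric a n c h h)"
    using Hn_norm_velocity_stage[OF m1 B(1) kn] unfolding k by blast
  \<comment> \<open>the summand 1 only serves to make the constant positive\<close>
  define K where "K = C * (1 + Q) + 1"
  have K: "K > 0" using C(1) Q(1) by (simp add: K_def add_nonneg_pos)
  have "Hn_norm n (\<lambda>x. p 1 x - p 0 x) \<le> K * path_len a n p"
    if p: "controlled_path m M R p" for p :: "real \<Rightarrow> real \<Rightarrow> real ^ 'd"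
  proof -
    note pD = controlled_pathD[OF p]
    define f where "f t = Hn_norm n (\<lambda>x. p t x - p 0 x)" for t
    have "\<bar>f 1 - f 0\<bar> \<le> K * path_len a n p"
    proof (rule path_estimate[OF pD(1)])
      fix V S assume sub: "S \<subseteq> {0..1}" and S: "smooth_piece p V S"
      show "loc_lip f (\<lambda>t. K * metric_norm (p t) (V t)) S"
      proof (rule loc_lip_Hn_norm[OF S n1 order_refl])
        fix t assume t: "t \<in> S"
        note pt = smooth_pieceD[OF S t]
        have t01: "t \<in> {0..1}" using t sub by blast
        have nn: "metric_norm (p t) (V t) \<ge> 0" using metric_norm_nonneg[OF pt(1,3)] .
        have "\<forall>\<theta>. speed (p t) \<theta> \<ge> m1" using controlled_path_speed(1)[OF p t01] by (simp add: m1_def)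
        from C(2)[OF pt(1,3) this B(2)[rule_format, OF p t01]]
        have "Hn_norm n (V t) \<le> C * (1 + Hn_norm n (p t)) * metric_norm (p t) (V t)"
          by (simp add: metric_norm_def)
        also have "\<dots> \<le> K * metric_norm (p t) (V t)"
        proof (rule mult_right_mono[OF _ nn])
          have "C * (1 + Hn_norm n (p t)) \<le> C * (1 + Q)" using Q(2)[OF p t01] C(1) by (intro mult_left_mono) auto
          then show "C * (1 + Hn_norm n (p t)) \<le> K" by (simp add: K_def)
        qed
        finally show "Hn_norm n (V t) \<le> K * metric_norm (p t) (V t)" .
        fix s assume s: "s \<in> S"
        have p0: "p 0 \<in> Hn n" using pD(6)[of 0] by simp
        have "\<bar>f s - f t\<bar> \<le> Hn_norm n (\<lambda>x. (p s x - p 0 x) - (p t x - p 0 x))"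
          unfolding f_def by (intro Hn_norm_triangle_diff Hn_diff smooth_pieceD(2)[OF S] s t p0 n1)
        then show "\<bar>f s - f t\<bar> \<le> Hn_norm n (\<lambda>x. p s x - p t x)" by simp
      qed
    qed (use K in auto)
    moreover have "f 0 = 0" using Hn_norm_zero[OF n1] by (simp add: f_def)
    ultimately show ?thesis by (simp add: f_def)
  qed
  moreover have "m1 \<le> speed (p 1) \<theta>" if "controlled_path m M R p" for p :: "real \<Rightarrow> real \<Rightarrow> real ^ 'd" and \<theta>
    using controlled_path_speed(1)[OF that, of 1] by (simp add: m1_def)
  moreover have "Hn_norm n (p 1) \<le> Q" if "controlled_path m M R p" for p :: "real \<Rightarrow> real \<Rightarrow> real ^ 'd"
    using Q(2)[OF that, of 1] by simp
  ultimately show ?thesis using m1 Q(1) K by (intro exI[of _ m1] exI[of _ Q] exI[of _ K] conjI allI impI) auto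
qed

section \<open>Comparison of the geodesic distance with the norm\<close>

lemma geod_dist_le:
  assumes "path_in p" shows "geod_dist a n (p 0) (p 1) \<le> ereal (path_len a n p)"
  unfolding geod_dist_def using assms by (intro Inf_lower) (auto simp: path_in_def)

lemma geod_dist_lessE:
  fixes c1 c2 :: "real \<Rightarrow> real ^ 'd"
  assumes "geod_dist a n c1 c2 < ereal r"
  obtains p where "path_in p" "p 0 = c1" "p 1 = c2" "path_len a n p < r"
  using assms unfolding geod_dist_def Inf_less_iff by (auto simp: path_in_def)

lemma geod_dist_ge:
  fixes c1 c2 :: "real \<Rightarrow> real ^ 'd"
  assumes "\<And>p. path_in p \<Longrightarrow> p 0 = c1 \<Longrightarrow> p 1 = c2 \<Longrightarrow> r \<le> path_len a n p"
  shows "ereal r \<le> geod_dist a n c1 c2"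
  unfolding geod_dist_def using assms by (intro Inf_greatest) (auto simp: path_in_def)

lemma ball_control:
  fixes c0 :: "real \<Rightarrow> real ^ 'd"
  assumes c0: "c0 \<in> Imm n"
  shows "\<exists>m>0. \<exists>M\<ge>0. \<exists>C>0. \<forall>r\<le>R. \<forall>c \<in> geod_ball a n c0 r. c \<in> Imm n \<and> (\<forall>\<theta>. speed c \<theta> \<ge> m) \<and> Hn_norm n c \<le> M \<and>
    Hn_norm n (\<lambda>x. c x - c0 x) \<le> C * r"
proof -
  obtain m0 where m0: "m0 > 0" "\<forall>\<theta>. speed c0 \<theta> \<ge> m0" using Imm_min_speed[OF c0 order] by blast
  obtain m M C where C: "m > 0" "M \<ge> 0" "C > 0" "\<And>p :: real \<Rightarrow> real \<Rightarrow> real ^ 'd. controlled_path m0 (Hn_norm n c0) R p \<Longrightarrow>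
    (\<forall>\<theta>. speed (p 1) \<theta> \<ge> m) \<and> Hn_norm n (p 1) \<le> M \<and> Hn_norm n (\<lambda>x. p 1 x - p 0 x) \<le> C * path_len a n p"
    using controlled_path_estimate[OF m0(1), of "Hn_norm n c0" R] by blast
  have "c \<in> Imm n \<and> (\<forall>\<theta>. speed c \<theta> \<ge> m) \<and> Hn_norm n c \<le> M \<and> Hn_norm n (\<lambda>x. c x - c0 x) \<le> C * r"
    if r: "r \<le> R" and c: "c \<in> geod_ball a n c0 r" for r c
  proof -
    have "geod_dist a n c0 c < ereal r" using c by (simp add: geod_ball_def)
    then obtain p where p: "path_in p" "p 0 = c0" "p 1 = c" "path_len a n p < r" by (rule geod_dist_lessE)
    have "controlled_path m0 (Hn_norm n c0) R p" using p r m0 by (simp add: controlled_path_def)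
    from C(4)[OF this] have "(\<forall>\<theta>. speed c \<theta> \<ge> m) \<and> Hn_norm n c \<le> M \<and> Hn_norm n (\<lambda>x. c x - c0 x) \<le> C * path_len a n p"
      by (simp add: p)
    moreover have "C * path_len a n p \<le> C * r" using p(4) C(3) by (intro mult_left_mono) auto
    moreover have "c \<in> Imm n" using c by (simp add: geod_ball_def)
    ultimately show ?thesis by auto
  qed
  then show ?thesis using C(1,2,3) by blast
qed

text \<open>
  For a path of length at most 1 from \<open>c1\<close> to \<open>c2\<close> the a priori estimate applies, because \<open>c1\<close> is controlled
  by a path from \<open>c0\<close>.  For a longer path, the diameter \<open>2 M\<close> of the ball in \<open>H\<^sup>n\<close> is at most \<open>2 M\<close> times its
  length.
\<close>

theorem Hn_norm_le_geod_dist: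
  fixes c0 :: "real \<Rightarrow> real ^ 'd"
  assumes c0: "c0 \<in> Imm n"
  shows "\<exists>C. \<forall>c1 \<in> geod_ball a n c0 r. \<forall>c2 \<in> geod_ball a n c0 r.
    ereal (Hn_norm n (\<lambda>\<theta>. c1 \<theta> - c2 \<theta>)) \<le> ereal C * geod_dist a n c1 c2"
proof -
  obtain m M C0 where ball: "m > 0" "M \<ge> 0" "C0 > 0"
    "\<And>r' c. r' \<le> r \<Longrightarrow> c \<in> geod_ball a n c0 r' \<Longrightarrow> c \<in> Imm n \<and> (\<forall>\<theta>. speed c \<theta> \<ge> m) \<and> Hn_norm n c \<le> M \<and>
      Hn_norm n (\<lambda>x. c x - c0 x) \<le> C0 * r'"
    using ball_control[OF c0, of r] by blast
  obtain m' M' C1 where C1: "m' > 0" "M' \<ge> 0" "C1 > 0" "\<And>p :: real \<Rightarrow> real \<Rightarrow> real ^ 'd. controlled_path m M 1 p \<Longrightarrow>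
    (\<forall>\<theta>. speed (p 1) \<theta> \<ge> m') \<and> Hn_norm n (p 1) \<le> M' \<and> Hn_norm n (\<lambda>x. p 1 x - p 0 x) \<le> C1 * path_len a n p"
    using controlled_path_estimate[OF ball(1), of M 1] by blast
  define C where "C = max C1 (2 * M)"
  have C: "C > 0" using C1(3) by (simp add: C_def)
  have "ereal (Hn_norm n (\<lambda>\<theta>. c1 \<theta> - c2 \<theta>)) \<le> ereal C * geod_dist a n c1 c2"
    if c1: "c1 \<in> geod_ball a n c0 r" and c2: "c2 \<in> geod_ball a n c0 r" for c1 c2
  proof -
    note b1 = ball(4)[OF order_refl c1] and b2 = ball(4)[OF order_refl c2]
    have H: "c1 \<in> Hn n" "c2 \<in> Hn n" using b1 b2 Imm_Hn by auto
    have "ereal (Hn_norm n (\<lambda>\<theta>. c1 \<theta> - c2 \<theta>) / C) \<le> geod_dist a n c1 c2"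
    proof (rule geod_dist_ge)
      fix p assume p: "path_in p" "p 0 = c1" "p 1 = c2"
      have "Hn_norm n (\<lambda>\<theta>. c1 \<theta> - c2 \<theta>) \<le> C * path_len a n p"
      proof (cases "path_len a n p \<le> 1")
        case True
        then have "controlled_path m M 1 p" using p b1 by (simp add: controlled_path_def)
        from C1(4)[OF this] have "Hn_norm n (\<lambda>\<theta>. c2 \<theta> - c1 \<theta>) \<le> C1 * path_len a n p" using p by simp
        also have "\<dots> \<le> C * path_len a n p"
          using path_len_nonneg[OF p(1)] by (intro mult_right_mono) (auto simp: C_def)
        finally show ?thesis using Hn_norm_diff_commute[OF H n1] by simp
      next
        case False
        have "Hn_norm n (\<lambda>\<theta>. c1 \<theta> + - c2 \<theta>) \<le> Hn_norm n c1 + Hn_norm n (\<lambda>\<theta>. - c2 \<theta>)"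
          using Hn_scaleR[OF H(2) n1, of "-1"] by (intro Hn_norm_triangle[OF H(1) _ n1]) simp
        then have "Hn_norm n (\<lambda>\<theta>. c1 \<theta> - c2 \<theta>) \<le> 2 * M"
          using Hn_norm_minus[OF H(2) n1] b1 b2 by simp
        also have "\<dots> \<le> C * 1" by (simp add: C_def)
        also have "\<dots> \<le> C * path_len a n p" using C False by (intro mult_left_mono) auto
        finally show ?thesis .
      qed
      then show "Hn_norm n (\<lambda>\<theta>. c1 \<theta> - c2 \<theta>) / C \<le> path_len a n p"
        using C by (simp add: divide_le_eq mult.commute)
    qed
    then have "ereal C * ereal (Hn_norm n (\<lambda>\<theta>. c1 \<theta> - c2 \<theta>) / C) \<le> ereal C * geod_dist a n c1 c2"
      using C by (intro ereal_mult_left_mono) auto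
    then show ?thesis using C by simp
  qed
  then show ?thesis by blast
qed

text \<open>
  The difference quotients of an affine path are constant, so no limit is involved.
\<close>

lemma segment_smooth:
  fixes c1 c2 :: "real \<Rightarrow> real ^ 'd"
  assumes c: "c1 \<in> Hn n" "c2 \<in> Hn n"
  defines "p \<equiv> \<lambda>t x. c1 x + t *\<^sub>R (c2 x - c1 x)"
  shows "Hn_has_derivative n p (\<lambda>x. c2 x - c1 x) t {0..1}" "Hn_smooth_on n p {0..1}"
proof -
  have d: "(\<lambda>x. c2 x - c1 x) \<in> Hn n" using Hn_diff[OF c(2,1) n1] .
  have pH: "p s \<in> Hn n" for s unfolding p_def using Hn_add[OF c(1) Hn_scaleR[OF d n1] n1] .
  have quot: "((\<lambda>s. Hn_norm n (\<lambda>\<theta>. (1 / (s - t)) *\<^sub>R (q s \<theta> - q t \<theta>) - v \<theta>)) \<longlongrightarrow> 0) (at t within S)"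
    if "\<And>s \<theta>. q s \<theta> - q t \<theta> = (s - t) *\<^sub>R v \<theta>" for q :: "real \<Rightarrow> real \<Rightarrow> real ^ 'd" and v t S
  proof (rule tendsto_eventually)
    have "\<forall>\<^sub>F s in at t within S. s \<noteq> t" by (simp add: eventually_at_filter)
    then show "\<forall>\<^sub>F s in at t within S. Hn_norm n (\<lambda>\<theta>. (1 / (s - t)) *\<^sub>R (q s \<theta> - q t \<theta>) - v \<theta>) = 0"
    proof eventually_elim
      case (elim s)
      then show ?case unfolding that by (simp add: Hn_norm_zero[OF n1])
    qed
  qed
  have p1: "Hn_has_derivative n p (\<lambda>x. c2 x - c1 x) t {0..1}" for t
    unfolding Hn_has_derivative_def using d pH
    by (intro conjI ballI quot) (auto simp: p_def scaleR_diff_left)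
  then show "Hn_has_derivative n p (\<lambda>x. c2 x - c1 x) t {0..1}" .
  \<comment> \<open>all derivatives of order at least two vanish\<close>
  define D where "D k = (if k = 0 then p else if k = 1 then \<lambda>_ x. c2 x - c1 x else (\<lambda>_ _. 0))" for k :: nat
  have const: "Hn_has_derivative n (\<lambda>_. h) (\<lambda>_. 0) t {0..1}" if "h \<in> Hn n" for h :: "real \<Rightarrow> real ^ 'd" and t
    unfolding Hn_has_derivative_def using that Hn_zero[OF n1] by (intro conjI ballI quot) auto
  have "Hn_has_derivative n (D k) (D (Suc k) t) t {0..1}" for k t
    using p1 const[OF d] const[OF Hn_zero[OF n1]] by (cases k) (auto simp: D_def)
  then show "Hn_smooth_on n p {0..1}" unfolding Hn_smooth_on_def by (intro exI[of _ D]) (simp add: D_def)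
qed

text \<open>
  The radius is chosen so that the ball lies within \<open>m0 / 4\<close> of \<open>c0\<close> in \<open>H\<^sup>n\<close>.  Tangents then differ from the
  one of \<open>c0\<close> by at most \<open>m0 / 2\<close>, also on segments between points of the ball, whose speed is thus at least
  \<open>m0 / 2\<close>.
\<close>

theorem geod_dist_le_Hn_norm:
  fixes c0 :: "real \<Rightarrow> real ^ 'd"
  assumes c0: "c0 \<in> Imm n"
  shows "\<exists>r>0. \<exists>C. \<forall>c1 \<in> geod_ball a n c0 r. \<forall>c2 \<in> geod_ball a n c0 r.
    geod_dist a n c1 c2 \<le> ereal C * ereal (Hn_norm n (\<lambda>\<theta>. c1 \<theta> - c2 \<theta>))"
proof -
  obtain m0 where m0: "m0 > 0" "\<forall>\<theta>. speed c0 \<theta> \<ge> m0" using Imm_min_speed[OF c0 order] by blast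
  obtain m M C0 where ball: "m > 0" "M \<ge> 0" "C0 > 0"
    "\<And>r' c. r' \<le> 1 \<Longrightarrow> c \<in> geod_ball a n c0 r' \<Longrightarrow> c \<in> Imm n \<and> (\<forall>\<theta>. speed c \<theta> \<ge> m) \<and> Hn_norm n c \<le> M \<and>
      Hn_norm n (\<lambda>x. c x - c0 x) \<le> C0 * r'"
    using ball_control[OF c0, of 1] by blast
  define r where "r = min 1 (m0 / (4 * C0))"
  have r: "r > 0" "r \<le> 1" using m0 ball(3) by (auto simp: r_def)
  have "C0 * r \<le> C0 * (m0 / (4 * C0))" using ball(3) by (intro mult_left_mono) (auto simp: r_def)
  also have "\<dots> = m0 / 4" using ball(3) by simp
  finally have C0r: "C0 * r \<le> m0 / 4" .
  have m2: "m0 / 2 > 0" using m0 by simp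
  obtain C where C: "C \<ge> 0" "\<And>c h :: real \<Rightarrow> real ^ 'd. c \<in> Imm n \<Longrightarrow> h \<in> Hn n \<Longrightarrow> \<forall>\<theta>. speed c \<theta> \<ge> m0 / 2 \<Longrightarrow>
    Hn_norm n c \<le> M \<Longrightarrow> sqrt (sobolev_metric a n c h h) \<le> C * Hn_norm n h"
    using metric_upper[OF m2, of M] by blast
  have c0H: "c0 \<in> Hn n" using Imm_Hn[OF c0] .
  have "geod_dist a n c1 c2 \<le> ereal C * ereal (Hn_norm n (\<lambda>\<theta>. c1 \<theta> - c2 \<theta>))"
    if c1: "c1 \<in> geod_ball a n c0 r" and c2: "c2 \<in> geod_ball a n c0 r" for c1 c2
  proof -
    note b1 = ball(4)[OF r(2) c1] and b2 = ball(4)[OF r(2) c2]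
    have H: "c1 \<in> Hn n" "c2 \<in> Hn n" using b1 b2 Imm_Hn by auto
    define p where "p = (\<lambda>t x. c1 x + t *\<^sub>R (c2 x - c1 x))"
    have pH: "p t \<in> Hn n" for t
      unfolding p_def using Hn_add[OF H(1) Hn_scaleR[OF Hn_diff[OF H(2,1) n1] n1] n1] .
    have convex: "Hn_norm n (\<lambda>x. (1 - t) *\<^sub>R f x + t *\<^sub>R g x) \<le> A"
      if "t \<in> {0..1}" "f \<in> Hn n" "g \<in> Hn n" "Hn_norm n f \<le> A" "Hn_norm n g \<le> A" for t A and f g :: "real \<Rightarrow> real ^ 'd"
    proof -
      have "Hn_norm n (\<lambda>x. (1 - t) *\<^sub>R f x + t *\<^sub>R g x) \<le> \<bar>1 - t\<bar> * Hn_norm n f + \<bar>t\<bar> * Hn_norm n g"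
        using Hn_norm_triangle[OF Hn_scaleR[OF that(2) n1] Hn_scaleR[OF that(3) n1] n1, of "1 - t" t]
        by (simp add: Hn_norm_scaleR[OF that(2) n1] Hn_norm_scaleR[OF that(3) n1])
      also have "\<dots> \<le> (1 - t) * A + t * A" using that by (intro add_mono mult_mono) (auto simp: Hn_norm_nonneg)
      also have "\<dots> = A" by (simp add: algebra_simps)
      finally show ?thesis .
    qed
    have pM: "Hn_norm n (p t) \<le> M" if t: "t \<in> {0..1}" for t
    proof -
      have "p t = (\<lambda>x. (1 - t) *\<^sub>R c1 x + t *\<^sub>R c2 x)" by (auto simp: p_def algebra_simps)
      then show ?thesis using convex[OF t H, of M] b1 b2 by simp
    qed
    have pc0: "Hn_norm n (\<lambda>x. p t x - c0 x) \<le> C0 * r" if t: "t \<in> {0..1}" for t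
    proof -
      have "(\<lambda>x. p t x - c0 x) = (\<lambda>x. (1 - t) *\<^sub>R (c1 x - c0 x) + t *\<^sub>R (c2 x - c0 x))"
        by (auto simp: p_def algebra_simps)
      then show ?thesis
        using convex[OF t Hn_diff[OF H(1) c0H n1] Hn_diff[OF H(2) c0H n1], of "C0 * r"] b1 b2 by simp
    qed
    have sp: "speed (p t) \<theta> \<ge> m0 / 2" if t: "t \<in> {0..1}" for t \<theta>
      using speed_diff_le(2)[OF pH c0H, of t \<theta>] pc0[OF t] C0r m0(2)[rule_format, of \<theta>] by linarith
    have pI: "p t \<in> Imm n" if "t \<in> {0..1}" for t using ImmI[OF pH sp[OF that] m2] .
    note smooth = segment_smooth[OF H, folded p_def]
    have "piecewise_smooth_path n p"
      unfolding piecewise_smooth_path_def using smooth(2)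
      by (intro exI[of _ 1] exI[of _ "\<lambda>i. real i"]) auto
    then have path: "path_in p" using pI by (simp add: path_in_def)
    have vel: "Hn_velocity n p t = (\<lambda>x. c2 x - c1 x)" if t: "t \<in> {0..1}" for t
    proof (rule Hn_derivative_unique[OF n1 _ smooth(1) t])
      show "Hn_has_derivative n p (Hn_velocity n p t) t {0..1}"
        unfolding Hn_velocity_def using smooth(1) by (rule someI[where P = "\<lambda>v. Hn_has_derivative n p v t {0..1}"])
      show "at t within {0..1} \<noteq> bot" using t by (simp add: trivial_limit_within)
    qed
    let ?F = "\<lambda>t. sqrt (sobolev_metric a n (p t) (Hn_velocity n p t) (Hn_velocity n p t))"
    have d: "(\<lambda>x. c2 x - c1 x) \<in> Hn n" using Hn_diff[OF H(2,1) n1] .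
    have "smooth_piece p (\<lambda>_ x. c2 x - c1 x) {0..1}"
      unfolding smooth_piece_def
    proof (intro conjI ballI exI[of _ "\<lambda>_ _. 0"])
      fix t :: real
      show "Hn_has_derivative n (\<lambda>_ x. c2 x - c1 x) (\<lambda>_. 0) t {0..1}"
        using segment_smooth(1)[OF d d] by simp
    qed (use pI smooth(1) in auto)
    from path_speed_integral[OF path this order_refl order_refl zero_le_one order_refl]
    have "?F integrable_on {0..1}" by (auto simp: metric_norm_def)
    then have "path_len a n p \<le> integral {0..1} (\<lambda>t::real. C * Hn_norm n (\<lambda>x. c2 x - c1 x))"
      unfolding path_len_def
    proof (rule integral_le)
      fix t :: real assume t: "t \<in> {0..1}"
      show "?F t \<le> C * Hn_norm n (\<lambda>x. c2 x - c1 x)"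
        unfolding vel[OF t] using C(2)[OF pI[OF t] d _ pM[OF t]] sp[OF t] by blast
    qed auto
    also have "\<dots> = C * Hn_norm n (\<lambda>x. c1 x - c2 x)"
      using Hn_norm_diff_commute[OF H n1] by simp
    finally have "ereal (path_len a n p) \<le> ereal C * ereal (Hn_norm n (\<lambda>x. c1 x - c2 x))" by simp
    moreover have "p 0 = c1" "p 1 = c2" by (auto simp: p_def)
    ultimately show ?thesis using geod_dist_le[OF path] by (metis order_trans)
  qed
  then show ?thesis using r(1) by blast
qed

end

theorem lemma4p2:
  fixes n :: nat and a :: "nat \<Rightarrow> real"
  assumes "n \<ge> 2"
    and "\<forall>j\<le>n. a j \<ge> 0" and "a 0 > 0" and "a n > 0"
  shows "(\<forall>c0 \<in> (Imm n :: (real \<Rightarrow> real ^ 'd) set). \<forall>r::real. \<exists>C::real.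
            \<forall>c1 \<in> geod_ball a n c0 r. \<forall>c2 \<in> geod_ball a n c0 r.
              ereal (Hn_norm n (\<lambda>\<theta>. c1 \<theta> - c2 \<theta>)) \<le> ereal C * geod_dist a n c1 c2) \<and>
         (\<forall>c0 \<in> (Imm n :: (real \<Rightarrow> real ^ 'd) set). \<exists>r::real. r > 0 \<and> (\<exists>C::real.
            \<forall>c1 \<in> geod_ball a n c0 r. \<forall>c2 \<in> geod_ball a n c0 r.
              geod_dist a n c1 c2 \<le> ereal C * ereal (Hn_norm n (\<lambda>\<theta>. c1 \<theta> - c2 \<theta>))))"
proof -
  interpret sobolev_coefficients n a
    using assms by unfold_locales auto
  show ?thesis using Hn_norm_le_geod_dist geod_dist_le_Hn_norm by blast
qed

end
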